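(* Let $\Lambda(z)=1+\sum_{j\ge1}\lambda_j z^j$ be analytic at $z=0$, with all $\lambda_j\ge0$ and $\lambda_1>0$. Define $F(z,v)=\sum_{n\ge0}P_n(v)z^n:=\sum_{k\ge0}\prod_{1\le j\le k}\bigl(1-\frac{1}{1+v(\Lambda(z)^j-1)}\bigr)$ and let $X_n$ be the random variable with $\mathbb{P}(X_n=k)=[v^k]P_n(v)/P_n(1)$. Then, with $(\mu,\sigma^2)=\bigl(\frac{6}{\pi^2},\frac{3(12-\pi^2)}{\pi^4}\bigr)$, $$\mathbb E(X_n)=\mu\Bigl(n+\frac32\Bigr)-\frac{\lambda_2}{\lambda_1^2}+O(n^{-1}),\qquad \mathbb V(X_n)=\sigma^2\Bigl(n+\frac32\Bigr)-\frac14+\frac{\lambda_2}{2\lambda_1^2}+O(n^{-1}).$$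
   Context: A Fishburn matrix (FM) is an upper-triangular square matrix with nonnegative integer entries and no zero row or zero column; size = sum of entries, dimension = number of rows. For nonnegative integers $\lambda_j$, a $\Lambda$-FM is an FM whose nonzero entries of value $j$ each carry one of $\lambda_j$ labels; then $[z^nv^k]F(z,v)$ counts $\Lambda$-FMs of size $n$ and dimension $k$, so $X_n$ is the dimension of a uniformly random $\Lambda$-FM of size $n$. In general the $\lambda_j$ are arbitrary nonnegative reals and $X_n$ is defined via the generating function. *)

theory Defs
  imports "HOL-Probability.Probability" "HOL-Library.Landau_Symbols"
    "HOL-Computational_Algebra.Computational_Algebra"
begin

text \<open>
  Power series in \<open>z\<close> are values of type \<open>real fps\<close>; series in \<open>z\<close> whose coefficients are
  polynomials in \<open>v\<close> are values of type \<open>real poly fps\<close>.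
\<close>

definition Lambda_fps :: "(nat \<Rightarrow> real) \<Rightarrow> real fps" where
  "Lambda_fps lam = Abs_fps (\<lambda>j. if j = 0 then 1 else lam j)"

definition fps_lift_poly :: "real fps \<Rightarrow> real poly fps" where
  "fps_lift_poly f = Abs_fps (\<lambda>n. [:fps_nth f n:])"

definition v_fps :: "real poly fps" where
  "v_fps = fps_const [:0, 1:]"

text \<open>
  The type \<open>real poly fps\<close> carries no \<open>inverse\<close> operation. For a series \<open>f\<close> with constant
  coefficient \<open>1\<close>, \<open>fps_right_inverse f 1\<close> is its (unique, two-sided) multiplicative inverse.
\<close>

definition Fishburn_factor :: "(nat \<Rightarrow> real) \<Rightarrow> nat \<Rightarrow> real poly fps" where
  "Fishburn_factor lam j =
     1 - fps_right_inverse (1 + v_fps * (fps_lift_poly (Lambda_fps lam) ^ j - 1)) 1"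

text \<open>
  The infinite sum is taken in the \<open>z\<close>-adic topology of formal power series; the \<open>k\<close>-th term is
  divisible by \<open>z ^ k\<close>. In general the series in \<open>z\<close> has radius of convergence 0, so it is
  inherently formal.
\<close>

definition Fishburn_gf :: "(nat \<Rightarrow> real) \<Rightarrow> real poly fps" where
  "Fishburn_gf lam = (\<Sum>k. \<Prod>j=1..k. Fishburn_factor lam j)"

definition Fishburn_poly :: "(nat \<Rightarrow> real) \<Rightarrow> nat \<Rightarrow> real poly" where
  "Fishburn_poly lam n = fps_nth (Fishburn_gf lam) n"

end

(*
  Put q = 1/Lambda(z) = exp(-t). The first two derivatives of F(z,v) at v = 1
  turn out to be rational functions of q times F(z,1), plus rational functions of q. By Zagier's identity
  for the sum of (1-q)(1-q^2)...(1-q^k), the power series F(z,1) in t is exp(t/24) times a series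
  whose coefficients are (2k+1)!/k! (3/(2 pi^2))^k up to a convergent factor with an exponentially
  small error. Hence F(z,1) satisfies, up to negligible terms, a first-order linear differential
  equation in t. Such equations survive the substitution t = log Lambda(z) (a convergent power series),
  and they turn the two moments into F(z,1) and its first two logarithmic derivatives z d/dz, i.e. into
  polynomials in n, plus corrections by shifted coefficients. A two-term expansion of the ratio of
  consecutive coefficients then gives mean and variance up to O(1/n).
*)
theory Submission
  imports Defs "HOL-Complex_Analysis.Complex_Analysis" "HOL-Real_Asymp.Real_Asymp"
begin

unbundle no vec_syntax

section \<open>The generating function and its derivatives at v = 1\<close>

text \<open>F(z,1) in general has radius of convergence 0, so there is no function to analyse. Sizes
  are measured on coefficients: \<open>fps_bigo s e\<close> means O(s_n n^e) for a weight s of at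
  least factorial growth. In this scale multiplication by X gains a factor 1/n, \<open>theta\<close>
  = z d/dz loses n, convergent factors cost nothing and convergent summands are negligible. Under t
  = log Lambda(z) infinitely many coefficients contribute already at leading order, whereas a
  differential equation only undergoes the chain rule. Summing over all contributions is needed
  once, to see that the coefficients of F(z,1) divided by s_n have a nonzero limit; bounds relative
  to s_n then become bounds relative to these coefficients. The precision is dictated by the
  variance: the mean has order n, so its square is known up to O(1/n) only if the mean is known up
  to O(1/n^2). The derivative identities carry the factors 1 - q and (1 - q)(1 - q^2), which vanish
  at t = 0 to orders 1 and 2; dividing by them loses n and n^2. Hence the equation for F(z,1) is
  established with error exponent -3.\<close>

definition fps_vsum :: "(nat \<Rightarrow> 'a::comm_ring_1 fps) \<Rightarrow> 'a fps" where
  "fps_vsum T = Abs_fps (\<lambda>n. \<Sum>k\<le>n. T k $ n)"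

text \<open>Term k is divisible by X^k. For such families the triangular truncation in
  \<open>fps_vsum\<close> is the X-adic sum, and multiplication, derivatives in v and composition
  reduce to finite sums.\<close>

definition vanishing :: "(nat \<Rightarrow> 'a::comm_ring_1 fps) \<Rightarrow> bool" where
  "vanishing T \<longleftrightarrow> (\<forall>k n. n < k \<longrightarrow> T k $ n = 0)"

lemma vanishingD: "vanishing T \<Longrightarrow> n < k \<Longrightarrow> T k $ n = 0"
  by (simp add: vanishing_def)

lemma fps_vsum_nth:
  assumes "vanishing T" "n \<le> N"
  shows "fps_vsum T $ n = (\<Sum>k\<le>N. T k) $ n"
proof -
  have "(\<Sum>k\<le>N. T k) $ n = (\<Sum>k\<le>N. T k $ n)" by (simp add: fps_sum_nth)
  also have "\<dots> = (\<Sum>k\<le>n. T k $ n)"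
    using assms by (intro sum.mono_neutral_right) (auto intro: vanishingD)
  finally show ?thesis by (simp add: fps_vsum_def)
qed

lemma vanishing_mult: "vanishing T \<Longrightarrow> vanishing (\<lambda>k. c k * T k)"
  by (auto simp: vanishing_def fps_mult_nth intro!: sum.neutral)

lemma vanishing_prod:
  assumes "\<And>j. j \<ge> 1 \<Longrightarrow> f j $ 0 = 0"
  shows "vanishing (\<lambda>k. \<Prod>j=1..k. f j)"
proof -
  have "n < k \<Longrightarrow> (\<Prod>j=1..k. f j) $ n = 0" for k n
  proof (induction k arbitrary: n)
    case (Suc k)
    have "(\<Prod>j=1..k. f j) $ i * f (Suc k) $ (n - i) = 0" if "i \<le> n" for i
      using that Suc assms[of "Suc k"] by (cases "i < k") auto
    then show ?case by (simp add: fps_mult_nth sum.neutral)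
  qed simp
  then show ?thesis by (simp add: vanishing_def)
qed

lemma fps_vsum_mult:
  assumes "vanishing T"
  shows "c * fps_vsum T = fps_vsum (\<lambda>k. c * T k)"
proof (rule fps_ext)
  fix n
  have "(c * fps_vsum T) $ n = (c * (\<Sum>k\<le>n. T k)) $ n"
    unfolding fps_mult_nth by (intro sum.cong refl) (simp add: fps_vsum_nth[OF assms, of _ n])
  then show "(c * fps_vsum T) $ n = fps_vsum (\<lambda>k. c * T k) $ n"
    by (simp add: fps_vsum_nth[OF vanishing_mult[OF assms] order_refl] sum_distrib_left)
qed

lemma fps_vsum_add: "fps_vsum T + fps_vsum U = fps_vsum (\<lambda>k. T k + U k)"
  by (rule fps_ext) (simp add: fps_vsum_def sum.distrib)

lemma fps_vsum_diff: "fps_vsum T - fps_vsum U = fps_vsum (\<lambda>k. T k - U k)"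
  by (rule fps_ext) (simp add: fps_vsum_def sum_subtractf)

lemma fps_vsum_telescope:
  assumes "vanishing u"
  shows "fps_vsum (\<lambda>k. u k - u (Suc k)) = u 0"
proof (rule fps_ext)
  fix n
  have "(\<Sum>k\<le>N. u k $ n - u (Suc k) $ n) = u 0 $ n - u (Suc N) $ n" for N
    by (induction N) simp_all
  then show "fps_vsum (\<lambda>k. u k - u (Suc k)) $ n = u 0 $ n"
    using assms by (simp add: fps_vsum_def vanishing_def)
qed

lemma fps_vsum_compose:
  assumes "vanishing T" "L $ 0 = 0"
  shows "fps_vsum T oo L = fps_vsum (\<lambda>k. T k oo L)"
proof (rule fps_ext)
  fix n
  have v: "(L ^ i) $ n = 0" if "n < i" for i n
    using that assms(2) by (simp add: startsby_zero_power_prefix)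
  have "(fps_vsum T oo L) $ n = (\<Sum>i=0..n. (\<Sum>k\<le>n. T k $ i * (L ^ i) $ n))"
    unfolding fps_compose_nth
    by (intro sum.cong refl) (simp add: fps_vsum_nth[OF assms(1), of _ n] fps_sum_nth sum_distrib_right)
  also have "\<dots> = (\<Sum>k\<le>n. (T k oo L) $ n)"
    unfolding fps_compose_nth by (rule sum.swap)
  finally show "(fps_vsum T oo L) $ n = fps_vsum (\<lambda>k. T k oo L) $ n"
    by (simp add: fps_vsum_def)
qed

text \<open>Links the truncated sum to the topological sum in the definition of
  \<open>Fishburn_gf\<close>: each coefficient of the partial sums is eventually constant.\<close>

lemma vanishing_sums:
  assumes "vanishing (T :: nat \<Rightarrow> real poly fps)"
  shows "T sums fps_vsum T"
  unfolding sums_def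
proof (rule tendsto_fpsI)
  fix n
  show "eventually (\<lambda>N. (\<Sum>k<N. T k) $ n = fps_vsum T $ n) sequentially"
  proof (rule eventually_sequentiallyI)
    fix N assume "N \<ge> Suc n"
    then obtain M where "N = Suc M" "M \<ge> n" by (cases N) auto
    then show "(\<Sum>k<N. T k) $ n = fps_vsum T $ n"
      by (simp add: fps_vsum_nth[OF assms, of n M] lessThan_Suc_atMost del: sum.lessThan_Suc)
  qed
qed

section \<open>Value and first two derivatives in v at v = 1\<close>

definition fps_at1 :: "real poly fps \<Rightarrow> real fps" where
  "fps_at1 f = Abs_fps (\<lambda>n. poly (f $ n) 1)"
definition fps_d1 :: "real poly fps \<Rightarrow> real fps" where
  "fps_d1 f = Abs_fps (\<lambda>n. poly (pderiv (f $ n)) 1)"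
definition fps_d2 :: "real poly fps \<Rightarrow> real fps" where
  "fps_d2 f = Abs_fps (\<lambda>n. poly (pderiv (pderiv (f $ n))) 1)"

lemmas fps_dv_defs = fps_at1_def fps_d1_def fps_d2_def

lemma fps_dv_add [simp]:
  "fps_at1 (f + g) = fps_at1 f + fps_at1 g" "fps_d1 (f + g) = fps_d1 f + fps_d1 g" "fps_d2 (f + g) = fps_d2 f + fps_d2 g"
  by (simp_all add: fps_dv_defs fps_eq_iff pderiv_add)

lemma fps_dv_diff [simp]:
  "fps_at1 (f - g) = fps_at1 f - fps_at1 g" "fps_d1 (f - g) = fps_d1 f - fps_d1 g" "fps_d2 (f - g) = fps_d2 f - fps_d2 g"
  by (simp_all add: fps_dv_defs fps_eq_iff pderiv_diff)

lemma fps_dv_one [simp]: "fps_at1 1 = 1" "fps_d1 1 = 0" "fps_d2 1 = 0"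
  by (simp_all add: fps_dv_defs fps_eq_iff pderiv_1)

lemma pderiv_sum': "pderiv (sum f A) = (\<Sum>x\<in>A. pderiv (f x))"
  by (induction A rule: infinite_finite_induct) (auto simp: pderiv_add)

lemma fps_dv_mult [simp]:
  "fps_at1 (f * g) = fps_at1 f * fps_at1 g"
  "fps_d1 (f * g) = fps_d1 f * fps_at1 g + fps_at1 f * fps_d1 g"
  "fps_d2 (f * g) = fps_d2 f * fps_at1 g + 2 * (fps_d1 f * fps_d1 g) + fps_at1 f * fps_d2 g"
  unfolding fps_dv_defs fps_eq_iff numeral_fps_const fps_add_nth fps_mult_left_const_nth
  by (simp_all add: fps_mult_nth pderiv_sum' poly_sum pderiv_mult pderiv_add numeral_fps_const fps_mult_left_const_nth sum.distrib)
     (simp_all add: sum.distrib sum_distrib_left algebra_simps)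

lemma fps_dv_vsum:
  "fps_at1 (fps_vsum T) = fps_vsum (\<lambda>k. fps_at1 (T k))"
  "fps_d1 (fps_vsum T) = fps_vsum (\<lambda>k. fps_d1 (T k))"
  "fps_d2 (fps_vsum T) = fps_vsum (\<lambda>k. fps_d2 (T k))"
  by (simp_all add: fps_dv_defs fps_eq_iff fps_vsum_def pderiv_sum' poly_sum)

lemma vanishing_dv:
  assumes "vanishing T"
  shows "vanishing (\<lambda>k. fps_at1 (T k))" "vanishing (\<lambda>k. fps_d1 (T k))" "vanishing (\<lambda>k. fps_d2 (T k))"
  using assms by (auto simp: vanishing_def fps_dv_defs)

lemma fps_dv_lift_power [simp]:
  "fps_at1 (fps_lift_poly f ^ j) = f ^ j" "fps_d1 (fps_lift_poly f ^ j) = 0" "fps_d2 (fps_lift_poly f ^ j) = 0"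
proof -
  have *: "fps_at1 (fps_lift_poly f) = f" "fps_d1 (fps_lift_poly f) = 0" "fps_d2 (fps_lift_poly f) = 0"
    by (simp_all add: fps_dv_defs fps_lift_poly_def fps_eq_iff pderiv_pCons)
  show "fps_at1 (fps_lift_poly f ^ j) = f ^ j" "fps_d1 (fps_lift_poly f ^ j) = 0" "fps_d2 (fps_lift_poly f ^ j) = 0"
    by (induction j) (simp_all add: *)
qed

lemma fps_dv_v [simp]: "fps_at1 v_fps = 1" "fps_d1 v_fps = 1" "fps_d2 v_fps = 0"
  by (simp_all add: fps_dv_defs v_fps_def fps_eq_iff pderiv_pCons)

lemma Lambda_fps_nth: "Lambda_fps lam $ 0 = 1" "Lambda_fps lam $ Suc n = lam (Suc n)"
  by (simp_all add: Lambda_fps_def)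

lemma lift_power_nth_0: "(fps_lift_poly (Lambda_fps lam) ^ j) $ 0 = 1"
  by (induction j) (simp_all add: fps_lift_poly_def Lambda_fps_nth one_pCons)

lemma Fishburn_factor_nth_0: "Fishburn_factor lam j $ 0 = 0"
  by (simp add: Fishburn_factor_def)

text \<open>The inverse is not computed: \<open>A * R = 1\<close> is differentiated twice at v = 1,
  where A is affine in v with value P and slope P - 1, and each equation is solved for R using Q P =
  1.\<close>

lemma Fishburn_factor_dv:
  fixes lam defines "q \<equiv> inverse (Lambda_fps lam)"
  shows "fps_at1 (Fishburn_factor lam j) = 1 - q ^ j"
    and "fps_d1 (Fishburn_factor lam j) = q ^ j - (q ^ j)\<^sup>2"
    and "fps_d2 (Fishburn_factor lam j) = - 2 * q ^ j * (1 - q ^ j)\<^sup>2"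
proof -
  define A where "A = 1 + v_fps * (fps_lift_poly (Lambda_fps lam) ^ j - 1)"
  define R where "R = fps_right_inverse A 1"
  have A0: "A $ 0 = 1" by (simp add: A_def lift_power_nth_0)
  have AR: "A * R = 1" unfolding R_def by (rule fps_right_inverse) (simp add: A0)
  define P where "P = Lambda_fps lam ^ j"
  define Q where "Q = q ^ j"
  have "q * Lambda_fps lam = 1"
    unfolding q_def by (rule inverse_mult_eq_1) (simp add: Lambda_fps_nth)
  then have PQ: "Q * P = 1" unfolding P_def Q_def by (metis power_mult_distrib power_one)
  have A: "fps_at1 A = P" "fps_d1 A = P - 1" "fps_d2 A = 0"
    by (simp_all add: A_def P_def)
  have e: "fps_at1 (A * R) = 1" "fps_d1 (A * R) = 0" "fps_d2 (A * R) = 0" by (simp_all add: AR)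
  have R0: "fps_at1 R = Q" using e(1) PQ unfolding fps_dv_mult A by algebra
  have R1: "fps_d1 R = Q\<^sup>2 - Q" using e(2) PQ unfolding fps_dv_mult A R0 by algebra
  have R2: "fps_d2 R = 2 * Q * (1 - Q)\<^sup>2" using e(3) PQ unfolding fps_dv_mult A R0 R1 by algebra
  have F: "Fishburn_factor lam j = 1 - R" by (simp add: Fishburn_factor_def R_def A_def)
  show "fps_at1 (Fishburn_factor lam j) = 1 - q ^ j"
    "fps_d1 (Fishburn_factor lam j) = q ^ j - (q ^ j)\<^sup>2"
    "fps_d2 (Fishburn_factor lam j) = - 2 * q ^ j * (1 - q ^ j)\<^sup>2"
    unfolding F by (simp_all add: R0 R1 R2 Q_def)
qed

definition Fishburn_term :: "(nat \<Rightarrow> real) \<Rightarrow> nat \<Rightarrow> real poly fps" where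
  "Fishburn_term lam k = (\<Prod>j=1..k. Fishburn_factor lam j)"

lemma Fishburn_term_Suc: "Fishburn_term lam (Suc k) = Fishburn_term lam k * Fishburn_factor lam (Suc k)"
  by (simp add: Fishburn_term_def)

lemma vanishing_term: "vanishing (Fishburn_term lam)"
  unfolding Fishburn_term_def by (rule vanishing_prod) (rule Fishburn_factor_nth_0)

lemma Fishburn_gf_eq: "Fishburn_gf lam = fps_vsum (Fishburn_term lam)"
  using sums_unique[OF vanishing_sums[OF vanishing_term]]
  unfolding Fishburn_gf_def Fishburn_term_def by (metis (no_types, lifting) )

text \<open>The q-Pochhammer symbol (q; q)_k.\<close>

definition qpoch :: "'a::comm_ring_1 \<Rightarrow> nat \<Rightarrow> 'a" where
  "qpoch q k = (\<Prod>j=1..k. 1 - q ^ j)"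

lemma qpoch_Suc: "qpoch q (Suc k) = qpoch q k * (1 - q ^ Suc k)" by (simp add: qpoch_def)

text \<open>
  With \<open>q = 1 / \<Lambda>\<close>, the \<open>k\<close>-th term is \<open>(q;q)_k / (b q;q)_k\<close> with \<open>b = 1 - 1 / v\<close>. The coefficients
  of \<open>b\<close> and \<open>b^2\<close> in \<open>1 / (b q;q)_k\<close> are complete homogeneous symmetric polynomials in
  \<open>q, ..., q^k\<close>, so they only involve \<open>q^k\<close> and \<open>q^(2 k)\<close>; the sums of \<open>(q;q)_k q^k\<close> and of
  \<open>(q;q)_k q^(2 k)\<close> telescope.
\<close>

lemma Fishburn_term_dv:
  fixes lam defines "q \<equiv> inverse (Lambda_fps lam)"
  shows "fps_at1 (Fishburn_term lam k) = qpoch q k"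
    and "(1 - q) * fps_d1 (Fishburn_term lam k) = qpoch q k * (q - q * q ^ k)"
    and "(1 - q) * (1 - q\<^sup>2) * fps_d2 (Fishburn_term lam k) =
      2 * qpoch q k * (q\<^sup>2 * (1 - q ^ k) * (1 - q * q ^ k) - (1 - q\<^sup>2) * q * (1 - q ^ k))"
proof -
  note F = Fishburn_factor_dv[of lam, folded q_def]
  show at1: "fps_at1 (Fishburn_term lam k) = qpoch q k" for k
    by (induction k) (simp_all add: Fishburn_term_Suc qpoch_Suc F, simp_all add: Fishburn_term_def qpoch_def)
  show d1: "(1 - q) * fps_d1 (Fishburn_term lam k) = qpoch q k * (q - q * q ^ k)" for k
  proof (induction k)
    case (Suc k)
    define K where "K = q ^ k"
    show ?case using Suc[folded K_def] unfolding Fishburn_term_Suc fps_dv_mult F at1 qpoch_Suc power_Suc K_def[symmetric] by algebra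
  qed (simp add: Fishburn_term_def)
  show "(1 - q) * (1 - q\<^sup>2) * fps_d2 (Fishburn_term lam k) =
      2 * qpoch q k * (q\<^sup>2 * (1 - q ^ k) * (1 - q * q ^ k) - (1 - q\<^sup>2) * q * (1 - q ^ k))"
  proof (induction k)
    case (Suc k)
    define K where "K = q ^ k"
    show ?case using Suc[folded K_def] d1[of k, folded K_def] unfolding Fishburn_term_Suc fps_dv_mult F at1 qpoch_Suc power_Suc K_def[symmetric] by algebra
  qed (simp add: Fishburn_term_def)
qed

text \<open>Summing the closed forms of the terms leaves only W and two telescoping sums. Since 1 -
  q and 1 - q^2 have constant term 0, they are not units and the identities stay multiplied
  out.\<close>

lemma Fishburn_moment_identities:
  fixes lam
  defines "q \<equiv> inverse (Lambda_fps lam)" and "W \<equiv> fps_vsum (qpoch (inverse (Lambda_fps lam)))"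
  shows "fps_at1 (Fishburn_gf lam) = W"
    and "(1 - q) * fps_d1 (Fishburn_gf lam) = q * W - 1"
    and "(1 - q) * (1 - q\<^sup>2) * fps_d2 (Fishburn_gf lam) = 2 * ((q ^ 3 + q\<^sup>2 - q) * W + q - 2 * q\<^sup>2)"
proof -
  note D = Fishburn_term_dv[of lam, folded q_def]
  note V = vanishing_dv[OF vanishing_term[of lam]]
  have W: "W = fps_vsum (qpoch q)" by (simp add: W_def q_def)
  have v: "vanishing (qpoch q)" using V(1) by (simp add: D(1))
  have v1: "vanishing (\<lambda>k. qpoch q k * q ^ k)" and v2: "vanishing (\<lambda>k. qpoch q k * (q ^ k)\<^sup>2)"
    using vanishing_mult[OF v, of "\<lambda>k. q ^ k"] vanishing_mult[OF v, of "\<lambda>k. (q ^ k)\<^sup>2"]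
    by (simp_all add: mult.commute)
  define S1 where "S1 = fps_vsum (\<lambda>k. qpoch q k * q ^ k)"
  define S2 where "S2 = fps_vsum (\<lambda>k. qpoch q k * (q ^ k)\<^sup>2)"
  show at1: "fps_at1 (Fishburn_gf lam) = W"
    by (simp add: Fishburn_gf_eq fps_dv_vsum D(1) W)
  have "q * S1 = fps_vsum (\<lambda>k. qpoch q k - qpoch q (Suc k))"
    unfolding S1_def fps_vsum_mult[OF v1] by (intro arg_cong[of _ _ fps_vsum] ext) (simp add: qpoch_Suc algebra_simps)
  also have "\<dots> = 1" using fps_vsum_telescope[OF v] by (simp add: qpoch_def)
  finally have S1: "q * S1 = 1" .
  \<comment> \<open>Telescoping with u_k = (q;q)_k q^k, for which u_k - u_(k+1) = u_k (1 - q + q^2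
    q^k).\<close>
  have "(1 - q) * S1 + q\<^sup>2 * S2 = fps_vsum (\<lambda>k. qpoch q k * q ^ k - qpoch q (Suc k) * q ^ Suc k)"
    unfolding S1_def S2_def fps_vsum_mult[OF v1] fps_vsum_mult[OF v2] fps_vsum_add
    by (intro arg_cong[of _ _ fps_vsum] ext) (simp add: qpoch_Suc algebra_simps power2_eq_square)
  also have "\<dots> = 1" using fps_vsum_telescope[OF v1] by (simp add: qpoch_def)
  finally have S2: "(1 - q) * S1 + q\<^sup>2 * S2 = 1" .
  have "(1 - q) * fps_d1 (Fishburn_gf lam) = fps_vsum (\<lambda>k. q * qpoch q k - q * (qpoch q k * q ^ k))"
    unfolding Fishburn_gf_eq fps_dv_vsum fps_vsum_mult[OF V(2)] D(2)
    by (simp add: algebra_simps)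
  also have "\<dots> = q * W - q * S1"
    unfolding W S1_def fps_vsum_mult[OF v1] fps_vsum_mult[OF v] fps_vsum_diff ..
  finally show "(1 - q) * fps_d1 (Fishburn_gf lam) = q * W - 1" by (simp add: S1)
  have "(1 - q) * (1 - q\<^sup>2) * fps_d2 (Fishburn_gf lam) =
     fps_vsum (\<lambda>k. 2 * (q ^ 3 + q\<^sup>2 - q) * qpoch q k + 2 * (q - q\<^sup>2 - 2 * q ^ 3) * (qpoch q k * q ^ k)
        + 2 * q ^ 3 * (qpoch q k * (q ^ k)\<^sup>2))"
    unfolding Fishburn_gf_eq fps_dv_vsum fps_vsum_mult[OF V(3)] D(3)
    by (intro arg_cong[of _ _ fps_vsum] ext) algebra
  also have "\<dots> = 2 * (q ^ 3 + q\<^sup>2 - q) * W + 2 * (q - q\<^sup>2 - 2 * q ^ 3) * S1 + 2 * q ^ 3 * S2"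
    unfolding W S1_def S2_def fps_vsum_mult[OF v] fps_vsum_mult[OF v1] fps_vsum_mult[OF v2] fps_vsum_add ..
  also have "\<dots> = 2 * ((q ^ 3 + q\<^sup>2 - q) * W + q - 2 * q\<^sup>2)"
    using S1 S2 by algebra
  finally show "(1 - q) * (1 - q\<^sup>2) * fps_d2 (Fishburn_gf lam) = 2 * ((q ^ 3 + q\<^sup>2 - q) * W + q - 2 * q\<^sup>2)" .
qed

section \<open>Zagier's identity\<close>

text \<open>
  Regularised sums over the set \<open>S\<close> of the numbers \<open>3 n + 1/2\<close> (sign \<open>(-1)^n\<close>) and
  \<open>3 n + 5/2\<close> (sign \<open>-(-1)^n\<close>): \<open>zagier_fps\<close> is the generating function of \<open>exp (-y m)\<close>,
  \<open>reg_moment k\<close> the regularised sum of \<open>m^k\<close>, and \<open>reg_sum p\<close> that of \<open>p m\<close>.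
\<close>

definition zagier_fps :: "real fps" where
  "zagier_fps = (fps_exp (-1/2) - fps_exp (-5/2)) * inverse (1 + fps_exp (-3))"

lemma zagier_fps_eq: "zagier_fps * (1 + fps_exp (-3)) = fps_exp (-1/2) - fps_exp (-5/2)"
proof -
  have "inverse (1 + fps_exp (-3 :: real)) * (1 + fps_exp (-3)) = 1"
    by (rule inverse_mult_eq_1) simp
  then show ?thesis by (simp add: zagier_fps_def mult.assoc)
qed

definition reg_moment :: "nat \<Rightarrow> real" where "reg_moment k = (-1) ^ k * fact k * zagier_fps $ k"

definition reg_sum :: "real poly \<Rightarrow> real" where
  "reg_sum p = (\<Sum>k\<le>degree p. coeff p k * reg_moment k)"

lemma reg_sum_eq: "degree p \<le> N \<Longrightarrow> reg_sum p = (\<Sum>k\<le>N. coeff p k * reg_moment k)"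
  unfolding reg_sum_def by (rule sum.mono_neutral_left) (auto simp: coeff_eq_0)

lemma reg_sum_add: "reg_sum (p + q) = reg_sum p + reg_sum q"
proof -
  define N where "N = max (degree p) (degree q)"
  have "degree (p + q) \<le> N" unfolding N_def by (rule degree_add_le_max)
  then show ?thesis
    by (simp add: reg_sum_eq[of _ N] N_def reg_sum_eq[of p N] reg_sum_eq[of q N] sum.distrib algebra_simps)
qed

lemma reg_sum_smult: "reg_sum (smult c p) = c * reg_sum p"
  using reg_sum_eq[OF degree_smult_le[of c p]] by (simp add: reg_sum_def sum_distrib_left mult_ac)

lemma reg_sum_0 [simp]: "reg_sum 0 = 0" by (simp add: reg_sum_def)

lemma reg_sum_sum: "reg_sum (sum f A) = (\<Sum>x\<in>A. reg_sum (f x))"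
  by (induction A rule: infinite_finite_induct) (auto simp: reg_sum_add)

lemma reg_sum_monom: "reg_sum (monom c k) = c * reg_moment k"
proof -
  have "reg_sum (monom c k) = (\<Sum>i\<le>k. coeff (monom c k) i * reg_moment i)"
    by (rule reg_sum_eq) (rule degree_monom_le)
  also have "\<dots> = (\<Sum>i\<le>k. if i = k then c * reg_moment i else 0)"
    by (intro sum.cong) auto
  finally show ?thesis by simp
qed

text \<open>Coefficient k of \<open>zagier_fps_eq\<close>: by the binomial theorem the factor
  \<open>fps_exp (-3)\<close> acts on moments as the translation by 3.\<close>

lemma reg_sum_shift_monom: "reg_moment k + reg_sum ([:3, 1:] ^ k) = (1/2) ^ k - (5/2) ^ k"
proof -
  have e: "(zagier_fps * (1 + fps_exp (-3))) $ k = (fps_exp (-1/2) - fps_exp (-5/2)) $ k"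
    by (simp only: zagier_fps_eq)
  have "reg_sum ([:3, 1:] ^ k) = (\<Sum>i\<le>k. coeff ([:3, 1:] ^ k) i * reg_moment i)"
    by (rule reg_sum_eq) (simp add: degree_power_eq)
  also have "\<dots> = (\<Sum>i\<le>k. (-1) ^ k * fact k * (zagier_fps $ i * ((-3) ^ (k - i) / fact (k - i))))"
  proof (rule sum.cong)
    fix i assume "i \<in> {..k}"
    then have ik: "i \<le> k" by simp
    have "(-1::real) ^ k = (-1) ^ i * (-1) ^ (k - i)" using ik by (simp flip: power_add)
    moreover have "(-3::real) ^ (k - i) = (-1) ^ (k - i) * 3 ^ (k - i)"
      by (metis mult_minus1 power_mult_distrib)
    moreover have "(-1::real) ^ (k - i) * (-1) ^ (k - i) = 1" by (simp flip: power_mult_distrib)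
    ultimately show "coeff ([:3, 1:] ^ k) i * reg_moment i = (-1) ^ k * fact k * (zagier_fps $ i * ((-3) ^ (k - i) / fact (k - i)))"
      using ik by (simp add: coeff_linear_poly_power reg_moment_def binomial_fact field_simps)
  qed simp
  also have "\<dots> = (-1) ^ k * fact k * (zagier_fps * fps_exp (-3)) $ k"
    by (simp add: fps_mult_nth sum_distrib_left atMost_atLeast0)
  finally have "reg_moment k + reg_sum ([:3, 1:] ^ k) = (-1) ^ k * fact k * (zagier_fps * (1 + fps_exp (-3))) $ k"
    by (simp add: reg_moment_def algebra_simps)
  also have "\<dots> = (-1) ^ k * ((-1/2) ^ k - (-5/2) ^ k)"
    unfolding e by (simp add: field_simps)
  also have "\<dots> = ((-1) * (-1/2)) ^ k - ((-1) * (-5/2)) ^ k"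
    by (simp only: power_mult_distrib right_diff_distrib)
  finally show ?thesis by simp
qed

lemma pcompose_power: "pcompose (p ^ n) q = pcompose p q ^ n" for p q :: "'a::comm_semiring_1 poly"
  by (induction n) (simp_all add: pcompose_mult pcompose_1)

text \<open>Shifting \<open>S\<close> by 3 flips all signs and drops the two smallest elements.\<close>

lemma reg_sum_shift: "reg_sum p + reg_sum (pcompose p [:3, 1:]) = poly p (1/2) - poly p (5/2)"
proof -
  have p: "p = (\<Sum>i\<le>degree p. smult (coeff p i) (monom 1 i))"
    by (simp add: poly_as_sum_of_monoms smult_monom)
  have q: "pcompose p [:3, 1:] = (\<Sum>i\<le>degree p. smult (coeff p i) ([:3, 1:] ^ i))"
    by (subst p) (simp add: pcompose_sum pcompose_smult monom_altdef pcompose_power pcompose_pCons)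
  have "reg_sum p + reg_sum (pcompose p [:3, 1:]) = (\<Sum>i\<le>degree p. coeff p i * (reg_moment i + reg_sum ([:3, 1:] ^ i)))"
    unfolding q by (subst (1) p) (simp add: reg_sum_sum reg_sum_smult reg_sum_monom sum.distrib algebra_simps)
  also have "\<dots> = poly p (1/2) - poly p (5/2)"
    unfolding reg_sum_shift_monom by (simp add: poly_altdef sum_subtractf right_diff_distrib)
  finally show ?thesis .
qed

text \<open>
  \<open>reg_theta m\<close> is the regularised sum of \<open>exp (-t (N m + N (N + 1) / 6))\<close>, \<open>N + 1/2\<close> in \<open>S\<close>. It satisfies
  the same functional equation in \<open>m\<close> as the \<open>q\<close>-series \<open>qsum\<close> below, \<open>q = exp (-t)\<close>, and
  solutions with coefficients polynomial in \<open>m\<close> are unique. Differentiating at \<open>m = 0\<close> gives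
  Zagier's identity.
\<close>

definition theta_exponent :: "real \<Rightarrow> real poly" where "theta_exponent m = [:- m / 2 - 1 / 24, m, 1 / 6:]"

definition reg_theta :: "real \<Rightarrow> real fps" where
  "reg_theta m = Abs_fps (\<lambda>r. (-1) ^ r / fact r * reg_sum (theta_exponent m ^ r))"

text \<open>Translating the summation variable by 3 amounts to raising m by 1, up to an additive
  constant. This turns the symmetry of S into a functional equation in m.\<close>

lemma theta_exponent_shift: "pcompose (theta_exponent m) [:3, 1:] = [:3 * m + 2:] + theta_exponent (m + 1)"
  by (simp add: theta_exponent_def pcompose_pCons field_simps)

text \<open>The regularised form of exp(-c t) exp(-t E) = exp(-t (c + E)).\<close>

lemma fps_exp_mult_reg_theta:
  "(fps_exp (- c) * reg_theta m) $ r = (-1) ^ r / fact r * reg_sum (([:c:] + theta_exponent m) ^ r)"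
proof -
  have "(-1) ^ r / fact r * reg_sum (([:c:] + theta_exponent m) ^ r) =
      (\<Sum>i\<le>r. (-1) ^ r / fact r * (of_nat (r choose i) * c ^ i * reg_sum (theta_exponent m ^ (r - i))))"
    by (subst binomial_ring) (simp add: reg_sum_sum reg_sum_smult sum_distrib_left poly_const_pow
          of_nat_poly mult_ac)
  also have "\<dots> = (\<Sum>i\<le>r. (- c) ^ i / fact i * ((-1) ^ (r - i) / fact (r - i) * reg_sum (theta_exponent m ^ (r - i))))"
  proof (rule sum.cong)
    fix i assume "i \<in> {..r}"
    then have ir: "i \<le> r" by simp
    have "(-1::real) ^ r = (-1) ^ i * (-1) ^ (r - i)" using ir by (simp flip: power_add)
    moreover have "(-c) ^ i = (-1) ^ i * c ^ i" by (rule power_minus)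
    ultimately show "(-1) ^ r / fact r * (of_nat (r choose i) * c ^ i * reg_sum (theta_exponent m ^ (r - i)))
       = (- c) ^ i / fact i * ((-1) ^ (r - i) / fact (r - i) * reg_sum (theta_exponent m ^ (r - i)))"
      using ir by (simp add: binomial_fact field_simps)
  qed simp
  finally show ?thesis by (simp add: fps_mult_nth reg_theta_def atMost_atLeast0)
qed

text \<open>The right side comes from the two elements of S that the shift drops, 1/2 and 5/2, where
  the exponent takes the values 0 and 2 m + 1.\<close>

lemma reg_theta_eq: "reg_theta m + fps_exp (- (3 * m + 2)) * reg_theta (m + 1) = 1 - fps_exp (- (2 * m + 1))"
proof (rule fps_ext)
  fix r
  have "(reg_theta m + fps_exp (- (3 * m + 2)) * reg_theta (m + 1)) $ r =
     (-1) ^ r / fact r * (reg_sum (theta_exponent m ^ r) + reg_sum (pcompose (theta_exponent m ^ r) [:3, 1:]))"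
    unfolding fps_add_nth fps_exp_mult_reg_theta pcompose_power theta_exponent_shift by (simp add: reg_theta_def distrib_left)
  also have "\<dots> = (-1) ^ r / fact r * (0 ^ r - (2 * m + 1) ^ r)"
  proof -
    have "poly (theta_exponent m) (1/2) = 0" "poly (theta_exponent m) (5/2) = 2 * m + 1"
      by (simp_all add: theta_exponent_def field_simps)
    then show ?thesis by (simp add: reg_sum_shift)
  qed
  also have "\<dots> = (1 - fps_exp (- (2 * m + 1))) $ r"
    by (cases "r = 0") (auto simp: power_0_left power_minus[of "2 * m + 1"] simp del: minus_add_distrib)
  finally show "(reg_theta m + fps_exp (- (3 * m + 2)) * reg_theta (m + 1)) $ r = (1 - fps_exp (- (2 * m + 1))) $ r" .
qed

text \<open>The class in which the functional equation determines its solution. Without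
  polynomiality in m, antiperiodic functions such as cos(pi m) would already give freedom in the
  lowest coefficient.\<close>

definition polyfam :: "(real \<Rightarrow> real fps) \<Rightarrow> bool" where
  "polyfam f \<longleftrightarrow> (\<forall>n. \<exists>p. \<forall>m. f m $ n = poly p m)"

lemma polyfam_const: "polyfam (\<lambda>m. c)"
  unfolding polyfam_def by (auto intro: exI[of _ "[:c $ n:]" for n])

lemma polyfam_diff: "polyfam f \<Longrightarrow> polyfam g \<Longrightarrow> polyfam (\<lambda>m. f m - g m)"
  unfolding polyfam_def by (metis fps_sub_nth poly_diff)

lemma polyfam_mult:
  assumes "polyfam f" "polyfam g"
  shows "polyfam (\<lambda>m. f m * g m)"
proof -
  from assms obtain p q where "f m $ n = poly (p n) m" "g m $ n = poly (q n) m" for m n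
    unfolding polyfam_def by metis
  then have "(f m * g m) $ n = poly (\<Sum>i=0..n. p i * q (n - i)) m" for m n
    by (simp add: fps_mult_nth poly_sum)
  then show ?thesis unfolding polyfam_def by blast
qed

lemma polyfam_prod: "(\<And>i. polyfam (f i)) \<Longrightarrow> polyfam (\<lambda>m. \<Prod>i\<in>A. f i m)"
  by (induction A rule: infinite_finite_induct) (auto intro: polyfam_const polyfam_mult)

lemma polyfam_power: "polyfam f \<Longrightarrow> polyfam (\<lambda>m. f m ^ n)"
  by (induction n) (auto intro: polyfam_const polyfam_mult)

lemma polyfam_exp: "polyfam (\<lambda>m. fps_exp (- (m + b)))"
proof -
  have "fps_exp (- (m + b)) $ n = poly (smult (1 / fact n) ([:-b, -1:] ^ n)) m" for m n
  proof -
    have "poly [:-b, -1:] m = - (m + b)" by simp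
    then show ?thesis by (simp only: poly_smult poly_power fps_exp_nth) simp
  qed
  then show ?thesis unfolding polyfam_def by blast
qed

lemma polyfam_vsum:
  assumes "\<And>k. polyfam (f k)"
  shows "polyfam (\<lambda>m. fps_vsum (\<lambda>k. f k m))"
proof -
  from assms obtain p where "f k m $ n = poly (p k n) m" for k m n
    unfolding polyfam_def by metis
  then have "fps_vsum (\<lambda>k. f k m) $ n = poly (\<Sum>k\<le>n. p k n) m" for m n
    by (simp add: fps_vsum_def poly_sum)
  then show ?thesis unfolding polyfam_def by blast
qed

text \<open>Antiperiodicity makes p take the value p(0) at all even natural numbers, so p is
  constant, and then 2 p(0) = 0.\<close>

lemma poly_antiperiodic_zero:
  fixes p :: "real poly"
  assumes "\<And>m. poly p m + poly p (m + 1) = 0"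
  shows "p = 0"
proof -
  have e: "poly p (2 * real n) = poly p 0" for n
  proof (induction n)
    case (Suc n)
    show ?case using Suc assms[of "2 * real n"] assms[of "2 * real n + 1"] by (simp add: algebra_simps)
  qed simp
  have "p = [:poly p 0:]"
  proof (rule ccontr)
    assume "p \<noteq> [:poly p 0:]"
    then have "finite {x. poly (p - [:poly p 0:]) x = 0}" by (intro poly_roots_finite) simp
    moreover have "range (\<lambda>n::nat. 2 * real n) \<subseteq> {x. poly (p - [:poly p 0:]) x = 0}" using e by auto
    ultimately have "finite (range (\<lambda>n::nat. 2 * real n))" by (rule rev_finite_subset)
    then show False by (subst (asm) finite_image_iff) (auto simp: inj_on_def)
  qed
  moreover from this have "poly p 1 = poly p 0" by (metis mult.right_neutral mult_zero_right poly_0 poly_pCons add.right_neutral)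
  ultimately show ?thesis using assms[of 0] by simp
qed

text \<open>Induction on the order in t: once the lower coefficients vanish, only the constant
  coefficient 1 of the exponential contributes, and coefficient n is an antiperiodic polynomial in
  m.\<close>

lemma polyfam_functional_unique:
  assumes "polyfam d" and eq: "\<And>m. d m + fps_exp (- (3 * m + 2)) * d (m + 1) = 0"
  shows "d m = 0"
proof -
  from assms(1) obtain p where p: "\<And>m n. d m $ n = poly (p n) m"
    unfolding polyfam_def by metis
  have "p n = 0" for n
  proof (induction n rule: less_induct)
    case (less n)
    have "poly (p n) m + poly (p n) (m + 1) = 0" for m
    proof -
      have "0 = (d m + fps_exp (- (3 * m + 2)) * d (m + 1)) $ n" by (simp only: eq fps_zero_nth)
      also have "\<dots> = poly (p n) m + (\<Sum>i=0..n. fps_exp (- (3 * m + 2)) $ i * poly (p (n - i)) (m + 1))"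
        by (simp add: fps_mult_nth p)
      also have "(\<Sum>i=0..n. fps_exp (- (3 * m + 2)) $ i * poly (p (n - i)) (m + 1)) =
          (\<Sum>i=0..n. if i = 0 then poly (p n) (m + 1) else 0)"
        by (intro sum.cong refl) (auto simp: less)
      finally show ?thesis by simp
    qed
    then show ?case by (rule poly_antiperiodic_zero)
  qed
  then show ?thesis by (simp add: fps_eq_iff p)
qed

section \<open>The q-series side of Zagier's identity\<close>

definition qshift :: "real \<Rightarrow> nat \<Rightarrow> real fps" where
  "qshift m n = (\<Prod>j=1..n. 1 - fps_exp (- (m + real j)))"

text \<open>With q = exp(-t) and x = q^m this is the sum of (x q; q)_n x^n; at m = 0 it is the sum
  of (q; q)_n.\<close>

definition qsum :: "real \<Rightarrow> real fps" where
  "qsum m = fps_vsum (\<lambda>n. qshift m n * fps_exp (- m) ^ n)"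

lemma vanishing_qshift: "vanishing (qshift m)"
  unfolding qshift_def by (rule vanishing_prod) simp

lemma vanishing_qsum: "vanishing (\<lambda>n. qshift m n * fps_exp (- m) ^ n)"
  using vanishing_mult[OF vanishing_qshift, of "\<lambda>n. fps_exp (-m) ^ n"] by (simp add: mult.commute)

lemma qshift_Suc: "qshift m (Suc n) = qshift m n * (1 - fps_exp (- m) * fps_exp (-1) ^ Suc n)"
  by (simp add: qshift_def fps_exp_power_mult flip: fps_exp_add_mult)

lemma qshift_Suc': "qshift m (Suc n) = (1 - fps_exp (- (m + 1))) * qshift (m + 1) n"
proof (induction n)
  case (Suc n)
  have "m + 1 + real (Suc n) = m + real (Suc (Suc n))" by simp
  then have "qshift (m + 1) (Suc n) = qshift (m + 1) n * (1 - fps_exp (- (m + real (Suc (Suc n)))))"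
    unfolding qshift_def by (simp only: prod.nat_ivl_Suc') (simp add: mult.commute)
  moreover have "qshift m (Suc (Suc n)) = qshift m (Suc n) * (1 - fps_exp (- (m + real (Suc (Suc n)))))"
    unfolding qshift_def by (simp only: prod.nat_ivl_Suc') (simp add: mult.commute)
  ultimately show ?case by (simp only: Suc.IH mult.assoc)
qed (simp add: qshift_def)

text \<open>The n-th term of the left side is V_n - V_(n+1) with V_n = (x q; q)_n x^n (1 - q^(n+1)
  x^2), so the sum telescopes to V_0 = 1 - q x^2.\<close>

lemma qsum_functional:
  "(1 - fps_exp (- m)) * qsum m + fps_exp (- (3 * m + 2)) * ((1 - fps_exp (- (m + 1))) * qsum (m + 1))
    = 1 - fps_exp (- (2 * m + 1))"
proof -
  define x where "x = fps_exp (- m)"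
  define q where "q = fps_exp (- 1 :: real)"
  have e: "fps_exp (- (3 * m + 2)) = q\<^sup>2 * x ^ 3" "fps_exp (- (2 * m + 1)) = q * x\<^sup>2"
      "fps_exp (- (m + 1)) = q * x"
    by (simp_all add: x_def q_def fps_exp_power_mult flip: fps_exp_add_mult)
  have R1: "(1 - fps_exp (- (m + 1))) * qsum (m + 1) = fps_vsum (\<lambda>n. qshift m (Suc n) * (q * x) ^ n)"
    unfolding qsum_def by (subst fps_vsum_mult[OF vanishing_qsum]) (simp only: qshift_Suc' e(3) mult.assoc)
  have vS: "vanishing (\<lambda>n. qshift m (Suc n) * (q * x) ^ n)"
    using vanishing_qshift[of m] vanishing_mult[of "\<lambda>n. qshift m (Suc n)" "\<lambda>n. (q * x) ^ n"]
    by (simp add: vanishing_def mult.commute)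
  have vV: "vanishing (\<lambda>n. qshift m n * (x ^ n * (1 - q ^ Suc n * x\<^sup>2)))"
    using vanishing_mult[OF vanishing_qshift, of "\<lambda>n. x ^ n * (1 - q ^ Suc n * x\<^sup>2)"] by (simp add: mult.commute)
  have "(1 - x) * qsum m + q\<^sup>2 * x ^ 3 * ((1 - q * x) * qsum (m + 1)) =
     fps_vsum (\<lambda>n. (1 - x) * (qshift m n * x ^ n) + q\<^sup>2 * x ^ 3 * (qshift m (Suc n) * (q * x) ^ n))"
    unfolding R1[unfolded e(3)] unfolding qsum_def x_def[symmetric]
    unfolding fps_vsum_mult[OF vS] fps_vsum_mult[OF vanishing_qsum[of m, folded x_def]] fps_vsum_add ..
  also have "\<dots> = fps_vsum (\<lambda>n. qshift m n * (x ^ n * (1 - q ^ Suc n * x\<^sup>2))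
       - qshift m (Suc n) * (x ^ Suc n * (1 - q ^ Suc (Suc n) * x\<^sup>2)))"
  proof (intro arg_cong[of _ _ fps_vsum] ext)
    fix n
    define Q where "Q = q ^ n"
    define X where "X = x ^ n"
    show "(1 - x) * (qshift m n * x ^ n) + q\<^sup>2 * x ^ 3 * (qshift m (Suc n) * (q * x) ^ n) =
      qshift m n * (x ^ n * (1 - q ^ Suc n * x\<^sup>2)) - qshift m (Suc n) * (x ^ Suc n * (1 - q ^ Suc (Suc n) * x\<^sup>2))"
      unfolding qshift_Suc x_def[symmetric] q_def[symmetric] power_mult_distrib power_Suc Q_def[symmetric] X_def[symmetric]
      by algebra
  qed
  also have "\<dots> = 1 - q * x\<^sup>2" by (subst fps_vsum_telescope[OF vV]) (simp add: qshift_def)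
  finally show ?thesis unfolding e x_def[symmetric] .
qed

text \<open>The parts of \<open>theta_exponent\<close> of degree 0 and, below, of degree 1 in m;
  needed to differentiate at m = 0.\<close>

definition exponent_square :: "real poly" where "exponent_square = [:-1/24, 0, 1/6:]"
definition exponent_linear :: "real poly" where "exponent_linear = [:-1/2, 1:]"

lemma reg_sum_theta_exponent_power:
  "reg_sum (theta_exponent m ^ r) = (\<Sum>i\<le>r. (of_nat (r choose i) * reg_sum (exponent_linear ^ i * exponent_square ^ (r - i))) * m ^ i)"
proof -
  have *: "theta_exponent m = smult m exponent_linear + exponent_square" by (simp add: theta_exponent_def exponent_square_def exponent_linear_def)
  show ?thesis
    unfolding * binomial_ring smult_power
    by (simp add: reg_sum_sum reg_sum_smult of_nat_poly mult_ac)
qed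

lemma polyfam_reg_theta: "polyfam reg_theta"
proof -
  have "reg_theta m $ n = poly (smult ((-1) ^ n / fact n) (\<Sum>i\<le>n. monom (of_nat (n choose i) * reg_sum (exponent_linear ^ i * exponent_square ^ (n - i))) i)) m" for m n
    by (simp add: reg_theta_def reg_sum_theta_exponent_power poly_sum poly_monom)
  then show ?thesis unfolding polyfam_def by blast
qed

lemma polyfam_qsum: "polyfam qsum"
proof -
  have 1: "polyfam (\<lambda>m. fps_exp (- m))" using polyfam_exp[of 0] by simp
  show ?thesis
    unfolding qsum_def qshift_def
    by (intro polyfam_vsum polyfam_mult polyfam_prod polyfam_power polyfam_diff polyfam_const polyfam_exp 1)
qed

lemma reg_theta_eq_qsum: "reg_theta m = (1 - fps_exp (- m)) * qsum m"
proof -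
  define d where "d = (\<lambda>m. reg_theta m - (1 - fps_exp (- m)) * qsum m)"
  have "polyfam d"
    unfolding d_def using polyfam_exp[of 0]
    by (intro polyfam_diff polyfam_mult polyfam_reg_theta polyfam_qsum polyfam_const) simp
  moreover have "d m + fps_exp (- (3 * m + 2)) * d (m + 1) = 0" for m
    using reg_theta_eq[of m] qsum_functional[of m] unfolding d_def by algebra
  ultimately have "d m = 0" by (rule polyfam_functional_unique)
  then show ?thesis by (simp add: d_def)
qed

text \<open>In \<open>reg_theta_eq_qsum\<close> the factor 1 - exp(-m t) vanishes at m = 0 with
  m-derivative t. So the m-derivative of \<open>reg_theta\<close> at 0 is t times
  \<open>qsum 0\<close>, which is why coefficient n + 1 is differentiated.\<close>

lemma qsum_0_nth: "qsum 0 $ n = (-1) ^ Suc n / fact n * reg_sum (exponent_linear * exponent_square ^ n)"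
proof -
  obtain p where p: "\<And>m n. qsum m $ n = poly (p n) m"
    using polyfam_qsum unfolding polyfam_def by metis
  have "((\<lambda>m. reg_theta m $ Suc n) has_real_derivative
      (-1) ^ Suc n / fact (Suc n) * (\<Sum>i\<le>Suc n. of_nat (Suc n choose i) * reg_sum (exponent_linear ^ i * exponent_square ^ (Suc n - i)) * (real i * 0 ^ (i - 1)))) (at 0)"
    unfolding reg_theta_def reg_sum_theta_exponent_power fps_nth_Abs_fps
    by (intro DERIV_cmult DERIV_sum) (auto intro!: derivative_eq_intros)
  also have "(\<Sum>i\<le>Suc n. of_nat (Suc n choose i) * reg_sum (exponent_linear ^ i * exponent_square ^ (Suc n - i)) * (real i * 0 ^ (i - 1))) =
      (\<Sum>i\<le>Suc n. if i = 1 then real (Suc n) * reg_sum (exponent_linear * exponent_square ^ n) else 0)"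
    by (intro sum.cong refl) (auto simp: power_0_left)
  also have "\<dots> = real (Suc n) * reg_sum (exponent_linear * exponent_square ^ n)" by simp
  finally have D1: "((\<lambda>m. reg_theta m $ Suc n) has_real_derivative (-1) ^ Suc n / fact n * reg_sum (exponent_linear * exponent_square ^ n)) (at 0)"
    by (simp add: field_simps del: of_nat_Suc)
  have E: "((\<lambda>m. (1 - fps_exp (- m)) $ i) has_real_derivative (if i = 1 then 1 else 0)) (at 0)" for i
    by (cases i) (auto intro!: derivative_eq_intros simp: power_0_left simp del: fact_Suc)
  have "((\<lambda>m. \<Sum>i=0..Suc n. (1 - fps_exp (- m)) $ i * poly (p (Suc n - i)) m) has_real_derivative
       (\<Sum>i=0..Suc n. (if i = 1 then 1 else 0) * poly (p (Suc n - i)) 0 +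
           poly (pderiv (p (Suc n - i))) 0 * (1 - fps_exp (- 0)) $ i)) (at 0)"
    by (intro DERIV_sum DERIV_mult E poly_DERIV)
  also have "(\<Sum>i=0..Suc n. (if i = 1 then 1 else 0) * poly (p (Suc n - i)) 0 +
           poly (pderiv (p (Suc n - i))) 0 * (1 - fps_exp (- 0)) $ i) = (\<Sum>i=0..Suc n. if i = 1 then poly (p n) 0 else 0)"
    by (intro sum.cong refl) auto
  also have "\<dots> = poly (p n) 0" by (subst sum.delta) auto
  also have "(\<lambda>m. \<Sum>i=0..Suc n. (1 - fps_exp (- m)) $ i * poly (p (Suc n - i)) m) = (\<lambda>m. reg_theta m $ Suc n)"
    unfolding reg_theta_eq_qsum fps_mult_nth p ..
  finally show ?thesis using D1 unfolding p by (rule DERIV_unique)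
qed

text \<open>The series is odd: after y -> -y, multiplying numerator and denominator by exp(-3 y)
  restores the denominator and negates the numerator.\<close>

lemma zagier_fps_even: "zagier_fps $ (2 * k) = 0"
proof -
  have c: "fps_exp a oo (- fps_X) = fps_exp (- a :: real)" for a
    by (simp add: fps_eq_iff fps_compose_uminus' power_minus[of a])
  define r where "r = zagier_fps oo (- fps_X)"
  have "(zagier_fps * (1 + fps_exp (-3))) oo (- fps_X) = (fps_exp (-1/2) - fps_exp (-5/2)) oo (- fps_X)"
    by (simp only: zagier_fps_eq)
  then have "r * (1 + fps_exp 3) = fps_exp (1/2) - fps_exp (5/2)"
    by (simp add: r_def fps_compose_mult_distrib fps_compose_add_distrib fps_compose_sub_distrib c)
  moreover have "fps_exp 3 * fps_exp (-3 :: real) = 1" "fps_exp (1/2) * fps_exp (-3 :: real) = fps_exp (-5/2)"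
      "fps_exp (5/2) * fps_exp (-3 :: real) = fps_exp (-1/2)"
    by (simp_all flip: fps_exp_add_mult)
  ultimately have "r * (1 + fps_exp (-3)) = fps_exp (-5/2) - fps_exp (-1/2)" by algebra
  with zagier_fps_eq have "(r + zagier_fps) * (1 + fps_exp (-3)) = 0" by algebra
  moreover have "(1 + fps_exp (-3 :: real)) $ 0 \<noteq> 0" by simp
  then have "1 + fps_exp (-3 :: real) \<noteq> 0" by (metis fps_zero_nth)
  ultimately have "r + zagier_fps = 0" by simp
  then have "(r + zagier_fps) $ (2 * k) = 0" by simp
  then show ?thesis by (simp add: r_def fps_compose_uminus')
qed

text \<open>In \<open>qsum_0_nth\<close> the constant -1/24 of \<open>exponent_square\<close> is
  split off binomially and becomes the factor exp(t/24). The constant -1/2 of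
  \<open>exponent_linear\<close> meets only even moments, which vanish by
  \<open>zagier_fps_even\<close>.\<close>

lemma Zagier_identity:
  "fps_vsum (qpoch (fps_exp (-1))) =
     fps_exp (1/24) * Abs_fps (\<lambda>k. (-1/6) ^ k * (fact (2 * k + 1) / fact k) * zagier_fps $ (2 * k + 1))"
proof -
  have 0: "fps_vsum (qpoch (fps_exp (-1))) = qsum 0"
    by (simp add: qsum_def qshift_def qpoch_def [abs_def] fps_exp_power_mult)
  define V where "V = (\<lambda>k. (-1/6) ^ k * (fact (2 * k + 1) / fact k) * zagier_fps $ (2 * k + 1))"
  define D :: "real poly" where "D = [:0, 0, 1/6:]"
  have B: "reg_sum (exponent_linear * D ^ k) = - ((1/6) ^ k * fact (2 * k + 1) * zagier_fps $ (2 * k + 1))" for k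
  proof -
    have D: "D = monom (1/6) 2" by (simp add: D_def monom_altdef numeral_2_eq_2)
    have "exponent_linear * D ^ k = monom ((1/6) ^ k) (2 * k + 1) - monom ((1/6) ^ k / 2) (2 * k)"
      unfolding D by (simp add: exponent_linear_def monom_power mult_pCons_left monom_Suc smult_monom mult.commute minus_monom)
    also have "\<dots> = monom ((1/6) ^ k) (2 * k + 1) + monom (- ((1/6) ^ k / 2)) (2 * k)"
      by (simp only: diff_conv_add_uminus minus_monom)
    finally show ?thesis
      by (simp only: reg_sum_add reg_sum_monom) (simp add: reg_moment_def zagier_fps_even)
  qed
  show ?thesis
  proof (rule fps_ext)
    fix n
    have A: "exponent_square = [:-1/24:] + D" by (simp add: exponent_square_def D_def)
    have "exponent_linear * exponent_square ^ n = (\<Sum>i\<le>n. smult (of_nat (n choose i) * (-1/24) ^ i) (exponent_linear * D ^ (n - i)))"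
      unfolding A binomial_ring by (simp add: sum_distrib_left poly_const_pow of_nat_poly mult_ac)
    then have "reg_sum (exponent_linear * exponent_square ^ n) = (\<Sum>i\<le>n. (of_nat (n choose i) * (-1/24) ^ i) * reg_sum (exponent_linear * D ^ (n - i)))"
      by (simp add: reg_sum_sum reg_sum_smult)
    then have "qsum 0 $ n = (\<Sum>i\<le>n. (-1) ^ Suc n / fact n * (of_nat (n choose i) * (-1/24) ^ i * reg_sum (exponent_linear * D ^ (n - i))))"
      by (simp add: qsum_0_nth sum_distrib_left)
    also have "\<dots> = (\<Sum>i\<le>n. (1/24) ^ i / fact i * V (n - i))"
    proof (rule sum.cong)
      fix i assume "i \<in> {..n}"
      then have i: "i \<le> n" by simp
      define a where "a = (-1::real) ^ i"
      define b where "b = (-1::real) ^ (n - i)"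
      define Z where "Z = fact (2 * (n - i) + 1) * zagier_fps $ (2 * (n - i) + 1)"
      have e: "(-1::real) ^ Suc n = - (a * b)" using i by (simp add: a_def b_def flip: power_add)
      have f: "(-1/24::real) ^ i = a * (1/24) ^ i" "(-1/6::real) ^ (n - i) = b * (1/6) ^ (n - i)"
        unfolding a_def b_def by (simp_all flip: power_mult_distrib)
      have a: "a * a = 1" by (simp add: a_def flip: power_mult_distrib)
      have c: "of_nat (n choose i) / fact n = 1 / (fact i * fact (n - i) :: real)"
        using i by (simp add: binomial_fact)
      have "(-1) ^ Suc n / fact n * (of_nat (n choose i) * (-1/24) ^ i * reg_sum (exponent_linear * D ^ (n - i)))
         = a * a * b * (of_nat (n choose i) / fact n) * (1/24) ^ i * (1/6) ^ (n - i) * Z"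
        unfolding B e f Z_def by simp
      also have "\<dots> = (1/24) ^ i / fact i * V (n - i)"
        unfolding c a V_def f Z_def by simp
      finally show "(-1) ^ Suc n / fact n * (of_nat (n choose i) * (-1/24) ^ i * reg_sum (exponent_linear * D ^ (n - i)))
          = (1/24) ^ i / fact i * V (n - i)" .
    qed simp
    also have "\<dots> = (fps_exp (1/24) * Abs_fps V) $ n"
      by (simp add: fps_mult_nth atMost_atLeast0)
    finally show "fps_vsum (qpoch (fps_exp (-1))) $ n = (fps_exp (1/24) * Abs_fps (\<lambda>k. (-1/6) ^ k * (fact (2 * k + 1) / fact k) * zagier_fps $ (2 * k + 1))) $ n"
      unfolding 0 V_def .
  qed
qed

section \<open>Asymptotics of the coefficients in Zagier's identity\<close>

lemma entire_factor_zero: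
  assumes "f holomorphic_on UNIV" "f a = 0"
  obtains g where "g holomorphic_on UNIV" "\<And>z. f z = (z - a) * g z"
proof
  define g where "g = (\<lambda>z. if z = a then deriv f a else f z / (z - a))"
  show "g holomorphic_on UNIV"
    by (rule pole_theorem_open_0[of f UNIV a]) (use assms in \<open>auto simp: g_def\<close>)
  show "f z = (z - a) * g z" for z
    using assms(2) by (simp add: g_def)
qed

definition zagier_pole :: complex where "zagier_pole = \<i> * pi / 3"

lemma norm_zagier_pole: "norm zagier_pole = pi / 3" by (simp add: zagier_pole_def norm_mult)

lemma zagier_pole_sq: "zagier_pole\<^sup>2 = - of_real (pi\<^sup>2 / 9)"
  by (simp add: zagier_pole_def power_mult_distrib power_divide)

lemma exp_3_zagier_pole: "exp (- 3 * zagier_pole) = -1" "exp (3 * zagier_pole) = -1"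
  by (simp_all add: zagier_pole_def exp_minus)

text \<open>The zeros are the odd multiples of \<open>zagier_pole\<close>, whose norm is pi / 3; the
  bound leaves the multiples 1 and -1.\<close>

lemma zagier_fps_denominator_zeros:
  assumes "norm z < pi" "1 + exp (- 3 * z) = 0"
  shows "z = zagier_pole \<or> z = - zagier_pole"
proof -
  have "exp (- 3 * z) = exp (\<i> * pi)" using assms(2) by (simp add: add_eq_0_iff)
  then obtain n :: int where n: "- 3 * z = \<i> * pi + (of_int (2 * n) * pi) * \<i>"
    by (metis exp_eq)
  have "z = (-1/3) * (- 3 * z)" by simp
  also have "\<dots> = - (of_int (2 * n + 1) * zagier_pole)" unfolding n by (simp add: zagier_pole_def field_simps)
  finally have z: "z = - (of_int (2 * n + 1) * zagier_pole)" .
  then have "norm z = \<bar>real_of_int (2 * n + 1)\<bar> * (pi / 3)"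
    by (simp only: norm_minus_cancel norm_mult norm_zagier_pole norm_of_int)
  with assms(1) have "\<bar>real_of_int (2 * n + 1)\<bar> < 3" by (simp add: field_simps)
  then have "\<bar>2 * n + 1\<bar> < 3" by linarith
  then have "n = 0 \<or> n = -1" by presburger
  with z show ?thesis by auto
qed

text \<open>
  The poles of \<open>zagier_fps\<close> closest to 0 are simple, at \<open>\<plusminus> i pi / 3\<close>; those at \<open>\<plusminus> i pi\<close> are
  removable, but radius \<open>pi\<close> is enough.
\<close>

lemma zagier_fps_regularization:
  obtains \<gamma> :: "complex \<Rightarrow> complex"
  where "\<gamma> holomorphic_on ball 0 pi" "\<gamma> zagier_pole \<noteq> 0"
    "\<gamma> has_fps_expansion (Abs_fps (\<lambda>n. of_real (((1 + fps_const (9 / pi\<^sup>2) * fps_X\<^sup>2) * zagier_fps) $ n)))"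
proof -
  define D where "D = (\<lambda>z::complex. 1 + exp (- 3 * z))"
  define f where "f = (\<lambda>z::complex. exp (-1/2 * z) - exp (-5/2 * z))"
  have D: "D holomorphic_on UNIV" unfolding D_def by (intro holomorphic_intros)
  have f: "f holomorphic_on UNIV" unfolding f_def by (intro holomorphic_intros)
  obtain u1 where u1: "u1 holomorphic_on UNIV" "\<And>z. D z = (z - zagier_pole) * u1 z"
    using entire_factor_zero[OF D, of zagier_pole] exp_3_zagier_pole unfolding D_def by (metis add.right_inverse)
  have p0: "zagier_pole \<noteq> 0" by (simp add: zagier_pole_def)
  have "D (- zagier_pole) = 0" by (simp add: D_def exp_3_zagier_pole)
  then have "u1 (- zagier_pole) = 0" using u1(2)[of "- zagier_pole"] p0 by simp
  then obtain u where u: "u holomorphic_on UNIV" "\<And>z. u1 z = (z - (- zagier_pole)) * u z"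
    using entire_factor_zero[OF u1(1)] by blast
  have Du: "D z = (z\<^sup>2 - zagier_pole\<^sup>2) * u z" for z
    unfolding u1(2) u(2) by (simp add: power2_eq_square algebra_simps)
  \<comment> \<open>A zero of u would be a double zero of D, but the derivative -3 exp(-3 z) of D
    never vanishes.\<close>
  have u_nz: "u z \<noteq> 0" if "norm z < pi" for z
  proof
    assume uz: "u z = 0"
    then have "D z = 0" by (simp add: Du)
    then have z: "z = zagier_pole \<or> z = - zagier_pole" using zagier_fps_denominator_zeros that by (simp add: D_def)
    have "(u has_field_derivative deriv u z) (at z)"
      using u(1) by (simp add: holomorphic_derivI)
    then have "((\<lambda>z. (z\<^sup>2 - zagier_pole\<^sup>2) * u z) has_field_derivative 0) (at z)"
      using z uz by (auto intro!: derivative_eq_intros)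
    moreover have "(D has_field_derivative - 3 * exp (- 3 * z)) (at z)"
      unfolding D_def by (auto intro!: derivative_eq_intros)
    moreover have "D = (\<lambda>z. (z\<^sup>2 - zagier_pole\<^sup>2) * u z)" using Du by blast
    ultimately have "- 3 * exp (- 3 * z) = 0" by (metis DERIV_unique)
    then show False by simp
  qed
  \<comment> \<open>The constant fits the statement: 1 + (9/pi^2) z^2 equals (9/pi^2) (z^2 -
    \<open>zagier_pole\<^sup>2\<close>), since the square of the pole is -pi^2/9.\<close>
  define \<gamma> where "\<gamma> = (\<lambda>z. of_real (9 / pi\<^sup>2) * f z / u z)"
  have hol: "\<gamma> holomorphic_on ball 0 pi" unfolding \<gamma>_def
    by (intro holomorphic_intros holomorphic_on_subset[OF f] holomorphic_on_subset[OF u(1)]) (auto simp: u_nz)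
  \<comment> \<open>The numerator does not vanish at the pole; this is what makes the limit of the
    normalised coefficients nonzero.\<close>
  have "f zagier_pole = exp (- (\<i> * pi / 6)) - exp (- (5 * \<i> * pi / 6))"
    by (simp add: f_def zagier_pole_def mult_ac)
  also have "\<dots> \<noteq> 0"
  proof
    assume "exp (- (\<i> * pi / 6)) - exp (- (5 * \<i> * pi / 6)) = 0"
    then have "exp (- (\<i> * pi / 6)) = exp (- (5 * \<i> * pi / 6))" by simp
    then obtain n :: int where "- (\<i> * pi / 6) = - (5 * \<i> * pi / 6) + (of_int (2 * n) * pi) * \<i>"
      by (metis exp_eq)
    then have "Im (- (\<i> * pi / 6)) = Im (- (5 * \<i> * pi / 6) + (of_int (2 * n) * pi) * \<i>)" by simp
    then have "pi * (4 - 12 * of_int n) = 0" by (simp add: field_simps)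
    then have "real_of_int (3 * n) = real_of_int 1" by simp
    then have "3 * n = 1" by (simp only: of_int_eq_iff)
    then show False by presburger
  qed
  finally have nz: "\<gamma> zagier_pole \<noteq> 0" using u_nz[of zagier_pole] norm_zagier_pole by (simp add: \<gamma>_def)
  define U where "U = fps_expansion u 0"
  have U: "u has_fps_expansion U"
    unfolding U_def using u(1) by (intro has_fps_expansion_fps_expansion[of UNIV]) auto
  define G where "G = fps_expansion \<gamma> 0"
  have G: "\<gamma> has_fps_expansion G"
    unfolding G_def by (rule has_fps_expansion_fps_expansion[of "ball 0 pi"]) (use hol in auto)
  have "(\<lambda>z. (z ^ 2 - zagier_pole\<^sup>2) * u z) has_fps_expansion (fps_X ^ 2 - fps_const (zagier_pole\<^sup>2)) * U"
    by (intro fps_expansion_intros U)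
  moreover have "D has_fps_expansion 1 + fps_exp (-3)"
    unfolding D_def by (intro fps_expansion_intros)
  moreover have "D = (\<lambda>z. (z\<^sup>2 - zagier_pole\<^sup>2) * u z)" using Du by blast
  ultimately have DU: "(fps_X ^ 2 - fps_const (zagier_pole\<^sup>2)) * U = 1 + fps_exp (-3)"
    by (metis fps_expansion_unique_complex)
  have fE: "(\<lambda>z. of_real (9 / pi\<^sup>2) * f z) has_fps_expansion fps_const (of_real (9 / pi\<^sup>2)) * (fps_exp (-1/2) - fps_exp (-5/2))"
    unfolding f_def by (intro fps_expansion_intros)
  have "eventually (\<lambda>z::complex. z \<in> ball 0 pi) (nhds 0)" by (rule eventually_nhds_in_open) auto
  then have ev: "eventually (\<lambda>z. \<gamma> z * u z = of_real (9 / pi\<^sup>2) * f z) (nhds 0)"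
    by eventually_elim (simp add: \<gamma>_def u_nz)
  have "(\<lambda>z. \<gamma> z * u z) has_fps_expansion G * U" by (intro fps_expansion_intros U G)
  then have "(\<lambda>z. of_real (9 / pi\<^sup>2) * f z) has_fps_expansion G * U"
    by (subst (asm) has_fps_expansion_cong[OF ev refl])
  then have GU: "G * U = fps_const (of_real (9 / pi\<^sup>2)) * (fps_exp (-1/2) - fps_exp (-5/2))"
    using fE by (rule fps_expansion_unique_complex)
  define cx :: "real fps \<Rightarrow> complex fps" where "cx = (\<lambda>F. Abs_fps (\<lambda>n. of_real (F $ n)))"
  have cx_mult: "cx (F * H) = cx F * cx H" for F H by (simp add: cx_def fps_eq_iff fps_mult_nth)
  have cx_add: "cx (F + H) = cx F + cx H" "cx (F - H) = cx F - cx H" for F H by (simp_all add: cx_def fps_eq_iff)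
  have cx_exp: "cx (fps_exp c) = fps_exp (of_real c)" for c by (simp add: cx_def fps_eq_iff)
  have cx_1: "cx 1 = 1" "cx fps_X = fps_X" "cx (fps_const c) = fps_const (of_real c)" for c
    by (simp_all add: cx_def fps_eq_iff fps_X_def)
  have "cx (zagier_fps * (1 + fps_exp (-3))) = cx (fps_exp (-1/2) - fps_exp (-5/2))" by (simp only: zagier_fps_eq)
  then have P: "cx zagier_fps * (1 + fps_exp (-3)) = fps_exp (-1/2) - fps_exp (-5/2)"
    by (simp add: cx_mult cx_add cx_exp cx_1)
  define k where "k = fps_const (of_real (9 / pi\<^sup>2) :: complex)"
  have kz: "k * fps_const (zagier_pole\<^sup>2) = -1"
    by (simp add: k_def zagier_pole_sq flip: fps_const_neg)
  have "G * (1 + fps_exp (-3)) = (k * fps_X\<^sup>2 + 1) * cx zagier_fps * (1 + fps_exp (-3))"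
    using GU DU P kz unfolding k_def[symmetric] by algebra
  moreover have "(1 + fps_exp (-3 :: complex)) $ 0 \<noteq> 0" by simp
  then have "1 + fps_exp (-3 :: complex) \<noteq> 0" by (metis fps_zero_nth)
  ultimately have "G = (k * fps_X\<^sup>2 + 1) * cx zagier_fps" by simp
  also have "\<dots> = cx ((1 + fps_const (9 / pi\<^sup>2) * fps_X\<^sup>2) * zagier_fps)"
    by (simp add: cx_mult cx_add cx_1 k_def power2_eq_square)
  finally have "\<gamma> has_fps_expansion cx ((1 + fps_const (9 / pi\<^sup>2) * fps_X\<^sup>2) * zagier_fps)" using G by simp
  then show ?thesis using that hol nz unfolding cx_def by blast
qed

text \<open>Odd coefficients rescaled by the square of the dominant pole. Multiplied by
  \<open>zagier_pole\<close>, they are partial sums of the Taylor series of the regularised function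
  at that pole.\<close>

definition zagier_coeff :: "nat \<Rightarrow> real" where
  "zagier_coeff k = (- (pi\<^sup>2 / 9)) ^ k * zagier_fps $ (2 * k + 1)"

text \<open>The differences of consecutive values are, up to the factor \<open>zagier_pole\<close>,
  Taylor terms of \<gamma> at the pole. The pole lies well inside the disc of holomorphy, so these
  terms decay geometrically and sum to a nonzero value.\<close>

lemma zagier_coeff_asymptotics:
  obtains C K where "C \<noteq> 0" "zagier_coeff \<longlonglongrightarrow> C"
    "\<And>k. \<bar>zagier_coeff (Suc k) - zagier_coeff k\<bar> \<le> K * (1 / 2) ^ Suc k"
proof -
  obtain \<gamma> where \<gamma>: "\<gamma> holomorphic_on ball 0 pi" "\<gamma> zagier_pole \<noteq> 0"
    "\<gamma> has_fps_expansion (Abs_fps (\<lambda>n. of_real (((1 + fps_const (9 / pi\<^sup>2) * fps_X\<^sup>2) * zagier_fps) $ n)))"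
    by (rule zagier_fps_regularization)
  define g where "g = (\<lambda>n. ((1 + fps_const (9 / pi\<^sup>2) * fps_X\<^sup>2) * zagier_fps) $ n)"
  have g_eq: "g n = zagier_fps $ n + 9 / pi\<^sup>2 * (if n < 2 then 0 else zagier_fps $ (n - 2))" for n
    by (simp add: g_def distrib_right mult.assoc fps_X_power_mult_nth)
  have hol: "\<gamma> holomorphic_on eball 0 (ereal pi)" using \<gamma>(1) by (simp add: eball_def ball_def)
  have sums: "(\<lambda>n. of_real (g n) * z ^ n) sums \<gamma> z" if "norm z < pi" for z
    using has_fps_expansion_imp_sums_complex[OF \<gamma>(3) hol, of z] that by (simp add: g_def)
  have g_even: "g (2 * k) = 0" for k
  proof (cases k)
    case (Suc j)
    then show ?thesis using zagier_fps_even[of k] zagier_fps_even[of j] by (simp add: g_eq)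
  qed (use zagier_fps_even[of 0] in \<open>simp add: g_eq\<close>)
  define c where "c = - (pi\<^sup>2 / 9)"
  have c0: "c \<noteq> 0" "9 / pi\<^sup>2 * c = -1" by (simp_all add: c_def)
  have step: "zagier_coeff (Suc k) - zagier_coeff k = c ^ Suc k * g (2 * Suc k + 1)" for k
  proof -
    have "c ^ Suc k * g (2 * Suc k + 1) = c ^ Suc k * zagier_fps $ (2 * Suc k + 1) + (9 / pi\<^sup>2 * c) * c ^ k * zagier_fps $ (2 * k + 1)"
      by (simp add: g_eq algebra_simps)
    then show ?thesis unfolding c0 by (simp add: zagier_coeff_def c_def)
  qed
  have norm_sum: "zagier_coeff k = (\<Sum>i\<le>k. c ^ i * g (2 * i + 1))" for k
  proof (induction k)
    case (Suc k) then show ?case using step[of k] by simp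
  qed (simp add: zagier_coeff_def g_eq)
  have "(\<lambda>n. of_real (g n) * zagier_pole ^ n) sums \<gamma> zagier_pole"
    by (rule sums) (simp add: norm_zagier_pole)
  then have "(\<lambda>i. of_real (g (2 * i + 1)) * zagier_pole ^ (2 * i + 1)) sums \<gamma> zagier_pole"
  proof (rule sums_mono_reindex[THEN iffD2, rotated 2])
    show "strict_mono (\<lambda>i::nat. 2 * i + 1)" by (simp add: strict_mono_def)
    fix n assume "n \<notin> range (\<lambda>i::nat. 2 * i + 1)"
    then have "even n" by (metis oddE rangeI)
    then show "complex_of_real (g n) * zagier_pole ^ n = 0" using g_even by (auto elim!: evenE)
  qed
  then have "(\<lambda>i. zagier_pole * of_real (c ^ i * g (2 * i + 1))) sums \<gamma> zagier_pole"
  proof -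
    have "zagier_pole ^ (2 * i + 1) = zagier_pole * of_real (c ^ i)" for i
      by (simp only: power_add power_mult power_one_right zagier_pole_sq) (simp add: c_def)
    with \<open>(\<lambda>i. of_real (g (2 * i + 1)) * zagier_pole ^ (2 * i + 1)) sums \<gamma> zagier_pole\<close> show ?thesis
      by (simp only: of_real_mult mult_ac)
  qed
  then have "(\<lambda>i. of_real (c ^ i * g (2 * i + 1)) :: complex) sums (\<gamma> zagier_pole / zagier_pole)"
    using sums_mult_D[of zagier_pole] by (auto simp: zagier_pole_def)
  then have lim: "(\<lambda>k. complex_of_real (zagier_coeff k)) \<longlonglongrightarrow> \<gamma> zagier_pole / zagier_pole"
    unfolding sums_def_le norm_sum by simp
  then have "(\<lambda>k. Re (complex_of_real (zagier_coeff k))) \<longlonglongrightarrow> Re (\<gamma> zagier_pole / zagier_pole)" by (rule tendsto_Re)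
  then have limr: "zagier_coeff \<longlonglongrightarrow> Re (\<gamma> zagier_pole / zagier_pole)" by simp
  then have "(\<lambda>k. complex_of_real (zagier_coeff k)) \<longlonglongrightarrow> of_real (Re (\<gamma> zagier_pole / zagier_pole))" by (rule tendsto_of_real)
  with lim have "of_real (Re (\<gamma> zagier_pole / zagier_pole)) = \<gamma> zagier_pole / zagier_pole" using LIMSEQ_unique by blast
  moreover have "\<gamma> zagier_pole / zagier_pole \<noteq> 0" using \<gamma>(2) by (simp add: zagier_pole_def)
  ultimately have nz: "Re (\<gamma> zagier_pole / zagier_pole) \<noteq> 0" by fastforce
  \<comment> \<open>Radius 3 lies inside the disc, so |g n| is O(3^(-n)); with the crude bound |c|
    <= 9/2 = 3^2 / 2 this gives the rate 1/2.\<close>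
  have "norm (3::complex) < pi" using pi_gt3 by simp
  from sums[OF this] have "summable (\<lambda>n. complex_of_real (g n) * 3 ^ n)" by (rule sums_summable)
  then have "(\<lambda>n. complex_of_real (g n) * 3 ^ n) \<longlonglongrightarrow> 0" by (rule summable_LIMSEQ_zero)
  then have "Bseq (\<lambda>n. complex_of_real (g n) * 3 ^ n)" by (intro convergent_imp_Bseq convergentI)
  then obtain B where B: "\<And>n. norm (complex_of_real (g n) * 3 ^ n) \<le> B" by (meson BseqE)
  have "\<bar>zagier_coeff (Suc k) - zagier_coeff k\<bar> \<le> B * (1 / 2) ^ Suc k" for k
  proof -
    have b: "\<bar>g n\<bar> * 3 ^ n \<le> B" for n using B[of n] by (simp add: norm_mult norm_power)
    have "\<bar>c\<bar> \<le> 9 / 2" using pi_less_4 mult_mono[of pi 4 pi 4] by (simp add: c_def power2_eq_square)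
    then have "\<bar>c\<bar> ^ Suc k \<le> (9 / 2) ^ Suc k" by (intro power_mono) auto
    then have "\<bar>zagier_coeff (Suc k) - zagier_coeff k\<bar> \<le> (9 / 2) ^ Suc k * \<bar>g (2 * Suc k + 1)\<bar>"
      unfolding step abs_mult power_abs by (intro mult_right_mono) auto
    also have "\<dots> = (1 / 2) ^ Suc k * (\<bar>g (2 * Suc k + 1)\<bar> * 3 ^ (2 * Suc k))"
    proof -
      have "(9 / 2 :: real) ^ Suc k = (1 / 2) ^ Suc k * (3\<^sup>2) ^ Suc k" by (simp only: power_mult_distrib[symmetric]) simp
      moreover have "(3::real) ^ (2 * Suc k) = (3\<^sup>2) ^ Suc k" by (rule power_mult)
      ultimately show ?thesis by (simp only: mult_ac)
    qed
    also have "\<dots> \<le> (1 / 2) ^ Suc k * B"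
    proof (intro mult_left_mono)
      have "\<bar>g (2 * Suc k + 1)\<bar> * 3 ^ (2 * Suc k) \<le> \<bar>g (2 * Suc k + 1)\<bar> * 3 ^ (2 * Suc k + 1)"
        by (intro mult_left_mono power_increasing) auto
      also have "\<dots> \<le> B" by (rule b)
      finally show "\<bar>g (2 * Suc k + 1)\<bar> * 3 ^ (2 * Suc k) \<le> B" .
    qed simp
    finally show ?thesis by (simp add: mult.commute)
  qed
  with nz limr show ?thesis using that by blast
qed

section \<open>Factorially divergent power series\<close>

text \<open>At least factorial growth. Its consequence s (n-j) <= s n B^j / j! turns convolutions
  with geometrically bounded sequences into exponential sums bounded uniformly in n.\<close>

definition fact_growth :: "real \<Rightarrow> (nat \<Rightarrow> real) \<Rightarrow> bool" where
  "fact_growth B s \<longleftrightarrow> (\<forall>n. s n > 0 \<and> real (Suc n) * s n \<le> B * s (Suc n))"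

text \<open>A bound for all n, which makes convolutions easy. The base is \<open>Suc n\<close>
  because \<open>0 powr e\<close> is 0, which would force the constant coefficient to
  vanish.\<close>

definition fps_bigo :: "(nat \<Rightarrow> real) \<Rightarrow> real \<Rightarrow> real fps \<Rightarrow> bool" where
  "fps_bigo s e f \<longleftrightarrow> (\<exists>c. \<forall>n. \<bar>f $ n\<bar> \<le> c * s n * real (Suc n) powr e)"

lemma fact_growth_pos: "fact_growth B s \<Longrightarrow> s n > 0" by (simp add: fact_growth_def)

lemma fact_growth_B: "fact_growth B s \<Longrightarrow> B > 0"
proof -
  assume s: "fact_growth B s"
  then have s01: "0 < s 0" "s (Suc 0) > 0" and "real (Suc 0) * s 0 \<le> B * s (Suc 0)"
    by (simp_all only: fact_growth_def)
  then have "0 < B * s (Suc 0)" by simp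
  with s01 show "B > 0" by (simp add: zero_less_mult_iff)
qed

lemma fact_growth_diff:
  assumes "fact_growth B s" "j \<le> n"
  shows "s (n - j) * (fact n / fact (n - j)) \<le> B ^ j * s n"
  using assms(2)
proof (induction j)
  case (Suc j)
  then obtain k where k: "n - j = Suc k" "n - Suc j = k" by (metis Suc_diff_Suc Suc_le_eq)
  have "s k * (fact n / fact k) = (real (Suc k) * s k) * (fact n / fact (Suc k))"
    by (simp add: fact_Suc del: of_nat_Suc)
  also have "\<dots> \<le> (B * s (Suc k)) * (fact n / fact (Suc k))"
    using assms(1) by (intro mult_right_mono) (auto simp: fact_growth_def)
  also have "\<dots> = B * (s (n - j) * (fact n / fact (n - j)))" by (simp add: k)
  also have "\<dots> \<le> B * (B ^ j * s n)"
    using Suc fact_growth_B[OF assms(1)] by (intro mult_left_mono) auto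
  finally show ?case by (simp add: k mult_ac)
qed simp

text \<open>The extra binomial is what composition needs: coefficient j of a power u^(n-j) can be as
  large as K^j times this binomial.\<close>

lemma fact_growth_choose:
  assumes "fact_growth B s" "j \<le> n"
  shows "s (n - j) * real (n choose j) \<le> s n * (B ^ j / fact j)"
proof -
  have "s (n - j) * real (n choose j) = (s (n - j) * (fact n / fact (n - j))) / fact j"
    using assms(2) by (simp add: binomial_fact field_simps)
  also have "\<dots> \<le> (B ^ j * s n) / fact j"
    by (intro divide_right_mono fact_growth_diff assms) simp
  finally show ?thesis by (simp add: mult.commute)
qed

lemma fact_growth_le:
  assumes "fact_growth B s" "j \<le> n"
  shows "s (n - j) \<le> s n * (B ^ j / fact j)"
proof -
  have "s (n - j) * 1 \<le> s (n - j) * real (n choose j)"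
  proof (intro mult_left_mono)
    have "n choose j > 0" using assms(2) by simp
    then show "1 \<le> real (n choose j)" by linarith
  qed (use fact_growth_pos[OF assms(1), of "n - j"] in simp)
  also have "\<dots> \<le> s n * (B ^ j / fact j)" by (rule fact_growth_choose[OF assms])
  finally show ?thesis by simp
qed

lemma fact_growth_scale:
  assumes "fact_growth B a" "r > 0"
  shows "fact_growth (B / r) (\<lambda>n. a n * r ^ n)"
  unfolding fact_growth_def
proof (intro allI conjI)
  fix n
  show "a n * r ^ n > 0" using fact_growth_pos[OF assms(1), of n] assms(2) by simp
  have "real (Suc n) * a n * r ^ n \<le> B * a (Suc n) * r ^ n"
    using assms by (intro mult_right_mono) (auto simp: fact_growth_def)
  then show "real (Suc n) * (a n * r ^ n) \<le> B / r * (a (Suc n) * r ^ Suc n)"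
    using assms(2) by (simp add: mult_ac)
qed

text \<open>Comparing x and y in both directions covers exponents of either sign.\<close>

lemma powr_ratio_le:
  fixes x y r e :: real
  assumes "x > 0" "y > 0" "x \<le> r * y" "y \<le> r * x"
  shows "x powr e \<le> r powr \<bar>e\<bar> * y powr e"
proof -
  have r: "r > 0" using assms by (metis less_le_trans mult.commute zero_less_mult_pos)
  show ?thesis
  proof (cases "e \<ge> 0")
    case True
    have "x powr e \<le> (r * y) powr e" using assms True by (intro powr_mono2) auto
    then show ?thesis using r assms True by (simp add: powr_mult)
  next
    case False
    have "(r * x) powr e \<le> y powr e" using assms False by (intro powr_mono2') auto
    then have "r powr \<bar>e\<bar> * (r * x) powr e \<le> r powr \<bar>e\<bar> * y powr e" by (intro mult_left_mono) auto
    moreover have "r powr \<bar>e\<bar> * (r * x) powr e = x powr e"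
      using False r assms by (simp add: powr_mult powr_minus)
    ultimately show ?thesis by simp
  qed
qed

text \<open>A Peetre-type inequality: the index shift costs only a polynomial factor in j, absorbed
  later by j!.\<close>

lemma powr_shift_le:
  assumes "j \<le> n"
  shows "real (Suc (n - j)) powr e \<le> real (Suc j) powr \<bar>e\<bar> * real (Suc n) powr e"
proof (rule powr_ratio_le)
  obtain k where k: "n = j + k" using assms le_Suc_ex by blast
  have "Suc (n - j) \<le> Suc j * Suc n" "Suc n \<le> Suc j * Suc (n - j)" by (simp_all add: k)
  then show "real (Suc (n - j)) \<le> real (Suc j) * real (Suc n)" "real (Suc n) \<le> real (Suc j) * real (Suc (n - j))"
    by (metis of_nat_le_iff of_nat_mult)+
qed auto

lemma weighted_exp_sum_le:
  fixes D a :: real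
  assumes "D \<ge> 0"
  shows "(\<Sum>j\<le>n. D ^ j / fact j * real (Suc j) powr \<bar>a\<bar>) \<le> exp (D * exp \<bar>a\<bar>)"
proof -
  have "(\<Sum>j\<le>n. D ^ j / fact j * real (Suc j) powr \<bar>a\<bar>) \<le> (\<Sum>j\<le>n. (D * exp \<bar>a\<bar>) ^ j / fact j)"
  proof (intro sum_mono)
    fix j
    have "real (Suc j) \<le> exp (real j)" using exp_ge_add_one_self[of "real j"] by simp
    then have "real (Suc j) powr \<bar>a\<bar> \<le> exp (real j) powr \<bar>a\<bar>" by (intro powr_mono2) auto
    also have "\<dots> = exp \<bar>a\<bar> ^ j" by (simp add: powr_def exp_of_nat_mult[symmetric] mult.commute)
    finally have "D ^ j / fact j * real (Suc j) powr \<bar>a\<bar> \<le> D ^ j / fact j * exp \<bar>a\<bar> ^ j"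
      using assms by (intro mult_left_mono) auto
    then show "D ^ j / fact j * real (Suc j) powr \<bar>a\<bar> \<le> (D * exp \<bar>a\<bar>) ^ j / fact j"
      by (simp add: power_mult_distrib)
  qed
  also have "\<dots> = (\<Sum>j\<in>{..n}. (D * exp \<bar>a\<bar>) ^ j /\<^sub>R fact j)" by (simp add: divide_inverse mult.commute)
  also have "\<dots> \<le> (\<Sum>j. (D * exp \<bar>a\<bar>) ^ j /\<^sub>R fact j)"
    using assms by (intro sum_le_suminf summable_exp_generic) auto
  also have "\<dots> = exp (D * exp \<bar>a\<bar>)" by (simp add: exp_def)
  finally show ?thesis .
qed

lemma fps_bigoE:
  assumes "fps_bigo s e f" "fact_growth B s"
  obtains c where "c \<ge> 0" "\<And>n. \<bar>f $ n\<bar> \<le> c * s n * real (Suc n) powr e"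
proof -
  obtain c where c: "\<And>n. \<bar>f $ n\<bar> \<le> c * s n * real (Suc n) powr e"
    using assms(1) unfolding fps_bigo_def by blast
  have "0 \<le> c * s 0" using c[of 0] by simp
  then have "c \<ge> 0" using fact_growth_pos[OF assms(2), of 0] by (simp add: zero_le_mult_iff)
  with c show ?thesis using that by blast
qed

lemma fps_bigo_add:
  assumes "fps_bigo s e f" "fps_bigo s e g"
  shows "fps_bigo s e (f + g)"
proof -
  from assms obtain c d where "\<And>n. \<bar>f $ n\<bar> \<le> c * s n * real (Suc n) powr e" "\<And>n. \<bar>g $ n\<bar> \<le> d * s n * real (Suc n) powr e"
    unfolding fps_bigo_def by blast
  then have "\<bar>(f + g) $ n\<bar> \<le> (c + d) * s n * real (Suc n) powr e" for n
    unfolding distrib_right fps_add_nth by (meson abs_triangle_ineq add_mono order_trans)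
  then show ?thesis unfolding fps_bigo_def by blast
qed

lemma fps_bigo_uminus: "fps_bigo s e f \<Longrightarrow> fps_bigo s e (- f)"
  by (simp add: fps_bigo_def)

lemma fps_bigo_diff: "fps_bigo s e f \<Longrightarrow> fps_bigo s e g \<Longrightarrow> fps_bigo s e (f - g)"
  using fps_bigo_add[of s e f "- g"] fps_bigo_uminus[of s e g] by simp

lemma fps_bigo_mono:
  assumes "fps_bigo s e f" "e \<le> e'" "fact_growth B s"
  shows "fps_bigo s e' f"
proof -
  obtain c where c: "c \<ge> 0" "\<And>n. \<bar>f $ n\<bar> \<le> c * s n * real (Suc n) powr e"
    using fps_bigoE[OF assms(1,3)] by blast
  have "c * s n * real (Suc n) powr e \<le> c * s n * real (Suc n) powr e'" for n
    using assms(2) c(1) fact_growth_pos[OF assms(3), of n]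
    by (intro mult_left_mono powr_mono mult_nonneg_nonneg) auto
  with c(2) show ?thesis unfolding fps_bigo_def by (meson order_trans)
qed

lemma fps_bigo_xderiv:
  assumes "fps_bigo s e f" "fact_growth B s"
  shows "fps_bigo s (e + 1) (fps_X * fps_deriv f)"
proof -
  obtain c where c: "c \<ge> 0" "\<And>n. \<bar>f $ n\<bar> \<le> c * s n * real (Suc n) powr e"
    using fps_bigoE[OF assms] by blast
  have "\<bar>(fps_X * fps_deriv f) $ n\<bar> \<le> c * s n * real (Suc n) powr (e + 1)" for n
  proof -
    have "\<bar>(fps_X * fps_deriv f) $ n\<bar> = real n * \<bar>f $ n\<bar>" by (cases n) (auto simp: abs_mult)
    also have "\<dots> \<le> real (Suc n) * (c * s n * real (Suc n) powr e)"
      by (intro mult_mono c(2)) auto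
    also have "\<dots> = c * s n * real (Suc n) powr (e + 1)" by (simp add: powr_add)
    finally show ?thesis .
  qed
  then show ?thesis unfolding fps_bigo_def by blast
qed

text \<open>The gain of 1/n is the growth of the weight: s (n-1) is at most B s n / n. Powers of X
  thus play the part of an expansion parameter.\<close>

lemma fps_bigo_X:
  assumes "fps_bigo s e f" "fact_growth B s"
  shows "fps_bigo s (e - 1) (fps_X * f)"
proof -
  obtain c where c: "c \<ge> 0" "\<And>n. \<bar>f $ n\<bar> \<le> c * s n * real (Suc n) powr e"
    using fps_bigoE[OF assms] by blast
  have "\<bar>(fps_X * f) $ n\<bar> \<le> c * B * 2 powr \<bar>e - 1\<bar> * s n * real (Suc n) powr (e - 1)" for n
  proof (cases n)
    case 0
    then show ?thesis using c(1) fact_growth_B[OF assms(2)] fact_growth_pos[OF assms(2), of 0] by simp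
  next
    case (Suc m)
    have "\<bar>(fps_X * f) $ n\<bar> \<le> c * s m * real (Suc m) powr e" using c(2) Suc by simp
    also have "\<dots> = c * (real (Suc m) * s m) * real (Suc m) powr (e - 1)"
      by (simp add: powr_diff)
    also have "\<dots> \<le> c * (B * s (Suc m)) * (2 powr \<bar>e - 1\<bar> * real (Suc (Suc m)) powr (e - 1))"
    proof (rule mult_mono)
      show "c * (real (Suc m) * s m) \<le> c * (B * s (Suc m))"
        using assms(2) c(1) by (intro mult_left_mono) (simp_all only: fact_growth_def)
      show "real (Suc m) powr (e - 1) \<le> 2 powr \<bar>e - 1\<bar> * real (Suc (Suc m)) powr (e - 1)"
        by (rule powr_ratio_le) auto
    qed (use c(1) fact_growth_B[OF assms(2)] fact_growth_pos[OF assms(2)] in \<open>auto simp: less_imp_le\<close>)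
    finally show ?thesis by (simp add: Suc mult_ac)
  qed
  then show ?thesis unfolding fps_bigo_def by blast
qed

lemma fps_conv_radius_pos_bound:
  assumes "fps_conv_radius (b :: real fps) > 0"
  obtains K where "K \<ge> 1" "\<And>n. \<bar>b $ n\<bar> \<le> K ^ Suc n"
proof -
  obtain r :: real where r: "r > 0" "ereal r < fps_conv_radius b"
    using ereal_dense2[OF assms] by auto
  have "summable (\<lambda>n. b $ n * r ^ n)" using r by (intro summable_fps) auto
  then have "(\<lambda>n. b $ n * r ^ n) \<longlonglongrightarrow> 0" by (rule summable_LIMSEQ_zero)
  then have "Bseq (\<lambda>n. b $ n * r ^ n)" by (intro convergent_imp_Bseq convergentI)
  then obtain c where c: "c > 0" "\<And>n. norm (b $ n * r ^ n) \<le> c"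
    unfolding Bseq_def by blast
  define K where "K = max 1 (max c (1 / r))"
  have "\<bar>b $ n\<bar> \<le> K ^ Suc n" for n
  proof -
    have "\<bar>b $ n\<bar> = norm (b $ n * r ^ n) * (1 / r) ^ n" using r by (simp add: abs_mult power_divide)
    also have "\<dots> \<le> K * K ^ n"
    proof (rule mult_mono)
      show "norm (b $ n * r ^ n) \<le> K" using c(2)[of n] by (simp add: K_def)
      show "(1 / r) ^ n \<le> K ^ n" using r by (intro power_mono) (auto simp: K_def)
    qed (use r in \<open>auto simp: K_def\<close>)
    finally show ?thesis by simp
  qed
  moreover have "K \<ge> 1" by (simp add: K_def)
  ultimately show ?thesis using that by blast
qed

text \<open>The j-th term of the convolution is at most (K B)^j / j! times a power of j + 1,
  relative to the bound for f at n; these factors have a bounded sum.\<close>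

lemma fps_bigo_mult:
  assumes "fps_conv_radius b > 0" "fps_bigo s e f" "fact_growth B s"
  shows "fps_bigo s e (b * f)"
proof -
  obtain c where c: "c \<ge> 0" "\<And>n. \<bar>f $ n\<bar> \<le> c * s n * real (Suc n) powr e"
    using fps_bigoE[OF assms(2,3)] by blast
  obtain K where K: "K \<ge> 1" "\<And>n. \<bar>b $ n\<bar> \<le> K ^ Suc n"
    using fps_conv_radius_pos_bound[OF assms(1)] by blast
  note Bp = fact_growth_B[OF assms(3)] and sp = fact_growth_pos[OF assms(3)]
  have "\<bar>(b * f) $ n\<bar> \<le> (K * c * exp (K * B * exp \<bar>e\<bar>)) * s n * real (Suc n) powr e" for n
  proof -
    have "\<bar>(b * f) $ n\<bar> \<le> (\<Sum>j=0..n. \<bar>b $ j * f $ (n - j)\<bar>)"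
      unfolding fps_mult_nth by (rule sum_abs)
    also have "\<dots> \<le> (\<Sum>j=0..n. K * c * s n * real (Suc n) powr e * ((K * B) ^ j / fact j * real (Suc j) powr \<bar>e\<bar>))"
    proof (intro sum_mono)
      fix j assume "j \<in> {0..n}"
      then have j: "j \<le> n" by simp
      have "\<bar>b $ j * f $ (n - j)\<bar> \<le> K ^ Suc j * (c * s (n - j) * real (Suc (n - j)) powr e)"
        unfolding abs_mult by (intro mult_mono K c) (use K in auto)
      also have "\<dots> \<le> K ^ Suc j * (c * (s n * (B ^ j / fact j)) * (real (Suc j) powr \<bar>e\<bar> * real (Suc n) powr e))"
        using c(1) K(1) Bp sp[of n]
        by (intro mult_left_mono mult_mono fact_growth_le[OF assms(3) j] powr_shift_le j) (auto simp: less_imp_le)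
      also have "\<dots> = K * c * s n * real (Suc n) powr e * ((K * B) ^ j / fact j * real (Suc j) powr \<bar>e\<bar>)"
        by (simp add: power_mult_distrib mult_ac)
      finally show "\<bar>b $ j * f $ (n - j)\<bar> \<le> K * c * s n * real (Suc n) powr e * ((K * B) ^ j / fact j * real (Suc j) powr \<bar>e\<bar>)" .
    qed
    also have "\<dots> = K * c * s n * real (Suc n) powr e * (\<Sum>j\<le>n. (K * B) ^ j / fact j * real (Suc j) powr \<bar>e\<bar>)"
      by (simp only: sum_distrib_left atMost_atLeast0)
    also have "\<dots> \<le> K * c * s n * real (Suc n) powr e * exp (K * B * exp \<bar>e\<bar>)"
      using K(1) Bp c(1) sp[of n] by (intro mult_left_mono weighted_exp_sum_le) (auto simp: less_imp_le)
    finally show ?thesis by (simp add: mult_ac)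
  qed
  then show ?thesis unfolding fps_bigo_def by blast
qed

lemma fps_bigo_X_power:
  assumes "fps_bigo s e f" "fact_growth B s"
  shows "fps_bigo s (e - real k) (fps_X ^ k * f)"
proof (induction k)
  case (Suc k)
  have "fps_bigo s (e - real k - 1) (fps_X * (fps_X ^ k * f))" by (rule fps_bigo_X[OF Suc assms(2)])
  then show ?case by (simp add: mult.assoc algebra_simps)
qed (use assms in simp)

lemma fps_bigo_imp_tendsto_0:
  assumes "fps_bigo s e f" "e < 0" "fact_growth B s"
  shows "(\<lambda>n. f $ n / s n) \<longlonglongrightarrow> 0"
proof -
  obtain c where c: "c \<ge> 0" "\<And>n. \<bar>f $ n\<bar> \<le> c * s n * real (Suc n) powr e"
    using fps_bigoE[OF assms(1,3)] by blast
  have "(\<lambda>n. c * real (Suc n) powr e) \<longlonglongrightarrow> c * 0"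
    by (intro tendsto_mult tendsto_const tendsto_neg_powr[OF assms(2)] filterlim_compose[OF filterlim_real_sequentially filterlim_Suc])
  then have lim: "(\<lambda>n. c * real (Suc n) powr e) \<longlonglongrightarrow> 0" by simp
  have "norm (f $ n / s n) \<le> c * real (Suc n) powr e" for n
    proof -
      have "\<bar>f $ n\<bar> \<le> (c * real (Suc n) powr e) * s n" using c(2)[of n] by (simp only: mult_ac)
      then have "\<bar>f $ n\<bar> / s n \<le> c * real (Suc n) powr e"
        using fact_growth_pos[OF assms(3), of n] by (simp only: pos_divide_le_eq)
      then show ?thesis using fact_growth_pos[OF assms(3), of n] by (simp only: real_norm_def abs_divide abs_of_pos)
    qed
  then show ?thesis by (intro Lim_null_comparison[OF _ lim] always_eventually allI)
qed

section \<open>Composition of factorially divergent with convergent series\<close>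

lemma fps_power_coeff_bound:
  fixes u :: "real fps"
  assumes "\<And>n. \<bar>u $ n\<bar> \<le> K ^ n"
  shows "\<bar>(u ^ m) $ j\<bar> \<le> K ^ j * real ((m + j) choose j)"
proof (induction m arbitrary: j)
  case 0 then show ?case using order_trans[OF abs_ge_zero assms[of 1]] by (simp add: fps_one_nth)
next
  case (Suc m)
  have K: "K \<ge> 0" using order_trans[OF abs_ge_zero assms[of 1]] by simp
  have "\<bar>(u ^ Suc m) $ j\<bar> = \<bar>(u ^ m * u) $ j\<bar>" by (simp add: mult.commute)
  also have "\<dots> \<le> (\<Sum>i=0..j. \<bar>(u ^ m) $ i * u $ (j - i)\<bar>)" unfolding fps_mult_nth by (rule sum_abs)
  also have "\<dots> \<le> (\<Sum>i=0..j. K ^ j * real ((m + i) choose i))"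
  proof (intro sum_mono)
    fix i assume "i \<in> {0..j}"
    then have "K ^ j = K ^ i * K ^ (j - i)" by (simp flip: power_add)
    moreover have "\<bar>(u ^ m) $ i * u $ (j - i)\<bar> \<le> (K ^ i * real ((m + i) choose i)) * K ^ (j - i)"
      unfolding abs_mult using K by (intro mult_mono Suc assms) auto
    ultimately show "\<bar>(u ^ m) $ i * u $ (j - i)\<bar> \<le> K ^ j * real ((m + i) choose i)" by (simp add: mult_ac)
  qed
  also have "\<dots> = K ^ j * real (\<Sum>i\<le>j. (m + i) choose i)"
    by (simp add: sum_distrib_left atMost_atLeast0)
  \<comment> \<open>The hockey-stick identity. The bound reflects that u is majorised by 1 / (1 - K
    z), hence u^m by its m-th power.\<close>
  also have "\<dots> = K ^ j * real ((Suc m + j) choose j)" by (simp only: sum_choose_lower) simp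
  finally show ?case .
qed

text \<open>The exponent is n, not n + 1, thanks to u(0) = 1. Otherwise u^m would bring a factor K^m
  and spoil the weight.\<close>

lemma fps_unit_bound:
  assumes "fps_conv_radius (u :: real fps) > 0" "u $ 0 = 1"
  obtains K where "K \<ge> 1" "\<And>n. \<bar>u $ n\<bar> \<le> K ^ n"
proof -
  obtain K where K: "K \<ge> 1" "\<And>n. \<bar>u $ n\<bar> \<le> K ^ Suc n"
    using fps_conv_radius_pos_bound[OF assms(1)] by blast
  have "\<bar>u $ n\<bar> \<le> (K\<^sup>2) ^ n" for n
  proof (cases "n = 0")
    case False
    have "\<bar>u $ n\<bar> \<le> K ^ Suc n" by (rule K)
    also have "\<dots> \<le> K ^ (2 * n)" using K False by (intro power_increasing) auto
    finally show ?thesis by (simp add: power_mult)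
  qed (use assms in simp)
  moreover have "K\<^sup>2 \<ge> 1" using K by simp
  ultimately show ?thesis using that by blast
qed

text \<open>Indexed by the distance j from the top coefficient, since the terms with fixed j
  dominate.\<close>

lemma fps_compose_nth_rev:
  fixes u :: "real fps"
  shows "(f oo (fps_const r * fps_X * u)) $ n = (\<Sum>j\<le>n. f $ (n - j) * r ^ (n - j) * (u ^ (n - j)) $ j)"
proof -
  have "(f oo (fps_const r * fps_X * u)) $ n = (\<Sum>i=0..n. f $ i * ((fps_const r * fps_X * u) ^ i) $ n)"
    by (rule fps_compose_nth)
  also have "\<dots> = (\<Sum>i=0..n. f $ i * r ^ i * (u ^ i) $ (n - i))"
  proof (rule sum.cong)
    fix i assume "i \<in> {0..n}"
    then have "((fps_const r * fps_X * u) ^ i) $ n = r ^ i * (u ^ i) $ (n - i)"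
      by (simp add: power_mult_distrib fps_const_power mult.assoc fps_X_power_mult_nth)
    then show "f $ i * ((fps_const r * fps_X * u) ^ i) $ n = f $ i * r ^ i * (u ^ i) $ (n - i)" by simp
  qed simp
  also have "\<dots> = (\<Sum>j=0..n. f $ (n - j) * r ^ (n - j) * (u ^ (n - j)) $ j)"
    by (subst sum.atLeastAtMost_rev) (auto intro!: sum.cong)
  finally show ?thesis by (simp add: atMost_atLeast0)
qed

text \<open>Serves twice: summed over j it bounds a composition, and with e = 0 it is the majorant
  for exchanging limit and sum.\<close>

lemma compose_term_bound:
  assumes "fact_growth B a" "r > 0" "\<And>n. \<bar>u $ n\<bar> \<le> K ^ n" "K \<ge> 1" "c \<ge> 0"
    and "\<And>n. \<bar>f $ n\<bar> \<le> c * a n * real (Suc n) powr e" "j \<le> n"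
  shows "\<bar>f $ (n - j) * r ^ (n - j) * (u ^ (n - j)) $ j\<bar>
    \<le> c * (a n * r ^ n) * real (Suc n) powr e * ((K * B / r) ^ j / fact j * real (Suc j) powr \<bar>e\<bar>)"
proof -
  note Bp = fact_growth_B[OF assms(1)] and sp = fact_growth_pos[OF assms(1)]
  have "\<bar>(u ^ (n - j)) $ j\<bar> \<le> K ^ j * real (n choose j)"
    using fps_power_coeff_bound[of u K "n - j" j] assms by simp
  then have "\<bar>f $ (n - j)\<bar> * r ^ (n - j) * \<bar>(u ^ (n - j)) $ j\<bar>
     \<le> (c * a (n - j) * real (Suc (n - j)) powr e) * r ^ (n - j) * (K ^ j * real (n choose j))"
    using assms(2,5) sp[of "n - j"]
    by (intro mult_mono[OF mult_right_mono[OF assms(6)]]) (auto simp: less_imp_le)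
  then have "\<bar>f $ (n - j) * r ^ (n - j) * (u ^ (n - j)) $ j\<bar>
     \<le> (c * a (n - j) * real (Suc (n - j)) powr e) * r ^ (n - j) * (K ^ j * real (n choose j))"
    using assms(2) by (simp add: abs_mult)
  also have "\<dots> = c * (a (n - j) * real (n choose j)) * real (Suc (n - j)) powr e * r ^ (n - j) * K ^ j"
    by (simp add: mult_ac)
  also have "\<dots> \<le> c * (a n * (B ^ j / fact j)) * (real (Suc j) powr \<bar>e\<bar> * real (Suc n) powr e) * r ^ (n - j) * K ^ j"
  proof -
    have "c * (a (n - j) * real (n choose j)) * real (Suc (n - j)) powr e
       \<le> c * (a n * (B ^ j / fact j)) * (real (Suc j) powr \<bar>e\<bar> * real (Suc n) powr e)"
      using assms(5) Bp sp[of n]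
      by (intro mult_mono[OF mult_left_mono[OF fact_growth_choose[OF assms(1,7)]] powr_shift_le[OF assms(7)]])
         (auto simp: less_imp_le)
    then show ?thesis using assms(2,4) by (intro mult_right_mono) auto
  qed
  also have "\<dots> = c * (a n * r ^ n) * real (Suc n) powr e * ((K * B / r) ^ j / fact j * real (Suc j) powr \<bar>e\<bar>)"
  proof -
    have "r ^ (n - j) = r ^ n / r ^ j" using assms by (simp add: power_diff)
    then show ?thesis by (simp only: power_mult_distrib power_divide) (simp add: mult_ac)
  qed
  finally show ?thesis .
qed

lemma fps_bigo_compose:
  assumes "fact_growth B a" "r > 0" "fps_conv_radius u > 0" "u $ 0 = 1" "fps_bigo a e f"
  shows "fps_bigo (\<lambda>n. a n * r ^ n) e (f oo (fps_const r * fps_X * u))"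
proof -
  obtain c where c: "c \<ge> 0" "\<And>n. \<bar>f $ n\<bar> \<le> c * a n * real (Suc n) powr e"
    using fps_bigoE[OF assms(5,1)] by blast
  obtain K where K: "K \<ge> 1" "\<And>n. \<bar>u $ n\<bar> \<le> K ^ n" using fps_unit_bound[OF assms(3,4)] by blast
  note Bp = fact_growth_B[OF assms(1)] and sp = fact_growth_pos[OF assms(1)]
  have "\<bar>(f oo (fps_const r * fps_X * u)) $ n\<bar> \<le> (c * exp (K * B / r * exp \<bar>e\<bar>)) * (a n * r ^ n) * real (Suc n) powr e" for n
  proof -
    have "\<bar>(f oo (fps_const r * fps_X * u)) $ n\<bar> \<le> (\<Sum>j\<le>n. \<bar>f $ (n - j) * r ^ (n - j) * (u ^ (n - j)) $ j\<bar>)"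
      unfolding fps_compose_nth_rev by (rule sum_abs)
    also have "\<dots> \<le> (\<Sum>j\<le>n. c * (a n * r ^ n) * real (Suc n) powr e * ((K * B / r) ^ j / fact j * real (Suc j) powr \<bar>e\<bar>))"
      by (intro sum_mono compose_term_bound assms K c) auto
    also have "\<dots> = c * (a n * r ^ n) * real (Suc n) powr e * (\<Sum>j\<le>n. (K * B / r) ^ j / fact j * real (Suc j) powr \<bar>e\<bar>)"
      by (simp only: sum_distrib_left)
    also have "\<dots> \<le> c * (a n * r ^ n) * real (Suc n) powr e * exp (K * B / r * exp \<bar>e\<bar>)"
      using K(1) Bp c(1) sp[of n] assms(2) by (intro mult_left_mono weighted_exp_sum_le) (auto simp: less_imp_le)
    finally show ?thesis by (simp add: mult_ac)
  qed
  then show ?thesis unfolding fps_bigo_def by blast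
qed

lemma binomial_shift_limit:
  "(\<lambda>n. real ((n - j) choose i) / real n ^ i) \<longlonglongrightarrow> 1 / fact i"
proof -
  have "(\<lambda>n. (\<Prod>k=0..<i. (real n - real j - real k) / real n) / fact i) \<longlonglongrightarrow> (\<Prod>k=0..<i. 1) / fact i"
  proof (intro tendsto_divide tendsto_prod tendsto_const)
    fix k
    show "(\<lambda>n. (real n - real j - real k) / real n) \<longlonglongrightarrow> 1" by real_asymp
  qed simp
  then have "(\<lambda>n. (\<Prod>k=0..<i. (real n - real j - real k) / real n) / fact i) \<longlonglongrightarrow> 1 / fact i" by simp
  moreover have "eventually (\<lambda>n. (\<Prod>k=0..<i. (real n - real j - real k) / real n) / fact i = real ((n - j) choose i) / real n ^ i) sequentially"
    using eventually_ge_at_top[of j]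
  proof eventually_elim
    case (elim n)
    then have "real ((n - j) choose i) = (\<Prod>k=0..<i. real n - real j - real k) / fact i"
      by (simp only: binomial_gbinomial gbinomial_prod_rev of_nat_diff)
    then show ?case by (simp add: prod_dividef)
  qed
  ultimately show ?thesis by (rule Lim_transform_eventually)
qed

text \<open>Writing u = 1 + w with w divisible by X, the binomial expansion has terms of order n^i
  with i <= j; only i = j survives division by n^j, and [X^j] w^j is the j-th power of u_1.\<close>

lemma fps_power_coeff_limit:
  fixes u :: "real fps"
  assumes "u $ 0 = 1"
  shows "(\<lambda>n. (u ^ (n - j)) $ j / real n ^ j) \<longlonglongrightarrow> (u $ 1) ^ j / fact j"
proof -
  define w where "w = u - 1"
  have w0: "w $ 0 = 0" by (simp add: w_def assms)
  have e: "(u ^ m) $ j = (\<Sum>i\<le>j. real (m choose i) * (w ^ i) $ j)" for m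
  proof -
    have "(u ^ m) $ j = ((w + 1) ^ m) $ j" by (simp add: w_def)
    also have "\<dots> = (\<Sum>i\<le>m. real (m choose i) * (w ^ i) $ j)"
      by (simp add: binomial_ring fps_sum_nth fps_mult_of_nat_nth(1))
    also have "\<dots> = (\<Sum>i\<le>max m j. real (m choose i) * (w ^ i) $ j)"
      by (rule sum.mono_neutral_left) (auto simp: binomial_eq_0)
    also have "\<dots> = (\<Sum>i\<le>j. real (m choose i) * (w ^ i) $ j)"
      by (rule sum.mono_neutral_right) (auto simp: startsby_zero_power_prefix w0)
    finally show ?thesis .
  qed
  have "(\<lambda>n. \<Sum>i\<le>j. (real ((n - j) choose i) / real n ^ i) * (1 / real n) ^ (j - i) * (w ^ i) $ j)
     \<longlonglongrightarrow> (\<Sum>i\<le>j. 1 / fact i * 0 ^ (j - i) * (w ^ i) $ j)"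
    by (intro tendsto_sum tendsto_mult binomial_shift_limit tendsto_power tendsto_const lim_1_over_n)
  also have "(\<Sum>i\<le>j. 1 / fact i * 0 ^ (j - i) * (w ^ i) $ j) = (\<Sum>i\<le>j. if i = j then (w ^ j) $ j / fact j else 0)"
    by (intro sum.cong) (auto simp: power_0_left)
  also have "\<dots> = (w ^ j) $ j / fact j" by simp
  also have "(w ^ j) $ j = (u $ 1) ^ j" using startsby_zero_power_nth_same[OF w0, of j] by (simp add: w_def fps_one_nth)
  finally have "(\<lambda>n. \<Sum>i\<le>j. (real ((n - j) choose i) / real n ^ i) * (1 / real n) ^ (j - i) * (w ^ i) $ j)
     \<longlonglongrightarrow> (u $ 1) ^ j / fact j" .
  moreover have "eventually (\<lambda>n. (\<Sum>i\<le>j. (real ((n - j) choose i) / real n ^ i) * (1 / real n) ^ (j - i) * (w ^ i) $ j)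
      = (u ^ (n - j)) $ j / real n ^ j) sequentially"
    using eventually_gt_at_top[of 0]
  proof eventually_elim
    case (elim n)
    show ?case unfolding e sum_divide_distrib
    proof (rule sum.cong)
      fix i assume "i \<in> {..j}"
      then have "real n ^ j = real n ^ i * real n ^ (j - i)" by (simp flip: power_add)
      then show "(real ((n - j) choose i) / real n ^ i) * (1 / real n) ^ (j - i) * (w ^ i) $ j = real ((n - j) choose i) * (w ^ i) $ j / real n ^ j"
        by (simp add: power_divide)
    qed simp
  qed
  ultimately show ?thesis by (rule Lim_transform_eventually)
qed

text \<open>
  All terms \<open>f_{n-j} [z^n] L^{n-j}\<close> with \<open>j\<close> fixed contribute to the leading order, because
  \<open>[z^j] u^{n-j}\<close> grows like \<open>n^j\<close>; this is the source of the exponential factor.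
\<close>

lemma fps_compose_leading_asymptotics:
  assumes a: "fact_growth B a" and r: "r > 0" and u: "fps_conv_radius u > 0" "u $ 0 = 1"
    and ratio: "(\<lambda>n. real (Suc n) * a n / a (Suc n)) \<longlonglongrightarrow> \<rho>"
    and lim: "(\<lambda>n. f $ n / a n) \<longlonglongrightarrow> C"
  shows "(\<lambda>n. (f oo (fps_const r * fps_X * u)) $ n / (a n * r ^ n)) \<longlonglongrightarrow> C * exp (\<rho> * (u $ 1) / r)"
proof -
  note ap = fact_growth_pos[OF a]
  have anz: "a n \<noteq> 0" for n using ap[of n] by simp
  obtain K where K: "K \<ge> 1" "\<And>n. \<bar>u $ n\<bar> \<le> K ^ n" using fps_unit_bound[OF u] by blast
  have "Bseq (\<lambda>n. f $ n / a n)" using lim by (intro convergent_imp_Bseq convergentI)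
  then obtain c where c: "c > 0" "\<And>n. norm (f $ n / a n) \<le> c"
    unfolding Bseq_def by blast
  have fb: "\<bar>f $ n\<bar> \<le> c * a n * real (Suc n) powr 0" for n
    using c(2)[of n] ap[of n] by (simp add: abs_divide field_simps)
  define t where "t = (\<lambda>j n. if j \<le> n then f $ (n - j) * r ^ (n - j) * (u ^ (n - j)) $ j / (a n * r ^ n) else 0)"
  define M where "M = (\<lambda>j. c * ((K * B / r) ^ j / fact j))"
  have a_ratio: "(\<lambda>n. real n ^ j * a (n - j) / a n) \<longlonglongrightarrow> \<rho> ^ j" for j
  proof (induction j)
    case 0 then show ?case by (simp add: anz)
  next
    case (Suc j)
    have s1: "(\<lambda>n. real (Suc n + j) ^ j * a (Suc n) / a (Suc n + j)) \<longlonglongrightarrow> \<rho> ^ j"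
      using LIMSEQ_ignore_initial_segment[OF Suc, of "Suc j"] by simp
    have s2: "(\<lambda>n. real (Suc n + j) / real (Suc n)) \<longlonglongrightarrow> 1" by real_asymp
    have "(\<lambda>n. (real (Suc n + j) ^ j * a (Suc n) / a (Suc n + j)) * (real (Suc n + j) / real (Suc n)) * (real (Suc n) * a n / a (Suc n)))
       \<longlonglongrightarrow> \<rho> ^ j * 1 * \<rho>"
      by (intro tendsto_mult s1 s2 ratio)
    also have "(\<lambda>n. (real (Suc n + j) ^ j * a (Suc n) / a (Suc n + j)) * (real (Suc n + j) / real (Suc n)) * (real (Suc n) * a n / a (Suc n)))
       = (\<lambda>n. real (n + Suc j) ^ Suc j * a (n + Suc j - Suc j) / a (n + Suc j))"
      by (rule ext) (simp add: anz)
    finally have "(\<lambda>n. real (n + Suc j) ^ Suc j * a (n + Suc j - Suc j) / a (n + Suc j)) \<longlonglongrightarrow> \<rho> ^ Suc j"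
      by (simp add: mult.commute)
    then show ?case by (rule LIMSEQ_offset)
  qed
  have main: "(\<lambda>n. suminf (\<lambda>j. t j n)) \<longlonglongrightarrow> suminf (\<lambda>j. C * (\<rho> * (u $ 1) / r) ^ j / fact j)"
  \<comment> \<open>Tannery's theorem: termwise limits in j, dominated by the summable
    \<open>M\<close>.\<close>
  proof (rule tannerys_theorem[THEN conjunct2, THEN conjunct2])
    fix j
    have l1: "(\<lambda>n. f $ (n - j) / a (n - j)) \<longlonglongrightarrow> C"
      by (rule LIMSEQ_offset[of _ j]) (use lim in simp)
    have "(\<lambda>n. (f $ (n - j) / a (n - j)) * (real n ^ j * a (n - j) / a n) * ((u ^ (n - j)) $ j / real n ^ j) / r ^ j)
        \<longlonglongrightarrow> C * \<rho> ^ j * ((u $ 1) ^ j / fact j) / r ^ j"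
      using r by (intro tendsto_mult tendsto_divide tendsto_const l1 a_ratio fps_power_coeff_limit u) auto
    also have "C * \<rho> ^ j * ((u $ 1) ^ j / fact j) / r ^ j = C * (\<rho> * (u $ 1) / r) ^ j / fact j"
      by (simp add: power_mult_distrib power_divide mult_ac)
    finally show "(\<lambda>n. t j n) \<longlonglongrightarrow> C * (\<rho> * (u $ 1) / r) ^ j / fact j"
    proof (rule Lim_transform_eventually)
      show "eventually (\<lambda>n. (f $ (n - j) / a (n - j)) * (real n ^ j * a (n - j) / a n) * ((u ^ (n - j)) $ j / real n ^ j) / r ^ j = t j n) sequentially"
        using eventually_gt_at_top[of j]
      proof eventually_elim
        case (elim n)
        have nz: "real n ^ j \<noteq> 0" "r ^ (n - j) \<noteq> 0" and rn: "r ^ n = r ^ j * r ^ (n - j)"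
          using elim r by (auto simp flip: power_add)
        have "x / b * (N * b / d) * (y / N) / R = x * S * y / (d * (R * S))"
          if "b \<noteq> 0" "N \<noteq> 0" "S \<noteq> 0" for x b N d y R S :: real
          using that by simp
        from this[OF anz nz] show ?case using elim by (simp only: t_def rn less_imp_le if_True)
      qed
    qed
  next
    have "norm (t j n) \<le> M j" for j n
    proof (cases "j \<le> n")
      case True
      have "\<bar>f $ (n - j) * r ^ (n - j) * (u ^ (n - j)) $ j\<bar>
          \<le> c * (a n * r ^ n) * real (Suc n) powr 0 * ((K * B / r) ^ j / fact j * real (Suc j) powr \<bar>0\<bar>)"
        using c(1) by (intro compose_term_bound a r K fb True) auto
      then have "\<bar>f $ (n - j) * r ^ (n - j) * (u ^ (n - j)) $ j\<bar> \<le> M j * (a n * r ^ n)"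
        by (simp add: M_def mult_ac)
      moreover have "a n * r ^ n > 0" using ap r by simp
      ultimately have "\<bar>f $ (n - j) * r ^ (n - j) * (u ^ (n - j)) $ j\<bar> / (a n * r ^ n) \<le> M j"
        by (simp add: pos_divide_le_eq)
      then show ?thesis using True \<open>a n * r ^ n > 0\<close> by (simp only: t_def if_True real_norm_def abs_divide abs_of_pos)
    next
      case False
      then show ?thesis using c(1) K(1) r fact_growth_B[OF a] by (simp add: t_def M_def)
    qed
    then show "\<forall>\<^sub>F (k, n) in sequentially \<times>\<^sub>F sequentially. norm (t k n) \<le> M k" by (intro always_eventually) auto
    show "summable M" unfolding M_def
      using summable_exp[of "K * B / r"] by (intro summable_mult) (simp add: divide_inverse mult.commute)
  qed simp
  have "suminf (\<lambda>j. C * (\<rho> * (u $ 1) / r) ^ j / fact j) = C * exp (\<rho> * (u $ 1) / r)"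
  proof -
    have "(\<lambda>j. C * ((\<rho> * (u $ 1) / r) ^ j /\<^sub>R fact j)) sums (C * exp (\<rho> * (u $ 1) / r))"
      by (intro sums_mult exp_converges)
    then show ?thesis by (simp add: sums_iff divide_inverse mult_ac)
  qed
  moreover have "suminf (\<lambda>j. t j n) = (f oo (fps_const r * fps_X * u)) $ n / (a n * r ^ n)" for n
  proof -
    have "suminf (\<lambda>j. t j n) = (\<Sum>j\<in>{..n}. t j n)" by (rule suminf_finite) (auto simp: t_def)
    also have "\<dots> = (f oo (fps_const r * fps_X * u)) $ n / (a n * r ^ n)"
      unfolding fps_compose_nth_rev sum_divide_distrib by (intro sum.cong) (auto simp: t_def)
    finally show ?thesis .
  qed
  ultimately show ?thesis using main by simp
qed

section \<open>The case \<open>\<Lambda> = exp\<close>\<close>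

definition fish_mu :: real where "fish_mu = 6 / pi\<^sup>2"

text \<open>The growth in \<open>Zagier_identity\<close> after normalisation: the factor 1/6 there
  times 9/pi^2 from the pole gives 3/(2 pi^2).\<close>

definition fish_a :: "nat \<Rightarrow> real" where
  "fish_a k = fact (2 * k + 1) / fact k * (3 / (2 * pi\<^sup>2)) ^ k"

lemma fish_mu_pos: "fish_mu > 0" by (simp add: fish_mu_def)

lemma fish_a_pos: "fish_a k > 0" by (simp add: fish_a_def)

text \<open>The origin of mu = 6/pi^2 and of the shift 3/2 in the theorem.\<close>

lemma fish_a_Suc: "fish_a (Suc k) = fish_mu * (real k + 3 / 2) * fish_a k"
proof -
  have "fact (2 * Suc k + 1) = (2 * real k + 3) * (2 * (real k + 1)) * fact (2 * k + 1)"
    by (simp add: algebra_simps)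
  moreover have "fact (Suc k) = (real k + 1) * fact k" by (simp add: algebra_simps)
  ultimately have "fish_a (Suc k) = ((2 * real k + 3) * (2 * (real k + 1)) * fact (2 * k + 1)) / ((real k + 1) * fact k)
      * (3 / (2 * pi\<^sup>2) * (3 / (2 * pi\<^sup>2)) ^ k)"
    by (simp only: fish_a_def power_Suc)
  also have "\<dots> = ((2 * real k + 3) * (2 * (real k + 1)) / (real k + 1)) * (3 / (2 * pi\<^sup>2)) * fish_a k"
  proof -
    have "x * P / (y * Q) * (c * R) = x / y * c * (P / Q * R)" for x y P Q c R :: real by simp
    then show ?thesis by (simp only: fish_a_def)
  qed
  also have "(2 * real k + 3) * (2 * (real k + 1)) / (real k + 1) = 2 * (2 * real k + 3)"
    by (simp add: nonzero_divide_eq_eq algebra_simps)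
  finally show ?thesis by (simp add: fish_mu_def field_simps)
qed

lemma fish_a_growth: "fact_growth (1 / fish_mu) fish_a"
  unfolding fact_growth_def
proof (intro allI conjI)
  fix n
  show "fish_a n > 0" by (rule fish_a_pos)
  have "real (Suc n) * fish_a n \<le> (real n + 3 / 2) * fish_a n"
    using fish_a_pos[of n] by (intro mult_right_mono) auto
  then show "real (Suc n) * fish_a n \<le> 1 / fish_mu * fish_a (Suc n)"
    using fish_mu_pos by (simp add: fish_a_Suc)
qed

lemma fish_a_ratio: "(\<lambda>n. real (Suc n) * fish_a n / fish_a (Suc n)) \<longlonglongrightarrow> 1 / fish_mu"
proof -
  have "(\<lambda>n. real (Suc n) / (real n + 3 / 2) / fish_mu) \<longlonglongrightarrow> 1 / fish_mu"
    using fish_mu_pos by (intro tendsto_divide tendsto_const) (real_asymp, simp)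
  moreover have "real (Suc n) / (real n + 3 / 2) / fish_mu = real (Suc n) * fish_a n / fish_a (Suc n)" for n
    using fish_a_pos[of n] by (simp add: fish_a_Suc)
  ultimately show ?thesis by simp
qed

lemma fps_bigo_of_limit:
  assumes "(\<lambda>n. f $ n / s n) \<longlonglongrightarrow> C" "fact_growth B s"
  shows "fps_bigo s 0 f"
proof -
  have "Bseq (\<lambda>n. f $ n / s n)" using assms(1) by (intro convergent_imp_Bseq convergentI)
  then obtain c where c: "\<And>n. norm (f $ n / s n) \<le> c" unfolding Bseq_def by blast
  have "\<bar>f $ n\<bar> \<le> c * s n * real (Suc n) powr 0" for n
    using c[of n] fact_growth_pos[OF assms(2), of n] by (simp add: abs_divide pos_divide_le_eq)
  then show ?thesis unfolding fps_bigo_def by blast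
qed

lemma fps_bigo_convergent:
  assumes "fps_conv_radius b > 0" "fact_growth B s"
  shows "fps_bigo s e b"
proof -
  have "\<bar>(1::real fps) $ n\<bar> \<le> (1 / s 0) * s n * real (Suc n) powr e" for n
    using fact_growth_pos[OF assms(2), of 0] fact_growth_pos[OF assms(2), of n] by (cases n) auto
  then have "fps_bigo s e 1" unfolding fps_bigo_def by blast
  from fps_bigo_mult[OF assms(1) this assms(2)] show ?thesis by simp
qed

text \<open>Undoing multiplication by X needs the reverse estimate, a weight of at most factorial
  growth, and costs one power of n.\<close>

lemma fps_bigo_divide_X:
  assumes "fps_bigo s e (fps_X * f)" "fact_growth B s" "\<And>n. s (Suc n) \<le> D * real (Suc n) * s n"
  shows "fps_bigo s (e + 1) f"
proof -
  obtain c where c: "c \<ge> 0" "\<And>n. \<bar>(fps_X * f) $ n\<bar> \<le> c * s n * real (Suc n) powr e"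
    using fps_bigoE[OF assms(1,2)] by blast
  have "\<bar>f $ n\<bar> \<le> c * D * 2 powr \<bar>e\<bar> * s n * real (Suc n) powr (e + 1)" for n
  proof -
    have "\<bar>f $ n\<bar> \<le> c * s (Suc n) * real (Suc (Suc n)) powr e" using c(2)[of "Suc n"] by simp
    also have "\<dots> \<le> c * (D * real (Suc n) * s n) * (2 powr \<bar>e\<bar> * real (Suc n) powr e)"
    proof (rule mult_mono)
      show "c * s (Suc n) \<le> c * (D * real (Suc n) * s n)" by (intro mult_left_mono assms c)
      then show "0 \<le> c * (D * real (Suc n) * s n)"
        using mult_nonneg_nonneg[OF c(1) less_imp_le[OF fact_growth_pos[OF assms(2), of "Suc n"]]] by linarith
      show "real (Suc (Suc n)) powr e \<le> 2 powr \<bar>e\<bar> * real (Suc n) powr e" by (rule powr_ratio_le) auto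
    qed auto
    also have "\<dots> = c * D * 2 powr \<bar>e\<bar> * s n * real (Suc n) powr (e + 1)" by (simp add: powr_add mult_ac)
    finally show ?thesis .
  qed
  then show ?thesis unfolding fps_bigo_def by blast
qed

lemma fish_a_Suc_le: "fish_a (Suc n) \<le> (2 * fish_mu) * real (Suc n) * fish_a n"
proof -
  have "fish_mu * (real n + 3 / 2) * fish_a n \<le> fish_mu * (2 * real (Suc n)) * fish_a n"
    using fish_mu_pos fish_a_pos[of n] by (intro mult_right_mono mult_left_mono) auto
  then show ?thesis by (simp add: fish_a_Suc mult_ac)
qed

lemma fps_split_3: "(f :: real fps) = fps_const (f $ 0) + fps_const (f $ 1) * fps_X + fps_const (f $ 2) * fps_X\<^sup>2
    + fps_X ^ 3 * fps_shift 3 f"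
proof (rule fps_ext)
  fix n :: nat
  consider "n = 0" | "n = 1" | "n = 2" | k where "n = k + 3"
  proof -
    have "n = 0 \<or> n = 1 \<or> n = 2 \<or> (\<exists>k::nat. n = k + 3)" by presburger
    then show ?thesis using that by blast
  qed
  then show "f $ n = (fps_const (f $ 0) + fps_const (f $ 1) * fps_X + fps_const (f $ 2) * fps_X\<^sup>2
    + fps_X ^ 3 * fps_shift 3 f) $ n"
    by cases (auto simp: fps_X_power_mult_nth fps_X_power_nth)
qed

lemma fps_conv_radius_mult_pos:
  "fps_conv_radius f > 0 \<Longrightarrow> fps_conv_radius g > 0 \<Longrightarrow> fps_conv_radius (f * g :: real fps) > 0"
  using fps_conv_radius_mult[of f g] by (meson less_le_trans min_less_iff_conj)

lemma fps_conv_radius_add_pos: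
  "fps_conv_radius f > 0 \<Longrightarrow> fps_conv_radius g > 0 \<Longrightarrow> fps_conv_radius (f + g :: real fps) > 0"
  using fps_conv_radius_add[of f g] by (meson less_le_trans min_less_iff_conj)

lemma fps_conv_radius_diff_pos:
  "fps_conv_radius f > 0 \<Longrightarrow> fps_conv_radius g > 0 \<Longrightarrow> fps_conv_radius (f - g :: real fps) > 0"
  using fps_conv_radius_diff[of f g] by (meson less_le_trans min_less_iff_conj)

lemma fps_conv_radius_power_pos:
  "fps_conv_radius f > 0 \<Longrightarrow> fps_conv_radius (f ^ n :: real fps) > 0"
  using fps_conv_radius_power[of f n] by auto

lemmas fps_conv_radius_pos_intros =
  fps_conv_radius_mult_pos fps_conv_radius_add_pos fps_conv_radius_diff_pos fps_conv_radius_power_pos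

definition fish_g0 :: "real fps" where "fish_g0 = fps_vsum (qpoch (fps_exp (-1)))"

definition theta :: "real fps \<Rightarrow> real fps" where "theta f = fps_X * fps_deriv f"

lemma theta_add: "theta (f + g) = theta f + theta g" by (simp add: theta_def algebra_simps)
lemma theta_diff: "theta (f - g) = theta f - theta g" by (simp add: theta_def algebra_simps)
lemma theta_mult: "theta (f * g) = theta f * g + f * theta g" by (simp add: theta_def algebra_simps)
lemma theta_const: "theta (fps_const c) = 0" by (simp add: theta_def)
lemma theta_X: "theta fps_X = fps_X" by (simp add: theta_def)
lemma theta_nth: "theta f $ n = real n * f $ n" by (cases n) (simp_all add: theta_def)

lemma fps_bigo_theta: "fps_bigo s e f \<Longrightarrow> fact_growth B s \<Longrightarrow> fps_bigo s (e + 1) (theta f)"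
  unfolding theta_def by (rule fps_bigo_xderiv)

text \<open>
  The weights satisfy \<open>a_{k+1} = \<mu> (k + 3/2) a_k\<close>, i.e. their generating function solves a
  first-order differential equation; up to a factor \<open>exp (t / 24)\<close> and a negligible error, so does
  \<open>fish_g0\<close>.
\<close>

lemma fish_g0_asymptotics:
  obtains C N where "C \<noteq> 0" "(\<lambda>n. fish_g0 $ n / fish_a n) \<longlonglongrightarrow> C"
    "fps_bigo fish_a (-3) N"
    "fish_g0 = fps_const fish_mu * fps_X * (theta fish_g0 + fps_const (3/2) * fish_g0)
        - fps_const (fish_mu / 24) * fps_X\<^sup>2 * fish_g0 + N"
proof -
  note a = fish_a_growth
  obtain C K where C: "C \<noteq> 0" "zagier_coeff \<longlonglongrightarrow> C"
    "\<And>k. \<bar>zagier_coeff (Suc k) - zagier_coeff k\<bar> \<le> K * (1 / 2) ^ Suc k"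
    using zagier_coeff_asymptotics by blast
  define V where "V = Abs_fps (\<lambda>k. (-1/6) ^ k * (fact (2 * k + 1) / fact k) * zagier_fps $ (2 * k + 1))"
  have V_nth: "V $ k = fish_a k * zagier_coeff k" for k
  proof -
    have "(-1/6::real) ^ k = (3 / (2 * pi\<^sup>2)) ^ k * (- (pi\<^sup>2 / 9)) ^ k"
      by (simp flip: power_mult_distrib)
    then show ?thesis by (simp add: V_def fish_a_def zagier_coeff_def)
  qed
  define E where "E = fps_exp (1/24 :: real)"
  have g0: "fish_g0 = E * V" unfolding fish_g0_def E_def V_def by (rule Zagier_identity)
  \<comment> \<open>The defect of V in the equation that the weights satisfy exactly; its
    coefficients are weights times differences of \<open>zagier_coeff\<close>.\<close>
  define \<eta> where "\<eta> = V - fps_const fish_mu * fps_X * (theta V + fps_const (3/2) * V)"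
  have eta_Suc: "\<eta> $ Suc k = fish_a (Suc k) * (zagier_coeff (Suc k) - zagier_coeff k)" for k
  proof -
    have "\<eta> $ Suc k = V $ Suc k - fish_mu * (real k * V $ k + 3/2 * V $ k)"
      by (simp add: \<eta>_def mult.assoc theta_nth)
    then show ?thesis unfolding V_nth fish_a_Suc by algebra
  qed
  have "fps_bigo fish_a (-3) \<eta>"
  proof -
    \<comment> \<open>The geometric error beats any power; -3 is chosen because two divisions by X
      must still leave -1.\<close>
    have "(\<lambda>n. (1 / 2) ^ n * real (Suc n) powr 3) \<longlonglongrightarrow> 0" by real_asymp
    then have "Bseq (\<lambda>n. (1 / 2 :: real) ^ n * real (Suc n) powr 3)" by (intro convergent_imp_Bseq convergentI)
    then obtain D where D: "D > 0" "\<And>n. norm ((1 / 2 :: real) ^ n * real (Suc n) powr 3) \<le> D" unfolding Bseq_def by blast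
    have D': "(1 / 2) ^ n \<le> D * real (Suc n) powr (-3)" for n
    proof -
      have "real (Suc n) powr 3 * real (Suc n) powr (-3) = 1"
        by (simp only: powr_add[symmetric]) simp
      then have "(1 / 2) ^ n = ((1 / 2) ^ n * real (Suc n) powr 3) * real (Suc n) powr (-3)"
        by (simp only: mult.assoc mult_1_right)
      also have "\<dots> \<le> D * real (Suc n) powr (-3)" using D(2)[of n] by (intro mult_right_mono) auto
      finally show ?thesis .
    qed
    have K: "K \<ge> 0" using order_trans[OF abs_ge_zero C(3)[of 0]] by simp
    have "\<bar>\<eta> $ n\<bar> \<le> (\<bar>zagier_coeff 0\<bar> + K * D) * fish_a n * real (Suc n) powr (-3)" for n
    proof (cases n)
      case 0
      have "\<bar>\<eta> $ 0\<bar> = fish_a 0 * \<bar>zagier_coeff 0\<bar>"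
        using fish_a_pos[of 0] by (simp add: \<eta>_def V_nth theta_nth abs_mult)
      also have "\<dots> \<le> fish_a 0 * (\<bar>zagier_coeff 0\<bar> + K * D)"
        using fish_a_pos[of 0] K D(1) by (intro mult_left_mono) auto
      finally show ?thesis using 0 by (simp add: mult_ac)
    next
      case (Suc k)
      have "\<bar>\<eta> $ n\<bar> = fish_a n * \<bar>zagier_coeff (Suc k) - zagier_coeff k\<bar>"
        using fish_a_pos[of n] by (simp add: Suc eta_Suc abs_mult)
      also have "\<dots> \<le> fish_a n * (K * (D * real (Suc n) powr (-3)))"
        using fish_a_pos[of n] order_trans[OF C(3)[of k] mult_left_mono[OF D'[of n] K, unfolded Suc]]
        by (intro mult_left_mono) (auto simp: Suc)
      also have "\<dots> \<le> fish_a n * ((\<bar>zagier_coeff 0\<bar> + K * D) * real (Suc n) powr (-3))"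
        using fish_a_pos[of n] by (intro mult_left_mono) (auto simp: distrib_right simp del: of_nat_Suc)
      finally show ?thesis by (simp only: mult_ac)
    qed
    then show ?thesis unfolding fps_bigo_def by blast
  qed
  then have N: "fps_bigo fish_a (-3) (E * \<eta>)"
    unfolding E_def by (intro fps_bigo_mult[OF _ _ a]) auto
  \<comment> \<open>The Euler operator applied to exp(t/24) produces the correction (mu/24) t^2 in
    the equation.\<close>
  have "theta E = fps_const (1/24) * fps_X * E" by (simp add: theta_def E_def mult_ac)
  then have "theta fish_g0 = fps_const (1/24) * fps_X * fish_g0 + E * theta V"
    unfolding g0 theta_mult by (simp add: mult_ac)
  moreover have "fps_const (fish_mu / 24) = fps_const fish_mu * fps_const (1/24)" by simp
  ultimately have eq: "fish_g0 = fps_const fish_mu * fps_X * (theta fish_g0 + fps_const (3/2) * fish_g0)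
        - fps_const (fish_mu / 24) * fps_X\<^sup>2 * fish_g0 + E * \<eta>"
    unfolding \<eta>_def g0 by algebra
  have Va: "(\<lambda>n. V $ n / fish_a n) \<longlonglongrightarrow> C"
    using C(2) fish_a_pos by (simp add: V_nth less_imp_neq[THEN not_sym])
  have "fps_bigo fish_a 0 V" by (rule fps_bigo_of_limit[OF Va a])
  then have "fps_bigo fish_a (-1) (fps_X * V)" using fps_bigo_X[OF _ a] by fastforce
  then have "fps_bigo fish_a (-1) (fps_shift 1 E * (fps_X * V))"
    by (rule fps_bigo_mult[OF _ _ a, rotated]) (simp add: E_def)
  then have "(\<lambda>n. (fps_shift 1 E * (fps_X * V)) $ n / fish_a n) \<longlonglongrightarrow> 0"
    by (rule fps_bigo_imp_tendsto_0[OF _ _ a]) simp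
  then have "(\<lambda>n. V $ n / fish_a n + (fps_shift 1 E * (fps_X * V)) $ n / fish_a n) \<longlonglongrightarrow> C + 0"
    by (rule tendsto_add[OF Va])
  \<comment> \<open>E has constant coefficient 1, so \<open>fish_g0\<close> and V differ by terms
    carrying a factor X and share their limit.\<close>
  moreover have "E = 1 + fps_X * fps_shift 1 E"
    by (rule fps_ext) (simp add: E_def)
  then have g0V: "fish_g0 = V + fps_shift 1 E * (fps_X * V)" unfolding g0 by algebra
  have "fish_g0 $ n / fish_a n = V $ n / fish_a n + (fps_shift 1 E * (fps_X * V)) $ n / fish_a n" for n
    unfolding g0V fps_add_nth add_divide_distrib ..
  ultimately have "(\<lambda>n. fish_g0 $ n / fish_a n) \<longlonglongrightarrow> C" by simp
  with C(1) N eq show ?thesis using that by blast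
qed

lemma fps_mult_nth_upto2:
  "(f * g) $ 0 = f $ 0 * g $ 0"
  "(f * g) $ 1 = f $ 0 * g $ 1 + f $ 1 * g $ 0"
  "(f * g) $ 2 = f $ 0 * g $ 2 + f $ 1 * g $ 1 + f $ 2 * g $ 0"
  by (simp_all add: fps_mult_nth numeral_2_eq_2)

text \<open>The universal case Lambda = exp, in which t = log Lambda(z) is z itself.\<close>

definition exp_weights :: "nat \<Rightarrow> real" where "exp_weights j = 1 / fact j"

lemma Lambda_exp_weights: "Lambda_fps exp_weights = fps_exp 1"
  by (auto simp: fps_eq_iff Lambda_fps_def exp_weights_def)

definition fish_g1 :: "real fps" where "fish_g1 = fps_d1 (Fishburn_gf exp_weights)"
text \<open>k (k - 1) + k = k^2, so this series carries the second raw moment rather than the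
  factorial one.\<close>

definition fish_m2 :: "real fps" where "fish_m2 = fps_d2 (Fishburn_gf exp_weights) + fish_g1"

lemma fish_exp_identities:
  defines "Q \<equiv> fps_exp (1::real)"
  shows "(Q - 1) * fish_g1 = fish_g0 - Q"
    and "(Q - 1)\<^sup>2 * (Q + 1) * fish_m2 = (2 - (Q - 1)\<^sup>2) * fish_g0 - Q ^ 3 + 2 * Q\<^sup>2 - 3 * Q"
proof -
  define q where "q = inverse Q"
  have qQ: "q * Q = 1" unfolding q_def by (rule inverse_mult_eq_1) (simp add: Q_def)
  have "q = fps_exp (-1)" by (simp add: q_def Q_def fps_exp_neg)
  then have g0: "fish_g0 = fps_vsum (qpoch q)" by (simp add: fish_g0_def)
  have 1: "(1 - q) * fish_g1 = q * fish_g0 - 1"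
    and 2: "(1 - q) * (1 - q\<^sup>2) * (fish_m2 - fish_g1) = 2 * ((q ^ 3 + q\<^sup>2 - q) * fish_g0 + q - 2 * q\<^sup>2)"
    using Fishburn_moment_identities(2,3)[of exp_weights]
    by (simp_all add: Lambda_exp_weights fish_g1_def fish_m2_def g0 flip: Q_def q_def)
  show e1: "(Q - 1) * fish_g1 = fish_g0 - Q" using 1 qQ by algebra
  have "(Q - 1) * (Q\<^sup>2 - 1) * (fish_m2 - fish_g1) = 2 * ((1 + Q - Q\<^sup>2) * fish_g0 + Q\<^sup>2 - 2 * Q)"
    using 2 qQ by algebra
  with e1 show "(Q - 1)\<^sup>2 * (Q + 1) * fish_m2 = (2 - (Q - 1)\<^sup>2) * fish_g0 - Q ^ 3 + 2 * Q\<^sup>2 - 3 * Q"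
    by algebra
qed

text \<open>Here b = X / (exp X - 1) generates the Bernoulli numbers over factorials, whence 1,
  -1/2, 1/12. The terms without \<open>fish_g0\<close> are convergent and go into K1 and K2.\<close>

lemma fish_expansions:
  obtains B1 K1 B2 K2 where
    "fps_conv_radius B1 > 0" "fps_conv_radius K1 > 0" "fps_conv_radius B2 > 0" "fps_conv_radius K2 > 0"
    "fps_X * fish_g1 = (1 - fps_const (1/2) * fps_X + fps_const (1/12) * fps_X\<^sup>2 + fps_X ^ 3 * B1) * fish_g0 + K1"
    "fps_X\<^sup>2 * fish_m2 = (1 - fps_const (3/2) * fps_X + fps_const (5/12) * fps_X\<^sup>2 + fps_X ^ 3 * B2) * fish_g0 + K2"
proof -
  define Q where "Q = fps_exp (1::real)"
  define Y where "Y = fps_shift 1 Q"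
  define b where "b = inverse Y"
  define d where "d = inverse (Q + 1)"
  have Q: "Q = 1 + fps_X * Y" by (rule fps_ext) (simp add: Q_def Y_def)
  have Yn: "Y $ 0 = 1" "Y $ 1 = 1/2" "Y $ 2 = 1/6" by (simp_all add: Y_def Q_def fact_numeral)
  have Yb: "Y * b = 1" unfolding b_def by (rule inverse_mult_eq_1') (simp add: Yn)
  have Qd: "(Q + 1) * d = 1" unfolding d_def by (rule inverse_mult_eq_1') (simp add: Q_def)
  have rQ: "fps_conv_radius Q > 0" and rY: "fps_conv_radius Y > 0" by (simp_all add: Q_def Y_def)
  have rb: "fps_conv_radius b > 0" unfolding b_def
    by (rule fps_conv_radius_inverse_pos) (use Yn rY in auto)
  have rd: "fps_conv_radius d > 0" unfolding d_def
    by (rule fps_conv_radius_inverse_pos) (use rQ in \<open>auto simp: Q_def intro!: fps_conv_radius_pos_intros\<close>)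
  define \<beta> where "\<beta> = (2 - (fps_X * Y)\<^sup>2) * b\<^sup>2 * d"
  have bn: "b $ 0 = 1" "b $ 1 = -1/2" "b $ 2 = 1/12"
  proof -
    have "(Y * b) $ n = 1 $ n" for n by (simp add: Yb)
    from this[of 0] this[of 1] this[of 2] show "b $ 0 = 1" "b $ 1 = -1/2" "b $ 2 = 1/12"
      unfolding fps_mult_nth_upto2 Yn by (auto simp: field_simps)
  qed
  have \<beta>n: "\<beta> $ 0 = 1" "\<beta> $ 1 = -3/2" "\<beta> $ 2 = 5/12"
  proof -
    \<comment> \<open>Denominators cleared, with Q + 1 = 2 + X Y; comparing coefficients 0, 1, 2
      gives 1, -3/2, 5/12.\<close>
    have "\<beta> * (Y * Y * (2 + fps_X * Y)) = 2 - fps_X * (fps_X * (Y * Y))"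
      using Yb Qd unfolding \<beta>_def Q by algebra
    then have e: "(\<beta> * (Y * Y * (2 + fps_X * Y))) $ n = (2 - fps_X * (fps_X * (Y * Y))) $ n" for n by simp
    have XY: "(fps_X * Y) $ 0 = 0" "(fps_X * Y) $ 1 = 1" "(fps_X * Y) $ 2 = 1/2"
      using Yn by (simp_all add: numeral_2_eq_2)
    have z: "(Y * Y * (2 + fps_X * Y)) $ 0 = 2" "(Y * Y * (2 + fps_X * Y)) $ 1 = 3" "(Y * Y * (2 + fps_X * Y)) $ 2 = 8/3"
      by (simp_all only: fps_mult_nth_upto2(1,2,3)[of "Y * Y"] fps_mult_nth_upto2(1,2,3)[of Y Y] Yn fps_add_nth XY)
         (simp_all add: numeral_fps_const)
    have r: "(2 - fps_X * (fps_X * (Y * Y))) $ 0 = 2" "(2 - fps_X * (fps_X * (Y * Y))) $ 1 = 0" "(2 - fps_X * (fps_X * (Y * Y))) $ 2 = -1"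
      using Yn(1) by (simp_all add: numeral_fps_const numeral_2_eq_2)
    from e[of 0] e[of 1] e[of 2] show "\<beta> $ 0 = 1" "\<beta> $ 1 = -3/2" "\<beta> $ 2 = 5/12"
      unfolding fps_mult_nth_upto2(1,2,3)[of \<beta>] z r by (auto simp: field_simps)
  qed
  define B1 where "B1 = fps_shift 3 b"
  define B2 where "B2 = fps_shift 3 \<beta>"
  define K1 where "K1 = - 1 * (b * Q)"
  define K2 where "K2 = (2 * Q\<^sup>2 - Q ^ 3 - 3 * Q) * b\<^sup>2 * d"
  have r1: "fps_conv_radius B1 > 0" using rb by (simp add: B1_def)
  have "fps_conv_radius \<beta> > 0" unfolding \<beta>_def
    by (intro fps_conv_radius_pos_intros rb rd rY) auto
  then have r2: "fps_conv_radius B2 > 0" by (simp add: B2_def)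
  have r3: "fps_conv_radius K1 > 0" using fps_conv_radius_mult_pos[OF rb rQ] by (simp add: K1_def)
  have r4: "fps_conv_radius K2 > 0" unfolding K2_def
    by (intro fps_conv_radius_pos_intros rb rd rQ) auto
  note id = fish_exp_identities[folded Q_def]
  have "b = 1 - fps_const (1/2) * fps_X + fps_const (1/12) * fps_X\<^sup>2 + fps_X ^ 3 * B1"
  proof -
    have n: "fps_const (-1/2::real) = - fps_const (1/2)" by simp
    show ?thesis using fps_split_3[of b] unfolding bn B1_def n
      by (simp only: mult_minus_left fps_const_1_eq_1 add_uminus_conv_diff)
  qed
  moreover have "fps_X * fish_g1 = b * fish_g0 + K1"
    using id(1) Yb unfolding K1_def Q by algebra
  ultimately have e1: "fps_X * fish_g1 = (1 - fps_const (1/2) * fps_X + fps_const (1/12) * fps_X\<^sup>2 + fps_X ^ 3 * B1) * fish_g0 + K1"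
    by simp
  have "\<beta> = 1 - fps_const (3/2) * fps_X + fps_const (5/12) * fps_X\<^sup>2 + fps_X ^ 3 * B2"
  proof -
    have n: "fps_const (-3/2::real) = - fps_const (3/2)" by simp
    show ?thesis using fps_split_3[of \<beta>] unfolding \<beta>n B2_def n
      by (simp only: mult_minus_left fps_const_1_eq_1 add_uminus_conv_diff)
  qed
  moreover have "fps_X\<^sup>2 * fish_m2 = \<beta> * fish_g0 + K2"
  proof -
    have X: "fps_X * Y = Q - 1" by (simp add: Q)
    have "fps_X\<^sup>2 * fish_m2 = (fps_X * Y)\<^sup>2 * (Q + 1) * fish_m2 * b\<^sup>2 * d"
      using Yb Qd by algebra
    also have "\<dots> = \<beta> * fish_g0 + K2"
      unfolding X id(2) \<beta>_def K2_def by algebra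
    finally show ?thesis .
  qed
  ultimately have e2: "fps_X\<^sup>2 * fish_m2 = (1 - fps_const (3/2) * fps_X + fps_const (5/12) * fps_X\<^sup>2 + fps_X ^ 3 * B2) * fish_g0 + K2"
    by simp
  show ?thesis using that[OF r1 r3 r2 r4 e1 e2] .
qed

text \<open>The equation for g0 reads g0 = X h plus smaller terms, h = mu (theta g0 + 3/2 g0).
  Inserted into \<open>fish_expansions\<close>, it exposes the factor X of the series for g1 and,
  applied again to h, the factor X^2 for m2. Cancelling them weakens the error exponent -3 to -2 and
  -1.\<close>

lemma fish_series_asymptotics:
  obtains C Z0 Z1 Z2 where "C \<noteq> 0" "(\<lambda>n. fish_g0 $ n / fish_a n) \<longlonglongrightarrow> C"
    "fps_bigo fish_a (-2) Z0" "fps_bigo fish_a (-2) Z1" "fps_bigo fish_a (-1) Z2"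
    "fish_g0 = fps_const fish_mu * fps_X * (theta fish_g0 + fps_const (3/2) * fish_g0) + Z0"
    "fish_g1 = fps_const fish_mu * (theta fish_g0 + fps_const (3/2) * fish_g0) - fps_const (1/2) * fish_g0
        + fps_const (1/12 - fish_mu / 24) * fps_X * fish_g0 + Z1"
    "fish_m2 = fps_const fish_mu * (theta (fps_const fish_mu * (theta fish_g0 + fps_const (3/2) * fish_g0))
          + fps_const (5/2) * (fps_const fish_mu * (theta fish_g0 + fps_const (3/2) * fish_g0)))
        - fps_const (3/2) * (fps_const fish_mu * (theta fish_g0 + fps_const (3/2) * fish_g0))
        + fps_const (5/12 - fish_mu / 12) * fish_g0 + Z2"
proof -
  note a = fish_a_growth
  obtain C N where C: "C \<noteq> 0" "(\<lambda>n. fish_g0 $ n / fish_a n) \<longlonglongrightarrow> C" and N: "fps_bigo fish_a (-3) N"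
    and g0: "fish_g0 = fps_const fish_mu * fps_X * (theta fish_g0 + fps_const (3/2) * fish_g0)
        - fps_const (fish_mu / 24) * fps_X\<^sup>2 * fish_g0 + N"
    by (rule fish_g0_asymptotics)
  obtain B1 K1 B2 K2 where r: "fps_conv_radius B1 > 0" "fps_conv_radius K1 > 0" "fps_conv_radius B2 > 0" "fps_conv_radius K2 > 0"
    and g1: "fps_X * fish_g1 = (1 - fps_const (1/2) * fps_X + fps_const (1/12) * fps_X\<^sup>2 + fps_X ^ 3 * B1) * fish_g0 + K1"
    and m2: "fps_X\<^sup>2 * fish_m2 = (1 - fps_const (3/2) * fps_X + fps_const (5/12) * fps_X\<^sup>2 + fps_X ^ 3 * B2) * fish_g0 + K2"
    by (rule fish_expansions)
  define m where "m = fps_const fish_mu"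
  define c where "c = fps_const (1 / 24 :: real)"
  have c24: "24 * c = 1" by (simp add: c_def numeral_fps_const)
  \<comment> \<open>All constants become multiples of c = 1/24, so that \<open>algebra\<close>
    treats them as polynomials in m and c.\<close>
  have k: "fps_const (1/2) = 12 * c" "fps_const (1/12) = 2 * c" "fps_const (3/2) = 36 * c" "fps_const (5/12) = 10 * c"
     "fps_const (5/2) = 60 * c" "fps_const (fish_mu / 24) = m * c" "fps_const (1/12 - fish_mu / 24) = 2 * c - m * c"
     "fps_const (5/12 - fish_mu / 12) = 10 * c - 2 * m * c"
    by (simp_all add: c_def m_def numeral_fps_const fps_const_sub[symmetric] mult.commute del: fps_const_sub)
  define g where "g = fish_g0"
  define h where "h = m * (theta g + 36 * c * g)"
  have g_eq: "g = fps_X * h - m * c * fps_X\<^sup>2 * g + N"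
    using g0 unfolding h_def k m_def[symmetric] g_def[symmetric] by algebra
  have bg: "fps_bigo fish_a 0 g" unfolding g_def by (rule fps_bigo_of_limit[OF C(2) a])
  have gX: "fps_bigo fish_a (- real n) (fps_X ^ n * g)" for n using fps_bigo_X_power[OF bg a, of n] by simp
  have rc: "fps_conv_radius c > 0" "fps_conv_radius m > 0" by (simp_all add: c_def m_def)
  define Z0 where "Z0 = N - m * c * (fps_X ^ 2 * g)"
  have Z0: "fps_bigo fish_a (-2) Z0" unfolding Z0_def
    by (intro fps_bigo_diff fps_bigo_mono[OF N _ a] fps_bigo_mult[OF fps_conv_radius_mult_pos[OF rc(2,1)] _ a])
       (use gX[of 2] in auto)
  define Z1 where "Z1 = fish_g1 - (h - 12 * c * g + (2 * c - m * c) * fps_X * g)"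
  have "fps_X * (Z1 - B1 * (fps_X ^ 2 * g)) = N + K1"
    using g1 g_eq unfolding Z1_def k g_def[symmetric] by algebra
  moreover have "fps_bigo fish_a (-3) (N + K1)" by (intro fps_bigo_add N fps_bigo_convergent[OF r(2) a])
  ultimately have "fps_bigo fish_a (-3 + 1) (Z1 - B1 * (fps_X ^ 2 * g))"
    by (intro fps_bigo_divide_X[OF _ a fish_a_Suc_le]) simp
  moreover have "fps_bigo fish_a (-2) (B1 * (fps_X ^ 2 * g))" using gX[of 2] fps_bigo_mult[OF r(1) _ a] by simp
  ultimately have "fps_bigo fish_a (-2) ((Z1 - B1 * (fps_X ^ 2 * g)) + B1 * (fps_X ^ 2 * g))"
    by (intro fps_bigo_add) auto
  then have Z1: "fps_bigo fish_a (-2) Z1" by simp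
  define Z2 where "Z2 = fish_m2 - (m * (theta h + 60 * c * h) - 36 * c * h + (10 * c - 2 * m * c) * g)"
  \<comment> \<open>The remainder of m2: \<open>D\<close> is bounded directly, while
    \<open>R\<close>, made of K2, N and theta N, has exponent -3 and is divided by X^2.\<close>
  define D where "D = (B2 - 2 * m\<^sup>2 * c + 36 * c\<^sup>2 * m) * (fps_X ^ 1 * g) - m\<^sup>2 * c\<^sup>2 * (fps_X ^ 2 * g) + m * c * N"
  define R where "R = K2 + (1 - 36 * c * fps_X) * N + m * (fps_X * (theta N) + 36 * c * (fps_X * N))"
  have tm: "theta (m * f) = m * theta f" "theta (c * f) = c * theta f" for f
    by (simp_all add: theta_mult m_def c_def theta_const)
  have th: "theta g = fps_X * h + fps_X * theta h - m * c * (2 * fps_X\<^sup>2 * g + fps_X\<^sup>2 * theta g) + theta N"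
  proof -
    have "theta g = theta (fps_X * h - m * (c * (fps_X * (fps_X * g))) + N)"
      using g_eq by (metis (no_types, lifting) mult.assoc power2_eq_square)
    also have "\<dots> = fps_X * h + fps_X * theta h - m * c * (2 * fps_X\<^sup>2 * g + fps_X\<^sup>2 * theta g) + theta N"
      unfolding theta_add theta_diff tm theta_mult[of fps_X] theta_X by algebra
    finally show ?thesis .
  qed
  \<comment> \<open>The equation is inserted into h itself. The rule theta (X h) = X (theta h + h)
    raises the constant 3/2 to 5/2.\<close>
  have hX: "fps_X * h = fps_X\<^sup>2 * m * (theta h + 60 * c * h) - m\<^sup>2 * c * fps_X ^ 3 * (theta g + 84 * c * g)
      + fps_X * m * (theta N + 36 * c * N)"
  proof -
    have "fps_X * h = fps_X * m * (theta g + 36 * c * g)" by (simp add: h_def mult.assoc)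
    also have "\<dots> = fps_X * m * (fps_X * h + fps_X * theta h - m * c * (2 * fps_X\<^sup>2 * g + fps_X\<^sup>2 * theta g) + theta N
        + 36 * c * (fps_X * h - m * c * fps_X\<^sup>2 * g + N))"
      using th g_eq by metis
    also have "\<dots> = fps_X\<^sup>2 * m * (theta h + 60 * c * h) - m\<^sup>2 * c * fps_X ^ 3 * (theta g + 84 * c * g)
      + fps_X * m * (theta N + 36 * c * N)"
      using c24 by algebra
    finally show ?thesis .
  qed
  have XX: "fps_X\<^sup>2 * Z2 = fps_X\<^sup>2 * D + R"
  proof -
    have mt: "m * theta g = h - 36 * c * m * g" by (simp add: h_def algebra_simps)
    have "fps_X\<^sup>2 * Z2 = g - 36 * c * fps_X * g + fps_X ^ 3 * B2 * g + K2
        - fps_X\<^sup>2 * m * (theta h + 60 * c * h) + 36 * c * fps_X\<^sup>2 * h + 2 * m * c * fps_X\<^sup>2 * g"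
      using m2 unfolding Z2_def k g_def[symmetric] by algebra
    then show ?thesis
      unfolding D_def R_def using hX g_eq mt c24 by algebra
  qed
  then have "fps_X * (fps_X * (Z2 - D)) = R" by algebra
  moreover have "fps_bigo fish_a (-3) R"
  proof -
    have 1: "fps_bigo fish_a (-3) (fps_X * N)" using fps_bigo_mono[OF fps_bigo_X[OF N a] _ a] by simp
    have 2: "fps_bigo fish_a (-3) (fps_X * theta N)" using fps_bigo_X[OF fps_bigo_theta[OF N a] a] by simp
    show ?thesis unfolding R_def
      by (intro fps_bigo_add fps_bigo_convergent[OF r(4) a] fps_bigo_mult[OF _ N a] fps_bigo_mult[OF rc(2) _ a] 2
          fps_bigo_mult[OF _ 1 a] fps_conv_radius_pos_intros rc) auto
  qed
  ultimately have "fps_bigo fish_a (-3 + 1) (fps_X * (Z2 - D))"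
    by (intro fps_bigo_divide_X[OF _ a fish_a_Suc_le]) simp
  from fps_bigo_divide_X[OF this a fish_a_Suc_le] have "fps_bigo fish_a (-1) (Z2 - D)" by simp
  moreover have "fps_bigo fish_a (-1) D"
  proof -
    have 1: "fps_bigo fish_a (-1) (fps_X ^ 1 * g)" using gX[of 1] by simp
    have 2: "fps_bigo fish_a (-1) (fps_X ^ 2 * g)" using fps_bigo_mono[OF gX[of 2] _ a] by simp
    have 3: "fps_bigo fish_a (-1) N" using fps_bigo_mono[OF N _ a] by simp
    show ?thesis unfolding D_def
      by (intro fps_bigo_add fps_bigo_diff fps_bigo_mult[OF _ 1 a] fps_bigo_mult[OF _ 2 a] fps_bigo_mult[OF _ 3 a]
          fps_conv_radius_pos_intros rc r) auto
  qed
  ultimately have "fps_bigo fish_a (-1) ((Z2 - D) + D)" by (rule fps_bigo_add)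
  then have Z2: "fps_bigo fish_a (-1) Z2" by simp
  show ?thesis
  proof (rule that[OF C Z0 Z1 Z2])
    show "fish_g0 = fps_const fish_mu * fps_X * (theta fish_g0 + fps_const (3/2) * fish_g0) + Z0"
      using g_eq unfolding Z0_def h_def k m_def[symmetric] g_def[symmetric] by algebra
  qed (simp_all only: k m_def[symmetric] g_def[symmetric] h_def[symmetric] Z1_def Z2_def, simp_all)
qed

section \<open>General \<open>\<Lambda>\<close>\<close>

definition fps_log :: "real fps \<Rightarrow> real fps" where "fps_log f = fps_ln 1 oo (f - 1)"

lemma fps_log_0 [simp]: "fps_log f $ 0 = 0" by (simp add: fps_log_def)

lemma fps_exp_compose_log:
  assumes "f $ 0 = 1"
  shows "fps_exp 1 oo fps_log f = f"
proof -
  have f0: "(f - 1) $ 0 = 0" using assms by simp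
  have "(fps_exp 1 - 1) oo fps_ln (1::real) = fps_X"
    unfolding fps_ln_fps_exp_inv[of "1::real", OF one_neq_zero] by (rule fps_inv_right) simp_all
  then have "((fps_exp 1 - 1) oo fps_ln 1) oo (f - 1) = fps_X oo (f - 1)" by simp
  then have "(fps_exp 1 - 1) oo fps_log f = f - 1"
    unfolding fps_log_def using f0 by (simp add: fps_compose_assoc)
  then show ?thesis by (simp add: fps_compose_sub_distrib)
qed

lemma fps_deriv_log:
  assumes "f $ 0 = 1"
  shows "fps_deriv (fps_log f) * f = fps_deriv f"
proof -
  have "fps_deriv (fps_exp 1 oo fps_log f) = (fps_exp 1 oo fps_log f) * fps_deriv (fps_log f)"
    by (simp add: fps_compose_deriv)
  then show ?thesis using fps_exp_compose_log[OF assms] by (simp add: mult.commute)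
qed

lemma fps_conv_radius_posI:
  fixes f :: "real fps"
  assumes "K > 0" "\<And>n. \<bar>f $ n\<bar> \<le> K ^ Suc n"
  shows "fps_conv_radius f > 0"
proof -
  define z where "z = 1 / (2 * K)"
  have z: "z > 0" using assms by (simp add: z_def)
  have "summable (\<lambda>n. K * (1 / 2 :: real) ^ n)" by (intro summable_mult summable_geometric) simp
  then have "summable (\<lambda>n. f $ n * z ^ n)"
  proof (rule summable_comparison_test'[where N = 0])
    fix n :: nat
    have "norm (f $ n * z ^ n) = \<bar>f $ n\<bar> * z ^ n" using z by (simp add: abs_mult)
    also have "\<dots> \<le> K ^ Suc n * z ^ n" using z by (intro mult_right_mono assms(2)) auto
    also have "\<dots> = K * (K * z) ^ n" by (simp add: power_mult_distrib)
    also have "K * z = 1 / 2" using assms by (simp add: z_def)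
    finally show "norm (f $ n * z ^ n) \<le> K * (1 / 2) ^ n" .
  qed
  then have "fps_conv_radius f \<ge> norm z" unfolding fps_conv_radius_def by (rule conv_radius_geI)
  then show ?thesis by (rule less_le_trans[rotated]) (use z in simp)
qed

lemma fps_conv_radius_pos_of_deriv:
  fixes f :: "real fps"
  assumes "fps_conv_radius (fps_deriv f) > 0"
  shows "fps_conv_radius f > 0"
proof -
  obtain K where K: "K \<ge> 1" "\<And>n. \<bar>fps_deriv f $ n\<bar> \<le> K ^ Suc n"
    using fps_conv_radius_pos_bound[OF assms] by blast
  define D where "D = max K \<bar>f $ 0\<bar>"
  have D: "D \<ge> 1" "D \<ge> K" "D \<ge> \<bar>f $ 0\<bar>" using K by (auto simp: D_def)
  have "\<bar>f $ n\<bar> \<le> D ^ Suc n" for n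
  proof (cases n)
    case (Suc k)
    have "\<bar>f $ Suc k\<bar> \<le> real (Suc k) * \<bar>f $ Suc k\<bar>" by (simp add: mult_le_cancel_right1)
    also have "\<dots> \<le> K ^ Suc k" using K(2)[of k] by (simp add: abs_mult del: power_Suc)
    also have "\<dots> \<le> D ^ Suc k" using D K by (intro power_mono) auto
    also have "\<dots> \<le> D ^ Suc (Suc k)" using D by (intro power_increasing) auto
    finally show ?thesis by (simp add: Suc)
  qed (use D in simp)
  then show ?thesis using D by (intro fps_conv_radius_posI[of D]) auto
qed

text \<open>The derivative of log f is f'/f, and integration does not increase coefficients beyond
  the constant one.\<close>

lemma fps_conv_radius_log:
  assumes "f $ 0 = 1" "fps_conv_radius f > 0"
  shows "fps_conv_radius (fps_log f) > 0"
proof -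
  have "f * inverse f = 1" by (rule inverse_mult_eq_1') (simp add: assms)
  then have "fps_deriv (fps_log f) = fps_deriv (fps_log f) * f * inverse f" by (simp only: mult.assoc mult_1_right)
  then have e: "fps_deriv (fps_log f) = fps_deriv f * inverse f" unfolding fps_deriv_log[OF assms(1)] .
  have "fps_conv_radius (fps_deriv f) > 0" using assms(2) fps_conv_radius_deriv[of f] by (rule less_le_trans)
  moreover have "fps_conv_radius (inverse f) > 0" by (rule fps_conv_radius_inverse_pos) (simp_all add: assms)
  ultimately have "fps_conv_radius (fps_deriv (fps_log f)) > 0" unfolding e by (rule fps_conv_radius_mult_pos)
  then show ?thesis by (rule fps_conv_radius_pos_of_deriv)
qed

lemma qpoch_compose:
  fixes q L :: "real fps"
  assumes "L $ 0 = 0"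
  shows "qpoch q k oo L = qpoch (q oo L) k"
  unfolding qpoch_def
  by (simp add: fps_compose_prod_distrib[OF assms] fps_compose_sub_distrib fps_compose_power[OF assms])

lemma fps_exp_uminus_compose_log:
  assumes "f $ 0 = 1"
  shows "fps_exp (-1) oo fps_log f = inverse f"
proof -
  have "(fps_exp (-1) * fps_exp 1) oo fps_log f = 1" by (simp flip: fps_exp_add_mult)
  then have "(fps_exp (-1) oo fps_log f) * f = 1"
    using fps_exp_compose_log[OF assms] by (simp add: fps_compose_mult_distrib)
  then show ?thesis using fps_inverse_unique[of f "fps_exp (-1) oo fps_log f"] by (simp add: mult.commute)
qed

lemma vanishing_qpoch_exp: "vanishing (qpoch (fps_exp (-1 :: real)))"
  unfolding qpoch_def by (rule vanishing_prod) (simp add: fps_exp_power_mult)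

text \<open>The identities depend on Lambda only through q = exp(-log Lambda). The value at v = 1 is
  composed termwise; the derivatives agree because they satisfy the same linear identities.\<close>

lemma Fishburn_series_compose:
  assumes "lam 1 \<noteq> 0"
  defines "L \<equiv> fps_log (Lambda_fps lam)"
  shows "fps_at1 (Fishburn_gf lam) = fish_g0 oo L"
    and "fps_d1 (Fishburn_gf lam) = fish_g1 oo L"
    and "fps_d2 (Fishburn_gf lam) + fps_d1 (Fishburn_gf lam) = fish_m2 oo L"
proof -
  define q where "q = inverse (Lambda_fps lam)"
  have Lam0: "Lambda_fps lam $ 0 = 1" by (simp add: Lambda_fps_nth)
  have L0: "L $ 0 = 0" by (simp add: L_def)
  have q: "fps_exp (-1) oo L = q" unfolding L_def q_def by (rule fps_exp_uminus_compose_log[OF Lam0])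
  define W where "W = fish_g0 oo L"
  have W: "W = fps_vsum (qpoch q)"
    unfolding W_def fish_g0_def fps_vsum_compose[OF vanishing_qpoch_exp L0] qpoch_compose[OF L0] q ..
  note z = Fishburn_moment_identities[of lam, folded q_def, folded W]
  show at1: "fps_at1 (Fishburn_gf lam) = fish_g0 oo L" using z(1) by (simp add: W_def)
  note t = Fishburn_moment_identities[of exp_weights, unfolded Lambda_exp_weights fps_exp_neg[symmetric], folded fish_g0_def fish_g1_def]
  \<comment> \<open>Since lam 1 is nonzero, q is not constant, so 1 - q can be cancelled in the
    integral domain of power series.\<close>
  have q_nz: "1 - q \<noteq> 0" "1 - q\<^sup>2 \<noteq> 0"
  proof -
    have "q * Lambda_fps lam = 1" unfolding q_def by (rule inverse_mult_eq_1) (simp add: Lam0)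
    then have "(1 - q) * Lambda_fps lam = Lambda_fps lam - 1" by algebra
    moreover have "(Lambda_fps lam - 1) $ 1 \<noteq> 0" using assms(1) by (simp add: Lambda_fps_def)
    ultimately show 1: "1 - q \<noteq> 0" by auto
    have "(1 + q) $ 0 \<noteq> 0" by (simp add: q_def Lam0)
    then have "1 + q \<noteq> 0" by (metis fps_zero_nth)
    moreover have "1 - q\<^sup>2 = (1 - q) * (1 + q)" by algebra
    ultimately show "1 - q\<^sup>2 \<noteq> 0" using 1 by simp
  qed
  note dist = fps_compose_mult_distrib[OF L0] fps_compose_sub_distrib fps_compose_add_distrib fps_compose_power[OF L0, symmetric]
  have "(1 - q) * (fish_g1 oo L) = q * W - 1"
    using arg_cong[OF t(2), of "\<lambda>f. f oo L"] by (simp add: dist q W_def)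
  with z(2) have "(1 - q) * (fish_g1 oo L) = (1 - q) * fps_d1 (Fishburn_gf lam)" by simp
  with q_nz show d1: "fps_d1 (Fishburn_gf lam) = fish_g1 oo L" by simp
  have n2: "2 oo L = (2 :: real fps)" by (simp add: numeral_fps_const)
  have "(1 - q) * (1 - q\<^sup>2) * (fps_d2 (Fishburn_gf exp_weights) oo L) = 2 * ((q ^ 3 + q\<^sup>2 - q) * W + q - 2 * q\<^sup>2)"
    using arg_cong[OF t(3), of "\<lambda>f. f oo L"] by (simp only: dist q W_def n2 fps_compose_1)
  with z(3) have "(1 - q) * (1 - q\<^sup>2) * (fps_d2 (Fishburn_gf exp_weights) oo L) = (1 - q) * (1 - q\<^sup>2) * fps_d2 (Fishburn_gf lam)"
    by simp
  with q_nz have "fps_d2 (Fishburn_gf exp_weights) oo L = fps_d2 (Fishburn_gf lam)" by simp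
  then show "fps_d2 (Fishburn_gf lam) + fps_d1 (Fishburn_gf lam) = fish_m2 oo L"
    by (simp add: fish_m2_def dist d1)
qed

text \<open>Transport along L = log Lambda = lam 1 z u, with u = 1 + \<kappa> z + .... The chain
  rule multiplies the Euler operator by m = L / (z L') = 1 - \<kappa> z + ..., and the scaling by
  lam 1 turns the weight into s.\<close>

lemma Fishburn_z_asymptotics:
  assumes conv: "fps_conv_radius (Lambda_fps lam) > 0" and lam1: "lam 1 > 0"
  defines "\<kappa> \<equiv> lam 2 / lam 1 - lam 1 / 2"
    and "s \<equiv> (\<lambda>n. fish_a n * lam 1 ^ n)"
    and "W \<equiv> fps_at1 (Fishburn_gf lam)"
    and "G1 \<equiv> fps_d1 (Fishburn_gf lam)"
    and "M2 \<equiv> fps_d2 (Fishburn_gf lam) + fps_d1 (Fishburn_gf lam)"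
    and "r \<equiv> fps_const (lam 1)" and "mu \<equiv> fps_const fish_mu"
  obtains C u m Z0 Z1 Z2 where
    "C \<noteq> 0" "(\<lambda>n. W $ n / s n) \<longlonglongrightarrow> C"
    "fps_conv_radius u > 0" "fps_conv_radius m > 0"
    "u $ 0 = 1" "u $ 1 = \<kappa>" "m $ 0 = 1" "m $ 1 = - \<kappa>"
    "fps_bigo s (-2) Z0" "fps_bigo s (-2) Z1" "fps_bigo s (-1) Z2"
    "W = mu * (r * fps_X * u) * (m * theta W + fps_const (3/2) * W) + Z0"
    "G1 = mu * (m * theta W + fps_const (3/2) * W) - fps_const (1/2) * W
        + fps_const (1/12 - fish_mu / 24) * (r * fps_X * u) * W + Z1"
    "M2 = mu * (m * theta (mu * (m * theta W + fps_const (3/2) * W))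
          + fps_const (5/2) * (mu * (m * theta W + fps_const (3/2) * W)))
        - fps_const (3/2) * (mu * (m * theta W + fps_const (3/2) * W))
        + fps_const (5/12 - fish_mu / 12) * W + Z2"
proof -
  define Lam where "Lam = Lambda_fps lam"
  define L where "L = fps_log Lam"
  have Lam0: "Lam $ 0 = 1" by (simp add: Lam_def Lambda_fps_nth)
  have Lam12: "Lam $ 1 = lam 1" "Lam $ 2 = lam 2" by (simp_all add: Lam_def Lambda_fps_def)
  have L0: "L $ 0 = 0" by (simp add: L_def)
  have Lrad: "fps_conv_radius L > 0" unfolding L_def
    by (rule fps_conv_radius_log[OF Lam0]) (use conv in \<open>simp add: Lam_def\<close>)
  have LD: "(fps_deriv L * Lam) $ n = fps_deriv Lam $ n" for n
    using fps_deriv_log[OF Lam0] by (simp add: L_def)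
  have L1: "L $ 1 = lam 1" using LD[of 0] Lam0 Lam12 by simp
  have L2: "L $ 2 = lam 1 * \<kappa>"
  proof -
    have "fps_deriv L $ 0 = L $ 1" "fps_deriv L $ 1 = 2 * L $ 2" "fps_deriv Lam $ 1 = 2 * Lam $ 2"
      by (simp_all add: numeral_2_eq_2)
    then have "lam 1 * lam 1 + 2 * L $ 2 = 2 * lam 2"
      using LD[of 1] unfolding fps_mult_nth_upto2 by (simp only: Lam0 Lam12 L1 mult_1_right)
    then have "L $ 2 = lam 2 - lam 1 * lam 1 / 2" by linarith
    also have "\<dots> = lam 1 * \<kappa>" using lam1 unfolding \<kappa>_def right_diff_distrib by simp
    finally show ?thesis .
  qed
  define u where "u = fps_const (1 / lam 1) * fps_shift 1 L"
  have Lu: "L = fps_const (lam 1) * fps_X * u"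
  proof -
    have "L = fps_X * fps_shift 1 L" by (rule fps_ext) (simp add: L0)
    moreover have "fps_const (lam 1) * fps_const (1 / lam 1) = 1" using lam1 by simp
    ultimately show ?thesis unfolding u_def by algebra
  qed
  define Ld where "Ld = fps_const (1 / lam 1) * fps_deriv L"
  have u01: "u $ 0 = 1" "u $ 1 = \<kappa>" using lam1 L1 L2 by (simp_all add: u_def numeral_2_eq_2)
  have Ld01: "Ld $ 0 = 1" "Ld $ 1 = 2 * \<kappa>" using lam1 L1 L2 by (simp_all add: Ld_def numeral_2_eq_2)
  define m where "m = u * inverse Ld"
  have LdI: "Ld * inverse Ld = 1" by (rule inverse_mult_eq_1') (simp add: Ld01)
  have urad: "fps_conv_radius u > 0" unfolding u_def using Lrad by (intro fps_conv_radius_mult_pos) auto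
  have "fps_conv_radius (fps_deriv L) > 0" using Lrad fps_conv_radius_deriv[of L] by auto
  then have "fps_conv_radius Ld > 0" unfolding Ld_def by (intro fps_conv_radius_mult_pos) auto
  then have mrad: "fps_conv_radius m > 0" unfolding m_def
    by (intro fps_conv_radius_mult_pos urad fps_conv_radius_inverse_pos) (auto simp: Ld01)
  have mLd: "m * Ld = u" unfolding m_def using LdI by algebra
  have m01: "m $ 0 = 1" "m $ 1 = - \<kappa>"
    using fps_mult_nth_upto2(1,2)[of m Ld] unfolding mLd u01 Ld01 by simp_all
  have theta_L: "theta f oo L = m * theta (f oo L)" for f
  proof -
    have "theta f oo L = L * (fps_deriv f oo L)"
      using L0 by (simp add: theta_def fps_compose_mult_distrib)
    moreover have "theta (f oo L) = fps_X * (fps_deriv f oo L) * (fps_const (lam 1) * Ld)"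
      using lam1 by (simp add: theta_def Ld_def fps_compose_deriv[OF L0] mult.assoc flip: fps_const_mult)
    ultimately show ?thesis using mLd unfolding Lu by algebra
  qed
  obtain C Z0 Z1 Z2 where Z: "C \<noteq> 0" "(\<lambda>n. fish_g0 $ n / fish_a n) \<longlonglongrightarrow> C"
    "fps_bigo fish_a (-2) Z0" "fps_bigo fish_a (-2) Z1" "fps_bigo fish_a (-1) Z2"
    "fish_g0 = fps_const fish_mu * fps_X * (theta fish_g0 + fps_const (3/2) * fish_g0) + Z0"
    "fish_g1 = fps_const fish_mu * (theta fish_g0 + fps_const (3/2) * fish_g0) - fps_const (1/2) * fish_g0
        + fps_const (1/12 - fish_mu / 24) * fps_X * fish_g0 + Z1"
    "fish_m2 = fps_const fish_mu * (theta (fps_const fish_mu * (theta fish_g0 + fps_const (3/2) * fish_g0))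
          + fps_const (5/2) * (fps_const fish_mu * (theta fish_g0 + fps_const (3/2) * fish_g0)))
        - fps_const (3/2) * (fps_const fish_mu * (theta fish_g0 + fps_const (3/2) * fish_g0))
        + fps_const (5/12 - fish_mu / 12) * fish_g0 + Z2"
    by (rule fish_series_asymptotics)
  have lam1': "lam 1 \<noteq> 0" using lam1 by simp
  note comp = Fishburn_series_compose[of lam, OF lam1', folded Lam_def, folded L_def]
  have W: "fish_g0 oo L = W" and G1: "fish_g1 oo L = G1" and M2: "fish_m2 oo L = M2"
    using comp by (simp_all add: W_def G1_def M2_def)
  note dist = fps_compose_mult_distrib[OF L0] fps_compose_sub_distrib fps_compose_add_distrib fps_const_compose theta_L
    fps_X_fps_compose_startby0[OF L0] W G1 M2
  have big: "fps_bigo s e (Z oo L)" if "fps_bigo fish_a e Z" for e Z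
    using fps_bigo_compose[OF fish_a_growth lam1 urad u01(1) that] unfolding Lu[symmetric] s_def .
  \<comment> \<open>The substitution changes the limit by an exponential factor; only its being
    nonzero matters.\<close>
  have lim: "(\<lambda>n. W $ n / s n) \<longlonglongrightarrow> C * exp (1 / fish_mu * \<kappa> / lam 1)"
    using fps_compose_leading_asymptotics[OF fish_a_growth lam1 urad u01(1) fish_a_ratio Z(2)]
    unfolding Lu[symmetric] W u01 s_def by simp
  show ?thesis
  proof (rule that[OF _ lim urad mrad u01 m01 big[OF Z(3)] big[OF Z(4)] big[OF Z(5)]])
    show "C * exp (1 / fish_mu * \<kappa> / lam 1) \<noteq> 0" using Z(1) by simp
    show "W = mu * (r * fps_X * u) * (m * theta W + fps_const (3/2) * W) + (Z0 oo L)"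
      using arg_cong[OF Z(6), of "\<lambda>f. f oo L"] unfolding dist Lu[symmetric] mu_def r_def .
    show "G1 = mu * (m * theta W + fps_const (3/2) * W) - fps_const (1/2) * W
        + fps_const (1/12 - fish_mu / 24) * (r * fps_X * u) * W + (Z1 oo L)"
      using arg_cong[OF Z(7), of "\<lambda>f. f oo L"] unfolding dist Lu[symmetric] mu_def r_def .
    show "M2 = mu * (m * theta (mu * (m * theta W + fps_const (3/2) * W))
          + fps_const (5/2) * (mu * (m * theta W + fps_const (3/2) * W)))
        - fps_const (3/2) * (mu * (m * theta W + fps_const (3/2) * W))
        + fps_const (5/12 - fish_mu / 12) * W + (Z2 oo L)"
      using arg_cong[OF Z(8), of "\<lambda>f. f oo L"] unfolding dist Lu[symmetric] mu_def r_def .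
  qed
qed

lemma fps_split_2: "(f :: real fps) = fps_const (f $ 0) + fps_const (f $ 1) * fps_X + fps_X\<^sup>2 * fps_shift 2 f"
proof (rule fps_ext)
  fix n :: nat
  have "n = 0 \<or> n = 1 \<or> (\<exists>k. n = k + 2)" by presburger
  then show "f $ n = (fps_const (f $ 0) + fps_const (f $ 1) * fps_X + fps_X\<^sup>2 * fps_shift 2 f) $ n"
    by (elim disjE exE) (auto simp: fps_X_power_mult_nth)
qed

text \<open>Each factor X shifts an index by 1. The series u and m are expanded as far as the errors
  require: X^3 T, for example, has exponent 1 - 3 = -2. The coefficient \<open>k2\<close> of z^2 in
  m is left symbolic.\<close>

lemma Fishburn_moment_coefficients:
  assumes conv: "fps_conv_radius (Lambda_fps lam) > 0" and lam1: "lam 1 > 0"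
  defines "\<kappa> \<equiv> lam 2 / lam 1 - lam 1 / 2"
    and "s \<equiv> (\<lambda>n. fish_a n * lam 1 ^ n)"
    and "W \<equiv> fps_at1 (Fishburn_gf lam)"
    and "G1 \<equiv> fps_d1 (Fishburn_gf lam)"
    and "M2 \<equiv> fps_d2 (Fishburn_gf lam) + fps_d1 (Fishburn_gf lam)"
  obtains C R0 R1 R2 k2 where
    "C \<noteq> 0" "(\<lambda>n. W $ n / s n) \<longlonglongrightarrow> C"
    "fps_bigo s (-2) R0" "fps_bigo s (-2) R1" "fps_bigo s (-1) R2"
    "\<And>n. n \<ge> 2 \<Longrightarrow> W $ n = fish_mu * lam 1 * (real n + 1/2) * W $ (n - 1) + R0 $ n"
    "\<And>n. n \<ge> 2 \<Longrightarrow> G1 $ n = fish_mu * (real n * W $ n - \<kappa> * (real n - 1) * W $ (n - 1) + k2 * (real n - 2) * W $ (n - 2))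
        + (3/2 * fish_mu - 1/2) * W $ n + (1/12 - fish_mu / 24) * lam 1 * W $ (n - 1) + R1 $ n"
    "\<And>n. n \<ge> 2 \<Longrightarrow> M2 $ n = fish_mu\<^sup>2 * ((real n)\<^sup>2 * W $ n - 2 * \<kappa> * (real n - 1)\<^sup>2 * W $ (n - 1)
          + (\<kappa>\<^sup>2 + 2 * k2) * (real n - 2)\<^sup>2 * W $ (n - 2) - \<kappa> * (real n - 1) * W $ (n - 1))
        + (4 * fish_mu\<^sup>2 - 3/2 * fish_mu) * (real n * W $ n - \<kappa> * (real n - 1) * W $ (n - 1))
        + (15/4 * fish_mu\<^sup>2 - 9/4 * fish_mu + 5/12 - fish_mu / 12) * W $ n + R2 $ n"
proof -
  define r where "r = fps_const (lam 1)"
  define mu where "mu = fps_const fish_mu"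
  have sn: "fish_a n * lam 1 ^ n = s n" for n by (simp add: s_def)
  obtain C u m Z0 Z1 Z2 where
    C: "C \<noteq> 0" "(\<lambda>n. W $ n / s n) \<longlonglongrightarrow> C" and
    rad: "fps_conv_radius u > 0" "fps_conv_radius m > 0" and
    u: "u $ 0 = 1" "u $ 1 = \<kappa>" and m: "m $ 0 = 1" "m $ 1 = - \<kappa>" and
    Z: "fps_bigo s (-2) Z0" "fps_bigo s (-2) Z1" "fps_bigo s (-1) Z2" and
    W: "W = mu * (r * fps_X * u) * (m * theta W + fps_const (3/2) * W) + Z0" and
    G1: "G1 = mu * (m * theta W + fps_const (3/2) * W) - fps_const (1/2) * W
        + fps_const (1/12 - fish_mu / 24) * (r * fps_X * u) * W + Z1" and
    M2: "M2 = mu * (m * theta (mu * (m * theta W + fps_const (3/2) * W))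
          + fps_const (5/2) * (mu * (m * theta W + fps_const (3/2) * W)))
        - fps_const (3/2) * (mu * (m * theta W + fps_const (3/2) * W))
        + fps_const (5/12 - fish_mu / 12) * W + Z2"
    by (rule Fishburn_z_asymptotics[of lam, OF conv lam1, folded M2_def, folded W_def G1_def s_def \<kappa>_def r_def mu_def, unfolded sn])
  have s: "fact_growth (1 / fish_mu / lam 1) s"
    unfolding s_def by (rule fact_growth_scale[OF fish_a_growth lam1])
  have rr: "fps_conv_radius r > 0" "fps_conv_radius mu > 0" by (simp_all add: r_def mu_def)
  have bW: "fps_bigo s 0 W" by (rule fps_bigo_of_limit[OF C(2) s])
  have XW: "fps_bigo s (- real k) (fps_X ^ k * W)" for k using fps_bigo_X_power[OF bW s, of k] by simp
  define kc where "kc = fps_const \<kappa>"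
  define k2 where "k2 = m $ 2"
  define k2c where "k2c = fps_const k2"
  define m3 where "m3 = fps_shift 3 m"
  have m3: "m = 1 - kc * fps_X + k2c * fps_X\<^sup>2 + fps_X ^ 3 * m3"
  proof -
    have n: "fps_const (- \<kappa>) = - fps_const \<kappa>" by simp
    show ?thesis using fps_split_3[of m] unfolding m m3_def k2_def[symmetric] kc_def k2c_def n
      by (simp only: mult_minus_left fps_const_1_eq_1 add_uminus_conv_diff)
  qed
  have rm3: "fps_conv_radius m3 > 0" using rad(2) by (simp add: m3_def)
  have rk: "fps_conv_radius kc > 0" "fps_conv_radius k2c > 0" by (simp_all add: kc_def k2c_def)
  define u1 where "u1 = fps_shift 1 u"
  have u1: "u = 1 + fps_X * u1" by (rule fps_ext) (use u in \<open>simp add: u1_def\<close>)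
  have ru1: "fps_conv_radius u1 > 0" using rad(1) by (simp add: u1_def)
  \<comment> \<open>The linear terms of u and m cancel, so \<kappa> does not appear in the
    recurrence for W.\<close>
  define p where "p = fps_shift 2 (u * m)"
  have p: "u * m = 1 + fps_X\<^sup>2 * p"
    using fps_split_2[of "u * m"] unfolding fps_mult_nth_upto2 u m p_def by simp
  have rp: "fps_conv_radius p > 0" using fps_conv_radius_mult_pos[OF rad] by (simp add: p_def)
  define T where "T = theta W"
  define TT where "TT = theta T"
  have bT: "fps_bigo s 1 T" using fps_bigo_theta[OF bW s] by (simp add: T_def)
  have bTT: "fps_bigo s 2 TT" using fps_bigo_theta[OF bT s] by (simp add: TT_def)
  have XT: "fps_bigo s (1 - real k) (fps_X ^ k * T)" for k using fps_bigo_X_power[OF bT s] by simp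
  have XTT: "fps_bigo s (2 - real k) (fps_X ^ k * TT)" for k using fps_bigo_X_power[OF bTT s] by simp

  define h where "h = fps_const (1/2 :: real)"
  have h: "2 * h = 1" "fps_const (3/2) = 3 * h" "fps_const (5/2) = 5 * h"
    by (simp_all add: h_def numeral_fps_const)
  define c1 where "c1 = fps_const (1/12 - fish_mu / 24)"
  define c2 where "c2 = fps_const (5/12 - fish_mu / 12)"
  have rc: "fps_conv_radius h > 0" "fps_conv_radius c1 > 0" "fps_conv_radius c2 > 0" by (simp_all add: h_def c1_def c2_def)

  define R0 where "R0 = mu * r * p * (fps_X ^ 3 * T) + mu * r * 3 * h * u1 * (fps_X ^ 2 * W) + Z0"
  have W': "W = mu * r * (fps_X * T + 3 * h * (fps_X * W)) + R0"
  proof -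
    have "W = mu * r * fps_X * ((u * m) * T + u * (3 * h * W)) + Z0"
      using W unfolding h T_def[symmetric] by algebra
    then show ?thesis unfolding R0_def p unfolding u1 by algebra
  qed
  have R0: "fps_bigo s (-2) R0" unfolding R0_def
  proof (intro fps_bigo_add Z(1))
    show "fps_bigo s (-2) (mu * r * p * (fps_X ^ 3 * T))"
      by (rule fps_bigo_mult[OF _ _ s]) (use XT[of 3] in \<open>auto intro!: fps_conv_radius_pos_intros rr rp\<close>)
    show "fps_bigo s (-2) (mu * r * 3 * h * u1 * (fps_X ^ 2 * W))"
      by (rule fps_bigo_mult[OF _ _ s]) (use XW[of 2] in \<open>auto intro!: fps_conv_radius_pos_intros rr ru1 rc\<close>)
  qed

  define R1 where "R1 = mu * m3 * (fps_X ^ 3 * T) + c1 * r * u1 * (fps_X ^ 2 * W) + Z1"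
  have G1': "G1 = mu * (T - kc * (fps_X * T) + k2c * (fps_X\<^sup>2 * T)) + (3 * h * mu - h) * W + c1 * r * (fps_X * W) + R1"
    using G1 unfolding h T_def[symmetric] c1_def[symmetric] h_def[symmetric] R1_def unfolding m3 u1 by algebra
  have R1: "fps_bigo s (-2) R1" unfolding R1_def
  proof (intro fps_bigo_add Z(2))
    show "fps_bigo s (-2) (mu * m3 * (fps_X ^ 3 * T))"
      by (rule fps_bigo_mult[OF _ _ s]) (use XT[of 3] in \<open>auto intro!: fps_conv_radius_pos_intros rr rm3\<close>)
    show "fps_bigo s (-2) (c1 * r * u1 * (fps_X ^ 2 * W))"
      by (rule fps_bigo_mult[OF _ _ s]) (use XW[of 2] in \<open>auto intro!: fps_conv_radius_pos_intros rr ru1 rc\<close>)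
  qed

  define mm3 where "mm3 = fps_shift 3 (m * m)"
  have mm3: "m * m = 1 - 2 * kc * fps_X + (kc\<^sup>2 + 2 * k2c) * fps_X\<^sup>2 + fps_X ^ 3 * mm3"
  proof -
    have n: "fps_const (2 * - \<kappa>) = - (2 * kc)" "fps_const (k2 + \<kappa>\<^sup>2 + k2) = kc\<^sup>2 + 2 * k2c"
      by (simp_all add: kc_def k2c_def numeral_fps_const fps_const_power)
    have "(m * m) $ 0 = 1" "(m * m) $ 1 = 2 * - \<kappa>" "(m * m) $ 2 = k2 + \<kappa>\<^sup>2 + k2"
      unfolding fps_mult_nth_upto2 m k2_def by (simp_all add: power2_eq_square)
    with fps_split_3[of "m * m"] show ?thesis unfolding mm3_def[symmetric]
      by (simp only: n mult_minus_left fps_const_1_eq_1 add_uminus_conv_diff)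
  qed
  have rmm3: "fps_conv_radius mm3 > 0" using fps_conv_radius_mult_pos[OF rad(2,2)] by (simp add: mm3_def)
  \<comment> \<open>Arises when the outer Euler operator hits the inner factor m; its linear
    coefficient -\<kappa> gives the last shifted term in the \<mu>^2 part of M2.\<close>
  define mt where "mt = fps_shift 2 (m * theta m)"
  have mt: "m * theta m = - kc * fps_X + fps_X\<^sup>2 * mt"
  proof -
    have "(m * theta m) $ 0 = 0" "(m * theta m) $ 1 = - \<kappa>"
      unfolding fps_mult_nth_upto2 theta_nth m by simp_all
    with fps_split_2[of "m * theta m"] show ?thesis unfolding mt_def[symmetric] kc_def
      by (simp add: fps_const_neg[symmetric] del: fps_const_neg)
  qed
  have rmt: "fps_conv_radius mt > 0"
  proof -
    have "fps_conv_radius (fps_deriv m) > 0" using rad(2) fps_conv_radius_deriv[of m] by (rule less_le_trans)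
    then have "fps_conv_radius (theta m) > 0" unfolding theta_def by (intro fps_conv_radius_mult_pos) auto
    then have "fps_conv_radius (m * theta m) > 0" by (rule fps_conv_radius_mult_pos[OF rad(2)])
    then show ?thesis by (simp add: mt_def)
  qed
  define R2 where "R2 = mu\<^sup>2 * mm3 * (fps_X ^ 3 * TT) + mu\<^sup>2 * mt * (fps_X ^ 2 * T)
     + (4 * mu\<^sup>2 - 3 * h * mu) * (k2c + fps_X * m3) * (fps_X ^ 2 * T) + Z2"
  have M2': "M2 = mu\<^sup>2 * (TT - 2 * kc * (fps_X * TT) + (kc\<^sup>2 + 2 * k2c) * (fps_X\<^sup>2 * TT) - kc * (fps_X * T))
     + (4 * mu\<^sup>2 - 3 * h * mu) * (T - kc * (fps_X * T)) + (15 * h * h * mu\<^sup>2 - 9 * h * h * mu + c2) * W + R2"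
  proof -
    have tm: "theta (mu * f) = mu * theta f" "theta (h * f) = h * theta f" "theta (3 * f) = 3 * theta f" for f
      by (simp_all add: theta_mult mu_def h_def theta_const numeral_fps_const)
    have t1: "m * theta (mu * (m * T + 3 * h * W)) = mu * ((m * theta m) * T + (m * m) * TT + 3 * h * (m * T))"
      unfolding tm theta_add mult.assoc tm theta_mult[of m] TT_def[symmetric] T_def[symmetric] by algebra
    have "M2 = mu * (mu * ((m * theta m) * T + (m * m) * TT + 3 * h * (m * T)) + 5 * h * (mu * (m * T + 3 * h * W)))
        - 3 * h * (mu * (m * T + 3 * h * W)) + c2 * W + Z2"
      using M2 unfolding h T_def[symmetric] c2_def[symmetric] t1 .
    \<comment> \<open>The shifts 3/2 and 5/2 combine to 4 = 3/2 + 5/2 and 15/4 = 3/2 times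
      5/2.\<close>
    then have "M2 = mu\<^sup>2 * ((m * theta m) * T + (m * m) * TT) + (4 * mu\<^sup>2 - 3 * h * mu) * (m * T)
        + (15 * h * h * mu\<^sup>2 - 9 * h * h * mu + c2) * W + Z2"
      using h(1) by algebra
    then show ?thesis unfolding mm3 mt R2_def using m3 by algebra
  qed
  have R2: "fps_bigo s (-1) R2" unfolding R2_def
  proof (intro fps_bigo_add Z(3))
    show "fps_bigo s (-1) (mu\<^sup>2 * mm3 * (fps_X ^ 3 * TT))"
      by (rule fps_bigo_mult[OF _ _ s]) (use XTT[of 3] in \<open>auto intro!: fps_conv_radius_pos_intros rr rmm3\<close>)
    show "fps_bigo s (-1) (mu\<^sup>2 * mt * (fps_X ^ 2 * T))"
      by (rule fps_bigo_mult[OF _ _ s]) (use XT[of 2] in \<open>auto intro!: fps_conv_radius_pos_intros rr rmt\<close>)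
    show "fps_bigo s (-1) ((4 * mu\<^sup>2 - 3 * h * mu) * (k2c + fps_X * m3) * (fps_X ^ 2 * T))"
      by (rule fps_bigo_mult[OF _ _ s]) (use XT[of 2] in \<open>auto intro!: fps_conv_radius_pos_intros rr rk rm3 rc\<close>)
  qed
  have Tn: "T $ n = real n * W $ n" "TT $ n = (real n)\<^sup>2 * W $ n" for n
    by (simp_all add: TT_def T_def theta_nth power2_eq_square)
  note nth = mult.assoc fps_mult_left_const_nth fps_add_nth fps_sub_nth fps_X_mult_nth fps_X_power_mult_nth Tn
  show ?thesis
  proof (rule that[OF C R0 R1 R2])
    fix n :: nat assume n: "n \<ge> 2"
    have n1: "real (n - 1) = real n - 1" "real (n - 2) = real n - 2" "n \<noteq> 0" "\<not> n < 2" using n by auto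
    have "mu * r * (fps_X * T + 3 * h * (fps_X * W)) = fps_const (fish_mu * lam 1) * (fps_X * T + fps_const (3/2) * (fps_X * W))"
      unfolding mu_def r_def h by simp
    then have "W $ n = (fps_const (fish_mu * lam 1) * (fps_X * T + fps_const (3/2) * (fps_X * W)) + R0) $ n"
      using W' by simp
    then show "W $ n = fish_mu * lam 1 * (real n + 1/2) * W $ (n - 1) + R0 $ n"
      unfolding nth using n1 by (simp add: algebra_simps)
    have "mu * (T - kc * (fps_X * T) + k2c * (fps_X\<^sup>2 * T)) + (3 * h * mu - h) * W + c1 * r * (fps_X * W)
      = fps_const fish_mu * (T - fps_const \<kappa> * (fps_X * T) + fps_const k2 * (fps_X\<^sup>2 * T)) + fps_const (3/2 * fish_mu - 1/2) * W
         + fps_const ((1/12 - fish_mu / 24) * lam 1) * (fps_X * W)"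
    proof -
      have "fps_const (3/2 * fish_mu - 1/2) = 3 * h * mu - h" 
        by (simp add: h_def mu_def numeral_fps_const)
      moreover have "fps_const ((1/12 - fish_mu / 24) * lam 1) = c1 * r" by (simp add: c1_def r_def)
      ultimately show ?thesis unfolding mu_def kc_def k2c_def by simp
    qed
    then have "G1 $ n = (fps_const fish_mu * (T - fps_const \<kappa> * (fps_X * T) + fps_const k2 * (fps_X\<^sup>2 * T)) + fps_const (3/2 * fish_mu - 1/2) * W
         + fps_const ((1/12 - fish_mu / 24) * lam 1) * (fps_X * W) + R1) $ n"
      using G1' by simp
    then show "G1 $ n = fish_mu * (real n * W $ n - \<kappa> * (real n - 1) * W $ (n - 1) + k2 * (real n - 2) * W $ (n - 2))
        + (3/2 * fish_mu - 1/2) * W $ n + (1/12 - fish_mu / 24) * lam 1 * W $ (n - 1) + R1 $ n"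
      unfolding nth using n1 by simp
    have "mu\<^sup>2 * (TT - 2 * kc * (fps_X * TT) + (kc\<^sup>2 + 2 * k2c) * (fps_X\<^sup>2 * TT) - kc * (fps_X * T))
     + (4 * mu\<^sup>2 - 3 * h * mu) * (T - kc * (fps_X * T)) + (15 * h * h * mu\<^sup>2 - 9 * h * h * mu + c2) * W
     = fps_const (fish_mu\<^sup>2) * (TT - fps_const (2 * \<kappa>) * (fps_X * TT) + fps_const (\<kappa>\<^sup>2 + 2 * k2) * (fps_X\<^sup>2 * TT) - fps_const \<kappa> * (fps_X * T))
     + fps_const (4 * fish_mu\<^sup>2 - 3/2 * fish_mu) * (T - fps_const \<kappa> * (fps_X * T))
     + fps_const (15/4 * fish_mu\<^sup>2 - 9/4 * fish_mu + 5/12 - fish_mu / 12) * W"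
    proof -
      have "fps_const (15/4 * fish_mu\<^sup>2 - 9/4 * fish_mu + 5/12 - fish_mu / 12) = 15 * h * h * mu\<^sup>2 - 9 * h * h * mu + c2"
        "fps_const (4 * fish_mu\<^sup>2 - 3/2 * fish_mu) = 4 * mu\<^sup>2 - 3 * h * mu"
        "fps_const (2 * \<kappa>) = 2 * kc" "fps_const (\<kappa>\<^sup>2 + 2 * k2) = kc\<^sup>2 + 2 * k2c" "fps_const (fish_mu\<^sup>2) = mu\<^sup>2"
        by (simp_all add: h_def mu_def c2_def kc_def k2c_def numeral_fps_const fps_const_power)
      then show ?thesis unfolding kc_def[symmetric] by (simp only:)
    qed
    then have "M2 $ n = (fps_const (fish_mu\<^sup>2) * (TT - fps_const (2 * \<kappa>) * (fps_X * TT) + fps_const (\<kappa>\<^sup>2 + 2 * k2) * (fps_X\<^sup>2 * TT) - fps_const \<kappa> * (fps_X * T))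
     + fps_const (4 * fish_mu\<^sup>2 - 3/2 * fish_mu) * (T - fps_const \<kappa> * (fps_X * T))
     + fps_const (15/4 * fish_mu\<^sup>2 - 9/4 * fish_mu + 5/12 - fish_mu / 12) * W + R2) $ n"
      using M2' by simp
    then show "M2 $ n = fish_mu\<^sup>2 * ((real n)\<^sup>2 * W $ n - 2 * \<kappa> * (real n - 1)\<^sup>2 * W $ (n - 1)
          + (\<kappa>\<^sup>2 + 2 * k2) * (real n - 2)\<^sup>2 * W $ (n - 2) - \<kappa> * (real n - 1) * W $ (n - 1))
        + (4 * fish_mu\<^sup>2 - 3/2 * fish_mu) * (real n * W $ n - \<kappa> * (real n - 1) * W $ (n - 1))
        + (15/4 * fish_mu\<^sup>2 - 9/4 * fish_mu + 5/12 - fish_mu / 12) * W $ n + R2 $ n"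
      unfolding nth using n1 by simp
  qed
qed

section \<open>From coefficient recurrences to mean and variance\<close>

lemma fps_bigo_ratio:
  assumes "fps_bigo s (- real j) Z" "(\<lambda>n. W $ n / s n) \<longlonglongrightarrow> C" "C \<noteq> 0" "fact_growth B s"
  shows "(\<lambda>n. Z $ n / W $ n) \<in> O(\<lambda>n. (1 / real n) ^ j)"
proof -
  obtain c where c: "c \<ge> 0" "\<And>n. \<bar>Z $ n\<bar> \<le> c * s n * real (Suc n) powr (- real j)"
    using fps_bigoE[OF assms(1,4)] by blast
  have "(\<lambda>n. \<bar>W $ n / s n\<bar>) \<longlonglongrightarrow> \<bar>C\<bar>" using assms(2) by (rule tendsto_rabs)
  then have "eventually (\<lambda>n. \<bar>W $ n / s n\<bar> > \<bar>C\<bar> / 2) sequentially"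
    by (rule order_tendstoD(1)) (use assms(3) in simp)
  then have "eventually (\<lambda>n. norm (Z $ n / W $ n) \<le> (2 * c / \<bar>C\<bar>) * norm ((1 / real n) ^ j)) sequentially"
    using eventually_gt_at_top[of 0]
  proof eventually_elim
    case (elim n)
    have sp: "s n > 0" by (rule fact_growth_pos[OF assms(4)])
    have w: "\<bar>W $ n\<bar> \<ge> \<bar>C\<bar> / 2 * s n"
      using elim(1) sp by (simp add: abs_divide pos_less_divide_eq)
    have w0: "\<bar>C\<bar> / 2 * s n > 0" using sp assms(3) by simp
    have "real (Suc n) powr (- real j) \<le> real n powr (- real j)" using elim(2) by (intro powr_mono2') auto
    also have "\<dots> = (1 / real n) ^ j" using elim(2) by (simp add: powr_minus powr_realpow power_one_over inverse_eq_divide)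
    finally have p: "real (Suc n) powr (- real j) \<le> (1 / real n) ^ j" .
    have "\<bar>Z $ n\<bar> / \<bar>W $ n\<bar> \<le> (c * s n * (1 / real n) ^ j) / (\<bar>C\<bar> / 2 * s n)"
    proof (rule frac_le)
      show "\<bar>Z $ n\<bar> \<le> c * s n * (1 / real n) ^ j"
        using c(2)[of n] mult_left_mono[OF p, of "c * s n"] c(1) sp by simp
    qed (use c(1) sp w w0 in auto)
    also have "\<dots> = (2 * c / \<bar>C\<bar>) * (1 / real n) ^ j" using sp by simp
    finally show ?case by (simp add: abs_divide)
  qed
  then show ?thesis by (rule bigoI)
qed

lemma bigo_inverse_power_times_linear:
  fixes f g :: "nat \<Rightarrow> real"
  assumes "f \<in> O(\<lambda>n. (1 / real n) ^ Suc j)" "g \<in> O(\<lambda>n. real n)"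
  shows "(\<lambda>n. g n * f n) \<in> O(\<lambda>n. (1 / real n) ^ j)"
proof -
  have "(\<lambda>n. g n * f n) \<in> O(\<lambda>n. real n * (1 / real n) ^ Suc j)"
    by (rule landau_o.big.mult[OF assms(2,1)])
  also have "(\<lambda>n. real n * (1 / real n) ^ Suc j) \<in> O(\<lambda>n. (1 / real n) ^ j)"
    by (rule bigoI[where c = 1], use eventually_gt_at_top[of 0] in eventually_elim) simp
  finally show ?thesis .
qed

lemma bigo_inverse_power_mono:
  assumes "f \<in> O(\<lambda>n. (1 / real n) ^ i)" "j \<le> i"
  shows "f \<in> O(\<lambda>n. (1 / real n) ^ j)"
proof -
  have "(\<lambda>n. (1 / real n) ^ i) \<in> O(\<lambda>n. (1 / real n) ^ j)"
    by (rule bigoI[where c = 1], use eventually_gt_at_top[of 0] in eventually_elim)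
       (use assms(2) in \<open>auto simp: power_abs intro!: power_decreasing\<close>)
  then show ?thesis by (rule landau_o.big_trans[OF assms(1)])
qed

lemma bigo_cmult: "f \<in> O(g) \<Longrightarrow> (\<lambda>n. c * f n) \<in> O(g)" for f g :: "nat \<Rightarrow> real"
  by (cases "c = 0") simp_all

text \<open>A polynomial identity modulo N x = 1, where x is 1/n, q is 1/12 - mu/24, and d1, d2 are
  the errors in w (n-1) / w n = k x - k x^2/2 + d1 and w (n-2) / w n = k^2 x^2 + d2. The right side
  collects the terms of size O(1/n^2).\<close>

lemma mean_recentring_identity:
  fixes N x :: real
  assumes nx: "N * x = 1"
  shows "\<mu> * (N - \<kappa> * (N - 1) * (k * x - k * x\<^sup>2 / 2 + d1) + k2 * (N - 2) * (k\<^sup>2 * x\<^sup>2 + d2)) +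
     (3 / 2 * \<mu> - 1 / 2) + q * \<Lambda> * (k * x - k * x\<^sup>2 / 2 + d1) + \<rho> -
     (\<mu> * (N + 3 / 2) - 1 / 2 - \<mu> * \<kappa> * k + (3 / 2 * (\<mu> * \<kappa> * k) + \<mu> * k2 * k\<^sup>2 + q * \<Lambda> * k) * x) =
     (- \<mu> * \<kappa> * k / 2 - 2 * \<mu> * k2 * k\<^sup>2 - q * \<Lambda> * k / 2) * x\<^sup>2 +
     (- \<mu> * \<kappa> * N + (\<mu> * \<kappa> + q * \<Lambda>)) * d1 + (\<mu> * k2 * N + - 2 * \<mu> * k2) * d2 + \<rho>" (is "?l = ?r")
proof -
  have "?l - ?r = (N * x - 1) * (- \<mu> * \<kappa> * k * (1 - x / 2) + \<mu> * k2 * k\<^sup>2 * x)"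
    by (simp add: field_simps power2_eq_square)
  then show ?thesis using nx by simp
qed

text \<open>The same device one order coarser, with d standing for \<kappa>^2 + 2 k2. Quadratic
  factors in N appear as products of linear ones, each to be paid for by one power of 1/n in d1 or
  d2.\<close>

lemma second_moment_recentring_identity:
  fixes N x :: real
  assumes nx: "N * x = 1"
  shows "\<mu>\<^sup>2 * (N\<^sup>2 - 2 * \<kappa> * (N - 1)\<^sup>2 * (k * x - k * x\<^sup>2 / 2 + d1) + d * (N - 2)\<^sup>2 * (k\<^sup>2 * x\<^sup>2 + d2)
       - \<kappa> * (N - 1) * (k * x - k * x\<^sup>2 / 2 + d1)) + b * (N - \<kappa> * (N - 1) * (k * x - k * x\<^sup>2 / 2 + d1)) + c0 + \<rho>
     - (\<mu>\<^sup>2 * (N\<^sup>2 - 2 * \<kappa> * k * N + 4 * \<kappa> * k + d * k\<^sup>2) + b * (N - \<kappa> * k) + c0) =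
     (- 4 * \<mu>\<^sup>2 * \<kappa> * k - 4 * \<mu>\<^sup>2 * d * k\<^sup>2 + 3/2 * \<mu>\<^sup>2 * \<kappa> * k + 3/2 * b * \<kappa> * k) * x ^ 1
     + (\<mu>\<^sup>2 * \<kappa> * k + 4 * \<mu>\<^sup>2 * d * k\<^sup>2 - \<mu>\<^sup>2 * \<kappa> * k / 2 - b * \<kappa> * k / 2) * x\<^sup>2
     + (1 * N + - 1) * (((- 2 * \<mu>\<^sup>2 * \<kappa>) * N + (2 * \<mu>\<^sup>2 * \<kappa> - \<mu>\<^sup>2 * \<kappa> - b * \<kappa>)) * d1)
     + (1 * N + - 2) * (((\<mu>\<^sup>2 * d) * N + (- 2 * \<mu>\<^sup>2 * d)) * d2) + \<rho>"
  (is "?l = ?r")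
proof -
  have "N\<^sup>2 * x = N * (N * x)" "N\<^sup>2 * x\<^sup>2 = (N * x) * (N * x)" "N * x\<^sup>2 = (N * x) * x"
    by (simp_all add: power2_eq_square)
  then have N2: "N\<^sup>2 * x = N" "N\<^sup>2 * x\<^sup>2 = 1" "N * x\<^sup>2 = x" by (simp_all only: nx mult_1_right mult_1_left)
  have a: "(N - 1)\<^sup>2 * (k * x - k * x\<^sup>2 / 2 + d1) = k * N - 5/2 * k + 2 * k * x - k * x\<^sup>2 / 2 + (N - 1)\<^sup>2 * d1"
  proof -
    have "(N - 1)\<^sup>2 * (k * x - k * x\<^sup>2 / 2 + d1) = k * (N\<^sup>2 * x) - k * (N\<^sup>2 * x\<^sup>2) / 2 - 2 * k * (N * x) + k * (N * x\<^sup>2) + k * x - k * x\<^sup>2 / 2 + (N - 1)\<^sup>2 * d1"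
      by (simp add: power2_eq_square field_simps)
    then show ?thesis unfolding N2 nx by (simp add: field_simps)
  qed
  have c: "(N - 1) * (k * x - k * x\<^sup>2 / 2 + d1) = k - 3/2 * k * x + k * x\<^sup>2 / 2 + (N - 1) * d1"
  proof -
    have "(N - 1) * (k * x - k * x\<^sup>2 / 2 + d1) = k * (N * x) - k * (N * x\<^sup>2) / 2 - k * x + k * x\<^sup>2 / 2 + (N - 1) * d1"
      by (simp add: field_simps)
    then show ?thesis unfolding N2 nx by (simp add: field_simps)
  qed
  have e: "(N - 2)\<^sup>2 * (k\<^sup>2 * x\<^sup>2 + d2) = k\<^sup>2 - 4 * k\<^sup>2 * x + 4 * k\<^sup>2 * x\<^sup>2 + (N - 2)\<^sup>2 * d2"
  proof -
    have "(N - 2)\<^sup>2 * (k\<^sup>2 * x\<^sup>2 + d2) = k\<^sup>2 * (N\<^sup>2 * x\<^sup>2) - 4 * k\<^sup>2 * (N * x\<^sup>2) + 4 * k\<^sup>2 * x\<^sup>2 + (N - 2)\<^sup>2 * d2"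
      by (simp add: power2_eq_square field_simps)
    then show ?thesis unfolding N2 nx by simp
  qed
  show ?thesis unfolding mult.assoc a c e by (simp add: power2_eq_square field_simps)
qed

text \<open>X0 is the 1/n coefficient of the mean. Its cross term with mu N adds the constant 2 mu
  X0 to the square, and its k2 part cancels against that of the second moment; mu \<Lambda> k = 1
  removes \<Lambda> from the rest.\<close>

lemma variance_recentring_identity:
  fixes N x :: real
  assumes nx: "N * x = 1" and k1: "\<mu> * \<Lambda> * k = 1" and tau: "\<tau> = \<mu> * \<kappa> * k" 
    and X0: "X0 = 3/2 * \<tau> + \<mu> * k2 * k\<^sup>2 + (1/12 - \<mu> / 24) * \<Lambda> * k"
  shows "\<mu>\<^sup>2 * (N\<^sup>2 - 2 * \<kappa> * k * N + 4 * \<kappa> * k + (\<kappa>\<^sup>2 + 2 * k2) * k\<^sup>2)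
      + (4 * \<mu>\<^sup>2 - 3/2 * \<mu>) * (N - \<kappa> * k) + (15/4 * \<mu>\<^sup>2 - 9/4 * \<mu> + 5/12 - \<mu> / 12)
      - (\<mu> * (N + 3/2) - 1/2 - \<tau> + X0 * x)\<^sup>2 - ((\<mu>\<^sup>2 - \<mu> / 2) * (N + 3/2) + \<tau> / 2) =
     (- 2 * X0 * (3/2 * \<mu> - 1/2 - \<tau>)) * x ^ 1 + (- X0\<^sup>2) * x\<^sup>2"
proof -
  define D where "D = \<mu> * (N + 3/2) - 1/2 - \<tau>"
  have "D = \<mu> * N + (3/2 * \<mu> - 1/2 - \<tau>)" by (simp add: D_def algebra_simps)
  then have "D * x = \<mu> * (N * x) + (3/2 * \<mu> - 1/2 - \<tau>) * x" by (simp only: distrib_right mult.assoc)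
  then have Dx: "D * x = \<mu> + (3/2 * \<mu> - 1/2 - \<tau>) * x" by (simp only: nx mult_1_right)
  have sq: "(D + X0 * x)\<^sup>2 = D\<^sup>2 + 2 * X0 * (D * x) + X0\<^sup>2 * x\<^sup>2" by (simp add: power2_eq_square algebra_simps)
  have "2 * \<mu> * X0 = 3 * \<mu> * \<tau> + 2 * \<mu>\<^sup>2 * k2 * k\<^sup>2 + (1/6 - \<mu> / 12) * (\<mu> * \<Lambda> * k)"
    unfolding X0 by (simp add: field_simps power2_eq_square)
  then have mX: "2 * \<mu> * X0 = 3 * \<mu> * \<tau> + 2 * \<mu>\<^sup>2 * k2 * k\<^sup>2 + 1/6 - \<mu> / 12" unfolding k1 by simp
  have e: "\<mu>\<^sup>2 * (N\<^sup>2 - 2 * \<kappa> * k * N + 4 * \<kappa> * k + (\<kappa>\<^sup>2 + 2 * k2) * k\<^sup>2) + (4 * \<mu>\<^sup>2 - 3/2 * \<mu>) * (N - \<kappa> * k)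
    = \<mu>\<^sup>2 * N\<^sup>2 - 2 * \<mu> * \<tau> * N + 4 * \<mu> * \<tau> + \<tau>\<^sup>2 + 2 * \<mu>\<^sup>2 * k2 * k\<^sup>2 + (4 * \<mu>\<^sup>2 - 3/2 * \<mu>) * N - 4 * \<mu> * \<tau> + 3/2 * \<tau>"
    unfolding tau by (simp add: field_simps power2_eq_square)
  have "\<mu>\<^sup>2 * N\<^sup>2 - 2 * \<mu> * \<tau> * N + 4 * \<mu> * \<tau> + \<tau>\<^sup>2 + 2 * \<mu>\<^sup>2 * k2 * k\<^sup>2 + (4 * \<mu>\<^sup>2 - 3/2 * \<mu>) * N - 4 * \<mu> * \<tau> + 3/2 * \<tau>
      + (15/4 * \<mu>\<^sup>2 - 9/4 * \<mu> + 5/12 - \<mu> / 12) - D\<^sup>2 - (3 * \<mu> * \<tau> + 2 * \<mu>\<^sup>2 * k2 * k\<^sup>2 + 1/6 - \<mu> / 12)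
      - ((\<mu>\<^sup>2 - \<mu> / 2) * (N + 3/2) + \<tau> / 2) = 0"
    unfolding D_def by (simp add: field_simps power2_eq_square)
  then show ?thesis unfolding D_def[symmetric] e sq Dx using mX by (simp add: algebra_simps)
qed

text \<open>
  The unknown coefficient \<open>k2\<close> (it depends on \<open>lam 3\<close>) enters the mean at order \<open>1 / n\<close> and cancels in
  the variance.
\<close>

lemma moment_expansion:
  fixes w g h R0 R1 R2 :: "nat \<Rightarrow> real" and \<mu> \<Lambda> \<kappa> k2 :: real
  assumes pos: "\<mu> > 0" "\<Lambda> > 0"
    and wnz: "eventually (\<lambda>n. w n \<noteq> 0) sequentially"
    and rec: "\<And>n. n \<ge> 2 \<Longrightarrow> w n = \<mu> * \<Lambda> * (real n + 1/2) * w (n - 1) + R0 n"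
    and g: "\<And>n. n \<ge> 2 \<Longrightarrow> g n = \<mu> * (real n * w n - \<kappa> * (real n - 1) * w (n - 1) + k2 * (real n - 2) * w (n - 2))
        + (3/2 * \<mu> - 1/2) * w n + (1/12 - \<mu> / 24) * \<Lambda> * w (n - 1) + R1 n"
    and h: "\<And>n. n \<ge> 2 \<Longrightarrow> h n = \<mu>\<^sup>2 * ((real n)\<^sup>2 * w n - 2 * \<kappa> * (real n - 1)\<^sup>2 * w (n - 1)
          + (\<kappa>\<^sup>2 + 2 * k2) * (real n - 2)\<^sup>2 * w (n - 2) - \<kappa> * (real n - 1) * w (n - 1))
        + (4 * \<mu>\<^sup>2 - 3/2 * \<mu>) * (real n * w n - \<kappa> * (real n - 1) * w (n - 1))
        + (15/4 * \<mu>\<^sup>2 - 9/4 * \<mu> + 5/12 - \<mu> / 12) * w n + R2 n"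
    and R0: "(\<lambda>n. R0 n / w n) \<in> O(\<lambda>n. (1 / real n) ^ 2)"
    and R0': "(\<lambda>n. R0 (n - 1) / w n) \<in> O(\<lambda>n. (1 / real n) ^ 3)"
    and R1: "(\<lambda>n. R1 n / w n) \<in> O(\<lambda>n. (1 / real n) ^ 2)"
    and R2: "(\<lambda>n. R2 n / w n) \<in> O(\<lambda>n. (1 / real n) ^ 1)"
  defines "\<tau> \<equiv> \<kappa> / \<Lambda>"
  shows "(\<lambda>n. g n / w n - (\<mu> * (real n + 3/2) - 1/2 - \<tau>)) \<in> O(\<lambda>n. (1 / real n) ^ 1)"
    and "(\<lambda>n. h n / w n - (g n / w n)\<^sup>2 - ((\<mu>\<^sup>2 - \<mu> / 2) * (real n + 3/2) + \<tau> / 2)) \<in> O(\<lambda>n. (1 / real n) ^ 1)"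
proof -
  define k where "k = 1 / (\<mu> * \<Lambda>)"
  have k1: "\<mu> * \<Lambda> * k = 1" using pos by (simp add: k_def)
  have tau: "\<tau> = \<mu> * \<kappa> * k" using pos by (simp add: \<tau>_def k_def)
  define x where "x = (\<lambda>n::nat. 1 / real n)"
  define r where "r = (\<lambda>n. w (n - 1) / w n)"
  define r2 where "r2 = (\<lambda>n. w (n - 2) / w n)"
  define \<delta>1 where "\<delta>1 = (\<lambda>n. r n - (k * x n - k * (x n)\<^sup>2 / 2))"
  define \<delta>2 where "\<delta>2 = (\<lambda>n. r2 n - k\<^sup>2 * (x n)\<^sup>2)"
  define \<rho>0 where "\<rho>0 = (\<lambda>n. R0 n / w n)"
  define \<rho>0' where "\<rho>0' = (\<lambda>n. R0 (n - 1) / w n)"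
  define \<rho>1 where "\<rho>1 = (\<lambda>n. R1 n / w n)"
  define \<rho>2 where "\<rho>2 = (\<lambda>n. R2 n / w n)"
  note O = bigo_inverse_power_times_linear
  have ev: "eventually (\<lambda>n. w n \<noteq> 0 \<and> n \<ge> 3) sequentially"
    using wnz eventually_ge_at_top[of 3] by eventually_elim simp
  have x_bigo: "(\<lambda>n. c * x n ^ j) \<in> O(\<lambda>n. (1 / real n) ^ j)" for c j
    unfolding x_def by simp

  \<comment> \<open>The recurrence divided by w n gives r n = k / (n + 1/2) up to R0, and 1 / (n +
    1/2) = x - x^2/2 + O(x^3).\<close>
  have \<delta>1: "\<delta>1 \<in> O(\<lambda>n. (1 / real n) ^ 3)"
  proof -
    have "eventually (\<lambda>n. \<delta>1 n = k * (1 / (real n + 1/2) - 1 / real n + (1 / real n)\<^sup>2 / 2) - k / (real n + 1/2) * \<rho>0 n) sequentially"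
      using ev
    proof eventually_elim
      case (elim n)
      have "1 = \<mu> * \<Lambda> * (real n + 1/2) * r n + \<rho>0 n"
        using arg_cong[OF rec[of n], of "\<lambda>y. y / w n"] elim by (simp add: r_def \<rho>0_def add_divide_distrib)
      then have "(real n + 1/2) * r n = k * (1 - \<rho>0 n)" using k1 by algebra
      then have "r n = k * (1 - \<rho>0 n) / (real n + 1/2)" by (simp add: eq_divide_eq mult.commute)
      also have "\<dots> = k * (1 / (real n + 1/2)) - k / (real n + 1/2) * \<rho>0 n"
        by (simp add: diff_divide_distrib right_diff_distrib)
      finally show ?case by (simp add: \<delta>1_def x_def algebra_simps)
    qed
    moreover have "(\<lambda>n. k * (1 / (real n + 1/2) - 1 / real n + (1 / real n)\<^sup>2 / 2) - k / (real n + 1/2) * \<rho>0 n) \<in> O(\<lambda>n. (1 / real n) ^ 3)"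
    proof (rule sum_in_bigo(2))
      have "(\<lambda>n::nat. 1 / (real n + 1/2) - 1 / real n + (1 / real n)\<^sup>2 / 2) \<in> O(\<lambda>n. (1 / real n) ^ 3)" by real_asymp
      then show "(\<lambda>n::nat. k * (1 / (real n + 1/2) - 1 / real n + (1 / real n)\<^sup>2 / 2)) \<in> O(\<lambda>n. (1 / real n) ^ 3)"
        by (rule bigo_cmult)
      have "(\<lambda>n::nat. 1 / (real n + 1/2)) \<in> O(\<lambda>n. 1 / real n)" by real_asymp
      then have "(\<lambda>n::nat. k / (real n + 1/2)) \<in> O(\<lambda>n. 1 / real n)"
        using bigo_cmult[of _ _ k] by fastforce
      then have "(\<lambda>n. k / (real n + 1/2) * \<rho>0 n) \<in> O(\<lambda>n. 1 / real n * (1 / real n) ^ 2)"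
        unfolding \<rho>0_def by (rule landau_o.big.mult[OF _ R0])
      then show "(\<lambda>n. k / (real n + 1/2) * \<rho>0 n) \<in> O(\<lambda>n. (1 / real n) ^ 3)"
        by (simp add: power2_eq_square power3_eq_cube mult_ac)
    qed
    ultimately show ?thesis by (subst landau_o.big.in_cong)
  qed

  \<comment> \<open>The recurrence at n - 1, still divided by w n; this is where the bound on R0 (n
    - 1) / w n enters.\<close>
  have \<delta>2: "\<delta>2 \<in> O(\<lambda>n. (1 / real n) ^ 3)"
  proof -
    have "eventually (\<lambda>n. \<delta>2 n = k\<^sup>2 * ((1 / real n - (1 / real n)\<^sup>2 / 2) / (real n - 1/2) - (1 / real n)\<^sup>2)
        + k / (real n - 1/2) * (\<delta>1 n - \<rho>0' n)) sequentially"
      using ev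
    proof eventually_elim
      case (elim n)
      have n1: "n - 1 - 1 = n - 2" "real (n - 1) = real n - 1" "n - 1 \<ge> 2" using elim by auto
      have "r n = \<mu> * \<Lambda> * (real n - 1/2) * r2 n + \<rho>0' n"
        using arg_cong[OF rec[of "n - 1"], of "\<lambda>y. y / w n"] elim n1
        by (simp add: r_def r2_def \<rho>0'_def add_divide_distrib)
      then have "(real n - 1/2) * r2 n = k * (r n - \<rho>0' n)" using k1 by algebra
      moreover have "real n - 1/2 \<noteq> 0" using elim by simp
      ultimately have "r2 n = k * (r n - \<rho>0' n) / (real n - 1/2)" by (simp add: eq_divide_eq mult.commute)
      moreover have "r n = k * (x n - (x n)\<^sup>2 / 2) + \<delta>1 n" by (simp add: \<delta>1_def algebra_simps)
      ultimately have "\<delta>2 n = k * (k * (x n - (x n)\<^sup>2 / 2) + \<delta>1 n - \<rho>0' n) / (real n - 1/2) - k\<^sup>2 * (x n)\<^sup>2"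
        by (simp add: \<delta>2_def)
      also have "\<dots> = k\<^sup>2 * ((x n - (x n)\<^sup>2 / 2) / (real n - 1/2) - (x n)\<^sup>2) + k / (real n - 1/2) * (\<delta>1 n - \<rho>0' n)"
      proof -
        have "k * (k * a + d - e) / y - k\<^sup>2 * b = k\<^sup>2 * (a / y - b) + k / y * (d - e)" for a b d e y :: real
          by (simp add: divide_inverse power2_eq_square algebra_simps)
        then show ?thesis .
      qed
      finally show ?case by (simp add: x_def)
    qed
    moreover have "(\<lambda>n. k\<^sup>2 * ((1 / real n - (1 / real n)\<^sup>2 / 2) / (real n - 1/2) - (1 / real n)\<^sup>2)
        + k / (real n - 1/2) * (\<delta>1 n - \<rho>0' n)) \<in> O(\<lambda>n. (1 / real n) ^ 3)"
    proof (rule sum_in_bigo(1))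
      have "(\<lambda>n::nat. (1 / real n - (1 / real n)\<^sup>2 / 2) / (real n - 1/2) - (1 / real n)\<^sup>2) \<in> O(\<lambda>n. (1 / real n) ^ 3)" by real_asymp
      then show "(\<lambda>n::nat. k\<^sup>2 * ((1 / real n - (1 / real n)\<^sup>2 / 2) / (real n - 1/2) - (1 / real n)\<^sup>2)) \<in> O(\<lambda>n. (1 / real n) ^ 3)"
        by (rule bigo_cmult)
      have "(\<lambda>n::nat. 1 / (real n - 1/2)) \<in> O(\<lambda>n. 1)" by real_asymp
      then have "(\<lambda>n::nat. k / (real n - 1/2)) \<in> O(\<lambda>n. 1)"
        using bigo_cmult[of _ _ k] by fastforce
      moreover have "(\<lambda>n. \<delta>1 n - \<rho>0' n) \<in> O(\<lambda>n. (1 / real n) ^ 3)"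
        unfolding \<rho>0'_def by (rule sum_in_bigo(2)[OF \<delta>1 R0'])
      ultimately show "(\<lambda>n. k / (real n - 1/2) * (\<delta>1 n - \<rho>0' n)) \<in> O(\<lambda>n. (1 / real n) ^ 3)"
        using landau_o.big.mult by fastforce
    qed
    ultimately show ?thesis by (subst landau_o.big.in_cong)
  qed

  have lin: "(\<lambda>n. a * real n + b) \<in> O(\<lambda>n. real n)" for a b :: real by real_asymp
  define X0 where "X0 = 3/2 * \<tau> + \<mu> * k2 * k\<^sup>2 + (1/12 - \<mu> / 24) * \<Lambda> * k"
  define Et where "Et = (\<lambda>n. \<mu> * (real n + 3/2) - 1/2 - \<tau> + X0 * x n)"
  define dE where "dE = (\<lambda>n. g n / w n - Et n)"
  have E_eq: "g n / w n = \<mu> * (real n - \<kappa> * (real n - 1) * r n + k2 * (real n - 2) * r2 n)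
        + (3/2 * \<mu> - 1/2) + (1/12 - \<mu> / 24) * \<Lambda> * r n + \<rho>1 n" if "w n \<noteq> 0" "n \<ge> 2" for n
    unfolding g[OF that(2)] r_def r2_def \<rho>1_def using that(1) by (simp add: add_divide_distrib diff_divide_distrib distrib_left right_diff_distrib)
  \<comment> \<open>One order beyond the claim on the mean: in the variance this error is multiplied
    by the mean, of order n.\<close>
  have dE: "dE \<in> O(\<lambda>n. (1 / real n) ^ 2)"
  proof -
    define c where "c = - \<mu> * \<kappa> * k / 2 - 2 * \<mu> * k2 * k\<^sup>2 - (1/12 - \<mu> / 24) * \<Lambda> * k / 2"
    have "eventually (\<lambda>n. dE n = c * x n ^ 2 + ((- \<mu> * \<kappa>) * real n + (\<mu> * \<kappa> + (1/12 - \<mu> / 24) * \<Lambda>)) * \<delta>1 n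
        + ((\<mu> * k2) * real n + (- 2 * \<mu> * k2)) * \<delta>2 n + \<rho>1 n) sequentially"
      using ev
    proof eventually_elim
      case (elim n)
      have nx: "real n * x n = 1" using elim by (simp add: x_def)
      have rn: "r n = k * x n - k * (x n)\<^sup>2 / 2 + \<delta>1 n" and r2n: "r2 n = k\<^sup>2 * (x n)\<^sup>2 + \<delta>2 n"
        by (simp_all add: \<delta>1_def \<delta>2_def)
      have e: "g n / w n = \<mu> * (real n - \<kappa> * (real n - 1) * r n + k2 * (real n - 2) * r2 n)
        + (3/2 * \<mu> - 1/2) + (1/12 - \<mu> / 24) * \<Lambda> * r n + \<rho>1 n" using E_eq elim by simp
      show ?case unfolding dE_def Et_def X0_def c_def e rn r2n tau by (rule mean_recentring_identity[OF nx])
    qed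
    moreover have "(\<lambda>n. c * x n ^ 2 + ((- \<mu> * \<kappa>) * real n + (\<mu> * \<kappa> + (1/12 - \<mu> / 24) * \<Lambda>)) * \<delta>1 n
        + ((\<mu> * k2) * real n + (- 2 * \<mu> * k2)) * \<delta>2 n + \<rho>1 n) \<in> O(\<lambda>n. (1 / real n) ^ 2)"
      using \<delta>1 \<delta>2 R1 unfolding \<rho>1_def
      by (intro sum_in_bigo(1) x_bigo O lin) (simp_all add: numeral_3_eq_3)
    ultimately show ?thesis by (subst landau_o.big.in_cong)
  qed
  have "(\<lambda>n. g n / w n - (\<mu> * (real n + 3/2) - 1/2 - \<tau>)) = (\<lambda>n. dE n + X0 * x n ^ 1)"
    by (simp add: dE_def Et_def fun_eq_iff)
  then show "(\<lambda>n. g n / w n - (\<mu> * (real n + 3/2) - 1/2 - \<tau>)) \<in> O(\<lambda>n. (1 / real n) ^ 1)"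
    using sum_in_bigo(1)[OF bigo_inverse_power_mono[OF dE, of 1] x_bigo[of X0 1]] by simp

  define c0 where "c0 = 15/4 * \<mu>\<^sup>2 - 9/4 * \<mu> + 5/12 - \<mu> / 12"
  define Mt where "Mt = (\<lambda>n. \<mu>\<^sup>2 * ((real n)\<^sup>2 - 2 * \<kappa> * k * real n + 4 * \<kappa> * k + (\<kappa>\<^sup>2 + 2 * k2) * k\<^sup>2)
      + (4 * \<mu>\<^sup>2 - 3/2 * \<mu>) * (real n - \<kappa> * k) + c0)"
  define dM where "dM = (\<lambda>n. h n / w n - Mt n)"
  have M_eq: "h n / w n = \<mu>\<^sup>2 * ((real n)\<^sup>2 - 2 * \<kappa> * (real n - 1)\<^sup>2 * r n
          + (\<kappa>\<^sup>2 + 2 * k2) * (real n - 2)\<^sup>2 * r2 n - \<kappa> * (real n - 1) * r n)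
        + (4 * \<mu>\<^sup>2 - 3/2 * \<mu>) * (real n - \<kappa> * (real n - 1) * r n) + c0 + \<rho>2 n" if "w n \<noteq> 0" "n \<ge> 2" for n
    unfolding h[OF that(2)] c0_def[symmetric] r_def r2_def \<rho>2_def using that(1)
    by (simp add: add_divide_distrib diff_divide_distrib distrib_left right_diff_distrib)
  have dM: "dM \<in> O(\<lambda>n. (1 / real n) ^ 1)"
  proof -
    define b where "b = 4 * \<mu>\<^sup>2 - 3/2 * \<mu>"
    define d where "d = \<kappa>\<^sup>2 + 2 * k2"
    define c1 where "c1 = - 4 * \<mu>\<^sup>2 * \<kappa> * k - 4 * \<mu>\<^sup>2 * d * k\<^sup>2 + 3/2 * \<mu>\<^sup>2 * \<kappa> * k + 3/2 * b * \<kappa> * k"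
    define c2 where "c2 = \<mu>\<^sup>2 * \<kappa> * k + 4 * \<mu>\<^sup>2 * d * k\<^sup>2 - \<mu>\<^sup>2 * \<kappa> * k / 2 - b * \<kappa> * k / 2"
    have "eventually (\<lambda>n. dM n = c1 * x n ^ 1 + c2 * x n ^ 2
        + (1 * real n + - 1) * (((- 2 * \<mu>\<^sup>2 * \<kappa>) * real n + (2 * \<mu>\<^sup>2 * \<kappa> - \<mu>\<^sup>2 * \<kappa> - b * \<kappa>)) * \<delta>1 n)
        + (1 * real n + - 2) * (((\<mu>\<^sup>2 * d) * real n + (- 2 * \<mu>\<^sup>2 * d)) * \<delta>2 n) + \<rho>2 n) sequentially"
      using ev
    proof eventually_elim
      case (elim n)
      have nx: "real n * x n = 1" using elim by (simp add: x_def)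
      have rn: "r n = k * x n - k * (x n)\<^sup>2 / 2 + \<delta>1 n" and r2n: "r2 n = k\<^sup>2 * (x n)\<^sup>2 + \<delta>2 n"
        by (simp_all add: \<delta>1_def \<delta>2_def)
      have e: "h n / w n = \<mu>\<^sup>2 * ((real n)\<^sup>2 - 2 * \<kappa> * (real n - 1)\<^sup>2 * r n
          + d * (real n - 2)\<^sup>2 * r2 n - \<kappa> * (real n - 1) * r n)
        + b * (real n - \<kappa> * (real n - 1) * r n) + c0 + \<rho>2 n" using M_eq elim by (simp add: d_def b_def)
      show ?case unfolding dM_def Mt_def c1_def c2_def e rn r2n d_def[symmetric] b_def[symmetric]
        by (rule second_moment_recentring_identity[OF nx])
    qed
    moreover have "(\<lambda>n. c1 * x n ^ 1 + c2 * x n ^ 2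
        + (1 * real n + - 1) * (((- 2 * \<mu>\<^sup>2 * \<kappa>) * real n + (2 * \<mu>\<^sup>2 * \<kappa> - \<mu>\<^sup>2 * \<kappa> - b * \<kappa>)) * \<delta>1 n)
        + (1 * real n + - 2) * (((\<mu>\<^sup>2 * d) * real n + (- 2 * \<mu>\<^sup>2 * d)) * \<delta>2 n) + \<rho>2 n) \<in> O(\<lambda>n. (1 / real n) ^ 1)"
      using \<delta>1 \<delta>2 R2 unfolding \<rho>2_def
      by (intro sum_in_bigo(1) x_bigo O lin bigo_inverse_power_mono[OF x_bigo[of c2 2]]) (simp_all add: numeral_3_eq_3)
    ultimately show ?thesis by (subst landau_o.big.in_cong)
  qed
  define Vt where "Vt = (\<lambda>n. (\<mu>\<^sup>2 - \<mu> / 2) * (real n + 3/2) + \<tau> / 2)"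
  have "eventually (\<lambda>n. h n / w n - (g n / w n)\<^sup>2 - Vt n =
     (- 2 * X0 * (3/2 * \<mu> - 1/2 - \<tau>)) * x n ^ 1 + (- X0\<^sup>2) * x n ^ 2 + dM n + (- 2 * Et n - dE n) * dE n) sequentially"
    using ev
  proof eventually_elim
    case (elim n)
    have nx: "real n * x n = 1" using elim by (simp add: x_def)
    have "Mt n - (Et n)\<^sup>2 - Vt n = (- 2 * X0 * (3/2 * \<mu> - 1/2 - \<tau>)) * x n ^ 1 + (- X0\<^sup>2) * x n ^ 2"
      unfolding Mt_def Et_def Vt_def c0_def by (rule variance_recentring_identity[OF nx k1 tau X0_def])
    moreover have "h n / w n = Mt n + dM n" "g n / w n = Et n + dE n" by (simp_all add: dM_def dE_def)
    ultimately show ?case by algebra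
  qed
  moreover have "(\<lambda>n. (- 2 * X0 * (3/2 * \<mu> - 1/2 - \<tau>)) * x n ^ 1 + (- X0\<^sup>2) * x n ^ 2 + dM n + (- 2 * Et n - dE n) * dE n)
      \<in> O(\<lambda>n. (1 / real n) ^ 1)"
  proof (intro sum_in_bigo(1) x_bigo dM bigo_inverse_power_mono[OF x_bigo[of "- X0\<^sup>2" 2]])
    have inv: "(\<lambda>n::nat. (1 / real n) ^ j) \<in> O(\<lambda>n. real n)" for j
    proof (rule bigoI[where c = 1], use eventually_gt_at_top[of 0] in eventually_elim)
      case (elim n)
      then have "(1 / real n) ^ j \<le> 1" by (intro power_le_one) auto
      also have "1 \<le> real n" using elim by simp
      finally show ?case by (simp add: power_abs)
    qed
    have "Et \<in> O(\<lambda>n. real n)"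
    proof -
      have "Et = (\<lambda>n. (\<mu> * real n + (\<mu> * (3/2) - 1/2 - \<tau>)) + X0 * x n ^ 1)" by (simp add: Et_def algebra_simps)
      then show ?thesis using sum_in_bigo(1)[OF lin landau_o.big_trans[OF x_bigo[of X0 1] inv]] by simp
    qed
    moreover have "dE \<in> O(\<lambda>n. real n)" by (rule landau_o.big_trans[OF dE inv])
    ultimately have "(\<lambda>n. - 2 * Et n - dE n) \<in> O(\<lambda>n. real n)"
      by (intro sum_in_bigo(2)) simp_all
    then show "(\<lambda>n. (- 2 * Et n - dE n) * dE n) \<in> O(\<lambda>n. (1 / real n) ^ 1)"
      using dE by (intro O) (simp_all add: numeral_2_eq_2)
  qed simp
  ultimately show "(\<lambda>n. h n / w n - (g n / w n)\<^sup>2 - ((\<mu>\<^sup>2 - \<mu> / 2) * (real n + 3/2) + \<tau> / 2)) \<in> O(\<lambda>n. (1 / real n) ^ 1)"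
    unfolding Vt_def by (subst landau_o.big.in_cong)
qed

section \<open>Moments of a law whose generating function is a polynomial\<close>

lemma poly_deriv_at_1:
  fixes p :: "real poly"
  shows "poly (pderiv p) 1 = (\<Sum>k\<le>degree p. real k * coeff p k)"
    and "poly (pderiv (pderiv p)) 1 + poly (pderiv p) 1 = (\<Sum>k\<le>degree p. (real k)\<^sup>2 * coeff p k)"
    and "poly p 1 = (\<Sum>k\<le>degree p. coeff p k)"
proof -
  have p: "p = (\<Sum>k\<le>degree p. monom (coeff p k) k)" by (simp add: poly_as_sum_of_monoms)
  have d1: "pderiv p = (\<Sum>k\<le>degree p. pderiv (monom (coeff p k) k))"
    by (subst p) (rule pderiv_sum')
  then show 1: "poly (pderiv p) 1 = (\<Sum>k\<le>degree p. real k * coeff p k)"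
    by (simp add: poly_sum pderiv_monom poly_monom)
  have "pderiv (pderiv p) = (\<Sum>k\<le>degree p. pderiv (pderiv (monom (coeff p k) k)))"
    unfolding d1 by (rule pderiv_sum')
  then have "poly (pderiv (pderiv p)) 1 = (\<Sum>k\<le>degree p. real (k - 1) * (real k * coeff p k))"
    by (simp add: poly_sum pderiv_monom poly_monom)
  then have "poly (pderiv (pderiv p)) 1 + poly (pderiv p) 1
      = (\<Sum>k\<le>degree p. real (k - 1) * (real k * coeff p k) + real k * coeff p k)"
    by (simp add: 1 sum.distrib)
  also have "\<dots> = (\<Sum>k\<le>degree p. (real k)\<^sup>2 * coeff p k)"
  proof (intro sum.cong refl)
    fix k show "real (k - 1) * (real k * coeff p k) + real k * coeff p k = (real k)\<^sup>2 * coeff p k"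
      by (cases k) (simp_all add: power2_eq_square algebra_simps)
  qed
  finally show "poly (pderiv (pderiv p)) 1 + poly (pderiv p) 1 = (\<Sum>k\<le>degree p. (real k)\<^sup>2 * coeff p k)" .
  show "poly p 1 = (\<Sum>k\<le>degree p. coeff p k)" by (simp add: poly_altdef)
qed

text \<open>The law bounds X by d only almost surely, so f composed with X is replaced almost
  everywhere by a finite combination of indicators.\<close>

lemma has_bochner_integral_finite_law:
  fixes f :: "nat \<Rightarrow> real"
  assumes "prob_space M" and X: "X \<in> M \<rightarrow>\<^sub>M count_space UNIV"
    and law: "\<And>k. measure M {\<omega> \<in> space M. X \<omega> = k} = p k" and fin: "\<And>k. k > d \<Longrightarrow> p k = 0"
  shows "has_bochner_integral M (\<lambda>\<omega>. f (X \<omega>)) (\<Sum>k\<le>d. f k * p k)"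
proof -
  interpret prob_space M by fact
  define A where "A = (\<lambda>k. {\<omega> \<in> space M. X \<omega> = k})"
  have A: "A k \<in> sets M" for k
    using measurable_sets[OF X, of "{k}"] by (simp add: A_def vimage_def Int_def conj_commute)
  have "AE \<omega> in M. X \<omega> \<noteq> k" if "k > d" for k
  proof -
    have "prob (A k) = 0" using law[of k] fin[OF that] by (simp add: A_def)
    then have "AE \<omega> in M. \<omega> \<notin> A k" using A[of k] by (simp add: prob_eq_0)
    then show ?thesis using AE_space by eventually_elim (auto simp: A_def)
  qed
  then have "AE \<omega> in M. \<forall>k. k > d \<longrightarrow> X \<omega> \<noteq> k" by (simp add: AE_all_countable)
  then have ae: "AE \<omega> in M. f (X \<omega>) = (\<Sum>k\<le>d. f k * indicator (A k) \<omega>)"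
    using AE_space
  proof eventually_elim
    case (elim \<omega>)
    then have "\<not> X \<omega> > d" by blast
    then have "X \<omega> \<le> d" by simp
    have "(\<Sum>k\<le>d. f k * indicator (A k) \<omega>) = (\<Sum>k\<le>d. if k = X \<omega> then f k else 0)"
      using elim by (intro sum.cong) (auto simp: A_def)
    then show ?case using \<open>X \<omega> \<le> d\<close> by simp
  qed
  have "has_bochner_integral M (\<lambda>\<omega>. \<Sum>k\<le>d. f k * indicator (A k) \<omega>) (\<Sum>k\<le>d. f k * measure M (A k))"
    by (intro has_bochner_integral_sum has_bochner_integral_mult_right has_bochner_integral_real_indicator A)
       (simp add: emeasure_eq_measure)
  then have "has_bochner_integral M (\<lambda>\<omega>. \<Sum>k\<le>d. f k * indicator (A k) \<omega>) (\<Sum>k\<le>d. f k * p k)"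
    by (simp add: A_def law)
  moreover have "(\<lambda>\<omega>. f (X \<omega>)) \<in> borel_measurable M"
    by (rule measurable_compose[OF X]) simp
  ultimately show ?thesis
    by (subst has_bochner_integral_cong_AE[OF _ _ ae]) (use A in \<open>auto dest: has_bochner_integral_integrable\<close>)
qed

lemma moments_of_polynomial_law:
  fixes p :: "real poly"
  assumes M: "prob_space M" and X: "X \<in> M \<rightarrow>\<^sub>M count_space UNIV"
    and law: "\<And>k. measure M {\<omega> \<in> space M. X \<omega> = k} = coeff p k / poly p 1"
  shows "prob_space.expectation M (\<lambda>\<omega>. real (X \<omega>)) = poly (pderiv p) 1 / poly p 1"
    and "prob_space.variance M (\<lambda>\<omega>. real (X \<omega>)) =
      (poly (pderiv (pderiv p)) 1 + poly (pderiv p) 1) / poly p 1 - (poly (pderiv p) 1 / poly p 1)\<^sup>2"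
proof -
  interpret prob_space M by fact
  have fin: "coeff p k / poly p 1 = 0" if "k > degree p" for k using that by (simp add: coeff_eq_0)
  note I = has_bochner_integral_finite_law[OF M X law fin]
  have 1: "has_bochner_integral M (\<lambda>\<omega>. real (X \<omega>)) (poly (pderiv p) 1 / poly p 1)"
    using I[of "degree p" real] by (simp add: poly_deriv_at_1(1) sum_divide_distrib)
  have 2: "has_bochner_integral M (\<lambda>\<omega>. (real (X \<omega>))\<^sup>2) ((poly (pderiv (pderiv p)) 1 + poly (pderiv p) 1) / poly p 1)"
    using I[of "degree p" "\<lambda>k. (real k)\<^sup>2"] by (simp add: poly_deriv_at_1(2) sum_divide_distrib)
  show E: "expectation (\<lambda>\<omega>. real (X \<omega>)) = poly (pderiv p) 1 / poly p 1"
    using 1 by (rule has_bochner_integral_integral_eq)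
  show "variance (\<lambda>\<omega>. real (X \<omega>)) =
      (poly (pderiv (pderiv p)) 1 + poly (pderiv p) 1) / poly p 1 - (poly (pderiv p) 1 / poly p 1)\<^sup>2"
    by (subst variance_eq) (use 1 2 in \<open>auto simp: E has_bochner_integral_iff\<close>)
qed

theorem theorem1p2:
  fixes lam :: "nat \<Rightarrow> real"
    and M :: "nat \<Rightarrow> 'a measure"
    and X :: "nat \<Rightarrow> 'a \<Rightarrow> nat"
  assumes analytic: "fps_conv_radius (Lambda_fps lam) > 0"
    and lam_nonneg: "\<And>j. j \<ge> 1 \<Longrightarrow> lam j \<ge> 0"
    and lam_1: "lam 1 > 0"
    and prob: "\<And>n. prob_space (M n)"
    and rv: "\<And>n. X n \<in> M n \<rightarrow>\<^sub>M count_space UNIV"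
    and law: "\<And>n k. measure (M n) {\<omega> \<in> space (M n). X n \<omega> = k} =
                coeff (Fishburn_poly lam n) k / poly (Fishburn_poly lam n) 1"
  shows "let \<mu> = 6 / pi\<^sup>2; \<sigma>2 = 3 * (12 - pi\<^sup>2) / pi ^ 4 in
    (\<lambda>n. prob_space.expectation (M n) (\<lambda>\<omega>. real (X n \<omega>))
        - (\<mu> * (real n + 3 / 2) - lam 2 / (lam 1)\<^sup>2)) \<in> O(\<lambda>n. 1 / real n) \<and>
    (\<lambda>n. prob_space.variance (M n) (\<lambda>\<omega>. real (X n \<omega>))
        - (\<sigma>2 * (real n + 3 / 2) - 1 / 4 + lam 2 / (2 * (lam 1)\<^sup>2))) \<in> O(\<lambda>n. 1 / real n)"
proof -
  define s where "s = (\<lambda>n. fish_a n * lam 1 ^ n)"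
  define \<kappa> where "\<kappa> = lam 2 / lam 1 - lam 1 / 2"
  define W where "W = fps_at1 (Fishburn_gf lam)"
  define G where "G = fps_d1 (Fishburn_gf lam)"
  define H where "H = fps_d2 (Fishburn_gf lam) + G"
  have sn: "fish_a n * lam 1 ^ n = s n" for n by (simp add: s_def)
  obtain C R0 R1 R2 k2 where C: "C \<noteq> 0" "(\<lambda>n. W $ n / s n) \<longlonglongrightarrow> C"
    and R: "fps_bigo s (-2) R0" "fps_bigo s (-2) R1" "fps_bigo s (-1) R2"
    and rec: "\<And>n. n \<ge> 2 \<Longrightarrow> W $ n = fish_mu * lam 1 * (real n + 1/2) * W $ (n - 1) + R0 $ n"
    and G: "\<And>n. n \<ge> 2 \<Longrightarrow> G $ n = fish_mu * (real n * W $ n - \<kappa> * (real n - 1) * W $ (n - 1) + k2 * (real n - 2) * W $ (n - 2))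
        + (3/2 * fish_mu - 1/2) * W $ n + (1/12 - fish_mu / 24) * lam 1 * W $ (n - 1) + R1 $ n"
    and H: "\<And>n. n \<ge> 2 \<Longrightarrow> H $ n = fish_mu\<^sup>2 * ((real n)\<^sup>2 * W $ n - 2 * \<kappa> * (real n - 1)\<^sup>2 * W $ (n - 1)
          + (\<kappa>\<^sup>2 + 2 * k2) * (real n - 2)\<^sup>2 * W $ (n - 2) - \<kappa> * (real n - 1) * W $ (n - 1))
        + (4 * fish_mu\<^sup>2 - 3/2 * fish_mu) * (real n * W $ n - \<kappa> * (real n - 1) * W $ (n - 1))
        + (15/4 * fish_mu\<^sup>2 - 9/4 * fish_mu + 5/12 - fish_mu / 12) * W $ n + R2 $ n"
    using Fishburn_moment_coefficients[of lam, OF analytic lam_1, folded W_def G_def, folded H_def s_def \<kappa>_def, unfolded sn]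
    by blast
  have s: "fact_growth (1 / fish_mu / lam 1) s"
    unfolding s_def by (rule fact_growth_scale[OF fish_a_growth lam_1])
  have ratio: "(\<lambda>n. Z $ n / W $ n) \<in> O(\<lambda>n. (1 / real n) ^ j)" if "fps_bigo s (- real j) Z" for Z j
    by (rule fps_bigo_ratio[OF that C(2,1) s])
  \<comment> \<open>The index shift is multiplication by X, which gains the third power of
    1/n.\<close>
  have R0': "(\<lambda>n. R0 $ (n - 1) / W $ n) \<in> O(\<lambda>n. (1 / real n) ^ 3)"
  proof -
    have XR: "(\<lambda>n. (fps_X * R0) $ n / W $ n) \<in> O(\<lambda>n. (1 / real n) ^ 3)"
      using fps_bigo_X[OF R(1) s] by (intro ratio) simp
    have ev: "eventually (\<lambda>n. (fps_X * R0) $ n / W $ n = R0 $ (n - 1) / W $ n) sequentially"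
      using eventually_gt_at_top[of 0] by eventually_elim simp
    show ?thesis using XR landau_o.big.in_cong[OF ev] by blast
  qed
  have Wnz: "eventually (\<lambda>n. W $ n \<noteq> 0) sequentially"
    using tendsto_imp_eventually_ne[OF C(2,1)] by eventually_elim auto
  \<comment> \<open>The 1/2 here cancels the -1/2 in the expansion of the mean, and half of it is
    the -1/4 in the variance.\<close>
  have tau: "\<kappa> / lam 1 = lam 2 / (lam 1)\<^sup>2 - 1 / 2"
    using lam_1 by (simp add: \<kappa>_def diff_divide_distrib power2_eq_square)
  have ratios: "(\<lambda>n. R0 $ n / W $ n) \<in> O(\<lambda>n. (1 / real n) ^ 2)" "(\<lambda>n. R1 $ n / W $ n) \<in> O(\<lambda>n. (1 / real n) ^ 2)"
    "(\<lambda>n. R2 $ n / W $ n) \<in> O(\<lambda>n. (1 / real n) ^ 1)"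
    using ratio[of 2 R0] ratio[of 2 R1] ratio[of 1 R2] R by simp_all
  note main = moment_expansion[of fish_mu "lam 1" "\<lambda>n. W $ n" "\<lambda>n. R0 $ n" "\<lambda>n. G $ n" \<kappa> k2 "\<lambda>n. R1 $ n" "\<lambda>n. H $ n" "\<lambda>n. R2 $ n",
      OF fish_mu_pos lam_1 Wnz rec G H ratios(1) R0' ratios(2,3), unfolded tau power_one_right]
  have E: "prob_space.expectation (M n) (\<lambda>\<omega>. real (X n \<omega>)) = G $ n / W $ n"
    and V: "prob_space.variance (M n) (\<lambda>\<omega>. real (X n \<omega>)) = H $ n / W $ n - (G $ n / W $ n)\<^sup>2" for n
    using moments_of_polynomial_law[OF prob rv law, of n]
    by (simp_all add: W_def G_def H_def fps_dv_defs Fishburn_poly_def)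
  have sigma: "fish_mu\<^sup>2 - fish_mu / 2 = 3 * (12 - pi\<^sup>2) / pi ^ 4"
  proof -
    have "fish_mu / 2 = 3 * pi\<^sup>2 / pi ^ 4" by (simp add: fish_mu_def power2_eq_square power4_eq_xxxx)
    moreover have "fish_mu\<^sup>2 = 36 / pi ^ 4" by (simp add: fish_mu_def power_divide)
    ultimately show ?thesis by (simp add: diff_divide_distrib right_diff_distrib)
  qed
  have "(\<lambda>n. G $ n / W $ n - (6 / pi\<^sup>2 * (real n + 3 / 2) - lam 2 / (lam 1)\<^sup>2)) \<in> O(\<lambda>n. 1 / real n)"
  proof -
    have e: "a - 1/2 - (t - 1/2) = a - t" for a t :: real by simp
    show ?thesis using main(1) unfolding e fish_mu_def .
  qed
  moreover have "(\<lambda>n. H $ n / W $ n - (G $ n / W $ n)\<^sup>2 -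
      (3 * (12 - pi\<^sup>2) / pi ^ 4 * (real n + 3 / 2) - 1 / 4 + lam 2 / (2 * (lam 1)\<^sup>2))) \<in> O(\<lambda>n. 1 / real n)"
  proof -
    have e: "c * y + (t - 1/2) / 2 = c * y - 1/4 + t / 2" for c y t :: real by (simp add: diff_divide_distrib)
    have f: "lam 2 / (lam 1)\<^sup>2 / 2 = lam 2 / (2 * (lam 1)\<^sup>2)" by simp
    show ?thesis using main(2) unfolding sigma e f .
  qed
  ultimately show ?thesis unfolding Let_def V unfolding E ..
qed

end
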